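(* Let $\mathcal P\subset\mathcal M_1(\Omega,\mathcal A)$ be a nonempty family of probability measures, $k:\mathcal P\to\mathbb R$ a functional differentiable at $P_0\in\mathcal P$ with canonical gradient $\widetilde k$ satisfying $\int\widetilde k^2\,dP_0\neq0$, and $\alpha\in(0,1)$. Suppose $K(P_0,\mathcal P)=T(P_0,\mathcal P)$. Then the test sequence $(\varphi_n)_n$ on $\Omega^n$ given by $$\varphi_n=1\ \text{ if }\ \Bigl|\frac1{\sqrt n}\sum_{i=1}^n\widetilde k(\omega_i)\Bigr|>u_{1-\frac\alpha2}\|\widetilde k\|_{L_2(P_0)},\qquad\varphi_n=0\ \text{ otherwise,}$$ is asymptotically optimal in the set of all test sequences for $\mathcal H_4$ against $\mathcal K_4$ that are asymptotically unbiased at level $\alpha$.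
   Context: $\Phi$ is the standard normal distribution function, $u_{p}=\Phi^{-1}(p)$; tests are measurable $[0,1]$-valued functions. $L_2^{(0)}(P)=\{h\in L_2(P):\int h\,dP=0\}$. With $dP/dQ$ the density quotient (a $[0,\infty]$-valued measurable $L$ with $P(A)=\int_AL\,dQ+P(A\cap\{L=\infty\})$, $Q(L<\infty)=1$), a curve $t\mapsto P_t$, $|t|<\varepsilon$, in $\mathcal P$ is $L_2(P_0)$-differentiable with tangent $g\in L_2(P_0)$ if $\|2((dP_t/dP_0)^{1/2}-1)-tg\|_{L_2(P_0)}=o(|t|)$ and $P_t(dP_t/dP_0=\infty)=o(t^2)$ as $t\to0$. The tangent cone $K(P_0,\mathcal P)\subset L_2^{(0)}(P_0)$ is the set of tangents of all such curves in $\mathcal P$ through $P_0$ at $t=0$; the tangent space $T(P_0,\mathcal P)$ is the $L_2(P_0)$-closure of its linear span. $k$ is differentiable at $P_0$ with gradient $\dot k\in L_2^{(0)}(P_0)$ if $\lim_{t\downarrow0}t^{-1}(k(P_t)-k(P_0))=\int\dot kg\,dP_0$ for each such curve with tangent $g$; the canonical gradient $\widetilde k$ is the unique gradient in $T(P_0,\mathcal P)$. $\mathcal F_1$ is the set of sequences $(P_{t_n})_n$ (identified with the sequences of product measures $(P_{t_n}^n)_n$) such that $t_n\to0$, $\lim_nt_n\sqrt n>0$, and there are $\varepsilon>0$ and an $L_2(P_0)$-differentiable curve $f:(-\varepsilon,\varepsilon)\to\mathcal P$, $t\mapsto P_t$ (through $P_0$ at $t=0$) with $f(t_n)=P_{t_n}$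 for all $n$. Implicit alternatives: $\mathcal K_4=\{(P_{t_n}^n)_n\in\mathcal F_1:\lim_n\sqrt n(k(P_{t_n})-k(P_0))\ne0\}$; implicit hypotheses: $\mathcal H_4=\{(P_{t_n}^n)_n\in\mathcal F_1:\lim_n\sqrt n(k(P_{t_n})-k(P_0))=0\}$. A sequence of tests $\psi_n$ on $\Omega^n$ is asymptotically unbiased at level $\alpha$ for $\mathcal H_4$ against $\mathcal K_4$ if $\limsup_n\int\psi_n\,dP_{t_n}^n\le\alpha$ for all $(P_{t_n}^n)_n\in\mathcal H_4$ and $\liminf_n\int\psi_n\,dP_{t_n}^n\ge\alpha$ for all $(P_{t_n}^n)_n\in\mathcal K_4$. "$(\varphi_n)$ is asymptotically optimal" in this class means: $(\varphi_n)$ belongs to the class, and for every $(\psi_n)$ in the class, $\limsup_n\int\psi_n\,dP_{t_n}^n\le\lim_n\int\varphi_n\,dP_{t_n}^n$ for all $(P_{t_n}^n)_n\in\mathcal F_1$ (the limit for $\varphi_n$ existing). *)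

theory Defs
  imports "HOL-Probability.Probability" "HOL-Library.Landau_Symbols"
begin

text \<open>
  The set of all probability measures on a measurable space \<open>M\<close> is \<open>space (prob_algebra M)\<close>.
  Elements of \<open>L\<^sub>2(P)\<close> are represented by measurable functions; all subsets of \<open>L\<^sub>2(P)\<close> below
  are closed under almost sure equality, so equalities between them have the usual meaning.
\<close>

definition L2 :: "'a measure \<Rightarrow> ('a \<Rightarrow> real) set" where
  "L2 P = {h \<in> borel_measurable P. integrable P (\<lambda>x. (h x)\<^sup>2)}"

definition L2_zero :: "'a measure \<Rightarrow> ('a \<Rightarrow> real) set" where
  "L2_zero P = {h \<in> L2 P. (\<integral>x. h x \<partial>P) = 0}"

definition L2_norm :: "'a measure \<Rightarrow> ('a \<Rightarrow> real) \<Rightarrow> real" where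
  "L2_norm P h = sqrt (\<integral>x. (h x)\<^sup>2 \<partial>P)"

definition density_quotient :: "'a measure \<Rightarrow> 'a measure \<Rightarrow> ('a \<Rightarrow> ennreal) \<Rightarrow> bool" where
  "density_quotient P Q L \<longleftrightarrow>
     L \<in> borel_measurable Q \<and>
     (\<forall>A\<in>sets Q. emeasure P A = (\<integral>\<^sup>+x\<in>A. L x \<partial>Q) + emeasure P (A \<inter> {x. L x = \<infinity>})) \<and>
     measure Q {x \<in> space Q. L x < \<infinity>} = 1"

text \<open>
  \<open>L t\<close> is a version of \<open>dP\<^sub>t/dP\<^sub>0\<close>; it exists and is \<open>(P\<^sub>t + P\<^sub>0)\<close>-a.e. unique, so the choice of
  version is irrelevant. Since \<open>L t\<close> is \<open>P\<^sub>0\<close>-a.e. finite and has \<open>P\<^sub>0\<close>-integral at most 1,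
  \<open>enn2real\<close> loses nothing and the integral in the \<open>L2_norm\<close> is that of an integrable function.
  The values of \<open>f\<close> outside \<open>(-\<epsilon>, \<epsilon>)\<close> are irrelevant.
\<close>

definition L2_diff_curve ::
  "'a measure set \<Rightarrow> 'a measure \<Rightarrow> real \<Rightarrow> (real \<Rightarrow> 'a measure) \<Rightarrow> ('a \<Rightarrow> real) \<Rightarrow> bool" where
  "L2_diff_curve \<P> P0 \<epsilon> f g \<longleftrightarrow>
     \<epsilon> > 0 \<and> (\<forall>t. \<bar>t\<bar> < \<epsilon> \<longrightarrow> f t \<in> \<P>) \<and> f 0 = P0 \<and> g \<in> L2 P0 \<and>
     (\<exists>L. (\<forall>t. \<bar>t\<bar> < \<epsilon> \<longrightarrow> density_quotient (f t) P0 (L t)) \<and>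
        (\<lambda>t. L2_norm P0 (\<lambda>x. 2 * (sqrt (enn2real (L t x)) - 1) - t * g x)) \<in> o[at 0](\<lambda>t. \<bar>t\<bar>) \<and>
        (\<lambda>t. measure (f t) {x \<in> space (f t). L t x = \<infinity>}) \<in> o[at 0](\<lambda>t. t\<^sup>2))"

definition tangent_cone :: "'a measure \<Rightarrow> 'a measure set \<Rightarrow> ('a \<Rightarrow> real) set" where
  "tangent_cone P0 \<P> = {g. \<exists>\<epsilon> f. L2_diff_curve \<P> P0 \<epsilon> f g}"

definition fun_span :: "('a \<Rightarrow> real) set \<Rightarrow> ('a \<Rightarrow> real) set" where
  "fun_span S = {(\<lambda>x. \<Sum>g\<in>F. c g * g x) | F c. finite F \<and> F \<subseteq> S}"

definition L2_closure :: "'a measure \<Rightarrow> ('a \<Rightarrow> real) set \<Rightarrow> ('a \<Rightarrow> real) set" where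
  "L2_closure P S = {h \<in> L2 P. \<forall>e>0. \<exists>s\<in>S. L2_norm P (\<lambda>x. h x - s x) < e}"

definition tangent_space :: "'a measure \<Rightarrow> 'a measure set \<Rightarrow> ('a \<Rightarrow> real) set" where
  "tangent_space P0 \<P> = L2_closure P0 (fun_span (tangent_cone P0 \<P>))"

definition is_gradient ::
  "'a measure \<Rightarrow> 'a measure set \<Rightarrow> ('a measure \<Rightarrow> real) \<Rightarrow> ('a \<Rightarrow> real) \<Rightarrow> bool" where
  "is_gradient P0 \<P> k kd \<longleftrightarrow>
     kd \<in> L2_zero P0 \<and>
     (\<forall>\<epsilon> f g. L2_diff_curve \<P> P0 \<epsilon> f g \<longrightarrow>
        ((\<lambda>t. (k (f t) - k P0) / t) \<longlongrightarrow> (\<integral>x. kd x * g x \<partial>P0)) (at_right 0))"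

definition is_canonical_gradient ::
  "'a measure \<Rightarrow> 'a measure set \<Rightarrow> ('a measure \<Rightarrow> real) \<Rightarrow> ('a \<Rightarrow> real) \<Rightarrow> bool" where
  "is_canonical_gradient P0 \<P> k kc \<longleftrightarrow> is_gradient P0 \<P> k kc \<and> kc \<in> tangent_space P0 \<P>"

text \<open>
  Sequences are indexed by \<open>n \<ge> 1\<close>; the value at index 0 is unconstrained and irrelevant.
  A sequence of product measures is represented by the sequence of its marginals. The limit of
  \<open>t\<^sub>n \<surd>n\<close> is a real number.
\<close>

definition F1 :: "'a measure \<Rightarrow> 'a measure set \<Rightarrow> (nat \<Rightarrow> 'a measure) set" where
  "F1 P0 \<P> = {Q. \<exists>t. t \<longlonglongrightarrow> 0 \<and> (\<exists>c>0. (\<lambda>n. t n * sqrt (real n)) \<longlonglongrightarrow> c) \<and>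
     (\<exists>\<epsilon> f g. L2_diff_curve \<P> P0 \<epsilon> f g \<and> (\<forall>n\<ge>1. \<bar>t n\<bar> < \<epsilon> \<and> Q n = f (t n)))}"

definition K4 :: "'a measure \<Rightarrow> 'a measure set \<Rightarrow> ('a measure \<Rightarrow> real) \<Rightarrow> (nat \<Rightarrow> 'a measure) set" where
  "K4 P0 \<P> k = {Q \<in> F1 P0 \<P>. \<exists>c. c \<noteq> 0 \<and> (\<lambda>n. sqrt (real n) * (k (Q n) - k P0)) \<longlonglongrightarrow> c}"

definition H4 :: "'a measure \<Rightarrow> 'a measure set \<Rightarrow> ('a measure \<Rightarrow> real) \<Rightarrow> (nat \<Rightarrow> 'a measure) set" where
  "H4 P0 \<P> k = {Q \<in> F1 P0 \<P>. (\<lambda>n. sqrt (real n) * (k (Q n) - k P0)) \<longlonglongrightarrow> 0}"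

abbreviation prod_power :: "nat \<Rightarrow> 'a measure \<Rightarrow> (nat \<Rightarrow> 'a) measure" where
  "prod_power n P \<equiv> PiM {..<n} (\<lambda>_. P)"

definition is_test :: "'b measure \<Rightarrow> ('b \<Rightarrow> real) \<Rightarrow> bool" where
  "is_test N \<psi> \<longleftrightarrow> \<psi> \<in> borel_measurable N \<and> (\<forall>\<omega>\<in>space N. 0 \<le> \<psi> \<omega> \<and> \<psi> \<omega> \<le> 1)"

definition test_power ::
  "(nat \<Rightarrow> (nat \<Rightarrow> 'a) \<Rightarrow> real) \<Rightarrow> (nat \<Rightarrow> 'a measure) \<Rightarrow> nat \<Rightarrow> real" where
  "test_power \<psi> Q n = (\<integral>\<omega>. \<psi> n \<omega> \<partial>(prod_power n (Q n)))"

definition asymp_unbiased ::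
  "'a measure \<Rightarrow> real \<Rightarrow> (nat \<Rightarrow> 'a measure) set \<Rightarrow> (nat \<Rightarrow> 'a measure) set \<Rightarrow>
    (nat \<Rightarrow> (nat \<Rightarrow> 'a) \<Rightarrow> real) set" where
  "asymp_unbiased M \<alpha> H K = {\<psi>.
     (\<forall>n\<ge>1. is_test (prod_power n M) (\<psi> n)) \<and>
     (\<forall>Q\<in>H. limsup (\<lambda>n. ereal (test_power \<psi> Q n)) \<le> ereal \<alpha>) \<and>
     (\<forall>Q\<in>K. liminf (\<lambda>n. ereal (test_power \<psi> Q n)) \<ge> ereal \<alpha>)}"

definition asymp_optimal_in ::
  "(nat \<Rightarrow> 'a measure) set \<Rightarrow> (nat \<Rightarrow> (nat \<Rightarrow> 'a) \<Rightarrow> real) set \<Rightarrow>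
    (nat \<Rightarrow> (nat \<Rightarrow> 'a) \<Rightarrow> real) \<Rightarrow> bool" where
  "asymp_optimal_in F C \<phi> \<longleftrightarrow>
     \<phi> \<in> C \<and>
     (\<forall>\<psi>\<in>C. \<forall>Q\<in>F. convergent (test_power \<phi> Q) \<and>
        limsup (\<lambda>n. ereal (test_power \<psi> Q n)) \<le> ereal (lim (test_power \<phi> Q)))"

definition std_normal_quantile :: "real \<Rightarrow> real" where
  "std_normal_quantile = inv (cdf std_normal_distribution)"

definition two_sided_test ::
  "'a measure \<Rightarrow> ('a \<Rightarrow> real) \<Rightarrow> real \<Rightarrow> nat \<Rightarrow> (nat \<Rightarrow> 'a) \<Rightarrow> real" where
  "two_sided_test P0 kc \<alpha> n \<omega> =
     (if \<bar>1 / sqrt (real n) * (\<Sum>i<n. kc (\<omega> i))\<bar>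
           > std_normal_quantile (1 - \<alpha> / 2) * L2_norm P0 kc
      then 1 else 0)"

end

theory Submission
  imports Defs "HOL-Real_Asymp.Real_Asymp"
begin

text \<open>
  Write \<open>\<kappa>\<close> for the normalised canonical gradient. Since the tangent cone is linear, it contains for
  every tangent \<open>h = \<eta> + s \<kappa>\<close>, with \<open>\<eta>\<close> orthogonal to \<open>\<kappa>\<close>, the whole line \<open>\<eta> + r \<kappa>\<close>; the point \<open>r = 0\<close>
  is an implicit hypothesis and the points \<open>r \<noteq> 0\<close> are implicit alternatives. Up to an arbitrarily
  small error in total variation (controlled by Hellinger affinities), the local product measures
  may be replaced by products of exponential tilts \<open>exp (h' / sqrt n)\<close> of \<open>P0\<close> with bounded \<open>h'\<close> near
  \<open>h\<close>. Tilted products have likelihood ratios depending on \<open>\<Sum> h' / sqrt n\<close> alone, up to constants, which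
  gives both their normal limits and, along the line, an exact comparison of tests: the generalised
  Neyman--Pearson lemma for the three points \<open>s\<close>, \<open>0\<close>, \<open>- d\<close>. Letting \<open>d\<close> tend to 0 turns the two
  unbiasedness conditions into the condition that the power function is stationary at \<open>0\<close>,
  and the bound into the power of the two-sided test.
\<close>

section \<open>The normal distribution and the power of the two-sided Gauss test\<close>

text \<open>A general score is only square integrable, so \<open>exp (h / sqrt n)\<close> may have
  infinite mean; boundedness of the replacing score is what makes the tilts exist. The price is an
  error bound that is the same for all tests, so that no weak limits of tests, compactness or limit
  experiment occur. For \<open>d\<close> on the same side of 0 as \<open>s\<close>, the quantity
  that is maximised is power(s) - c power(0) + \<mu> power(-d). The hypothesis bounds the power at 0
  from above and the alternative bounds the power at -d from below, so both weights have to be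
  positive. Inserting the level \<alpha> twice leaves the bound beta(s) + \<mu> (beta(-d) -
  beta(0)), where beta is \<open>gauss_power u\<close> and beta(0) = \<alpha>; the terms with c
  cancel. Now \<mu> grows like 1/d, but beta is even and differentiable, so beta(-d) - beta(0) =
  o(d) and the excess vanishes. Because the weights blow up, the order of the limits is forced: the
  sample size first, then the approximation of the scores for a fixed \<open>d\<close>, and
  \<open>d\<close> last.\<close>

definition std_normal_cdf :: "real \<Rightarrow> real" where
  "std_normal_cdf = cdf std_normal_distribution"

interpretation std_normal: real_distribution std_normal_distribution
  by (rule real_dist_normal_dist)

lemma std_normal_cdf_diff:
  assumes "a \<le> b"
  shows "std_normal_cdf b - std_normal_cdf a = integral {a..b} std_normal_density"
proof (cases "a = b")
  case False
  with assms have ab: "a < b" by simp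
  have "std_normal_cdf b - std_normal_cdf a = measure std_normal_distribution {a<..b}"
    unfolding std_normal_cdf_def by (rule std_normal.cdf_diff_eq[OF ab])
  also have "\<dots> = (\<integral>x. indicator {a<..b} x \<partial>std_normal_distribution)"
    by simp
  also have "\<dots> = (\<integral>x. std_normal_density x * indicator {a<..b} x \<partial>lborel)"
    by (subst integral_density) (auto simp: normal_density_nonneg)
  also have "\<dots> = (\<integral>x\<in>{a..b}. std_normal_density x \<partial>lborel)"
    unfolding set_lebesgue_integral_def
    by (intro integral_cong_AE eventually_mono[OF AE_lborel_singleton[of a]])
       (auto simp: indicator_def)
  also have "\<dots> = integral {a..b} std_normal_density"
    by (intro set_borel_integral_eq_integral(2))
       (auto simp: set_integrable_def simp del: real_scaleR_def intro!: integrable_mult_indicator)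
  finally show ?thesis .
qed simp

text \<open>Near \<open>y\<close> the distribution function is a constant plus an integral from
  \<open>y-1\<close>, so the fundamental theorem of calculus applies. The chain rule is built in so
  that the lemma can serve as a derivative rule.\<close>

lemma std_normal_cdf_deriv [derivative_intros]:
  assumes "(f has_field_derivative f') (at x within A)"
  shows "((\<lambda>x. std_normal_cdf (f x)) has_field_derivative std_normal_density (f x) * f')
    (at x within A)"
proof -
  have "(std_normal_cdf has_real_derivative std_normal_density y) (at y)" for y
  proof -
    have cont: "continuous_on {y-1..y+1} std_normal_density"
      unfolding normal_density_def by (intro continuous_intros) auto
    have "((\<lambda>u. integral {y-1..u} std_normal_density) has_real_derivative std_normal_density y)
        (at y within {y-1..y+1})"
      by (rule integral_has_real_derivative[OF cont]) auto
    then have "((\<lambda>u. integral {y-1..u} std_normal_density) has_real_derivative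
        std_normal_density y) (at y)"
      by (simp add: at_within_Icc_at)
    then have "((\<lambda>u. std_normal_cdf (y-1) + integral {y-1..u} std_normal_density)
        has_real_derivative 0 + std_normal_density y) (at y)"
      by (intro DERIV_add) auto
    moreover have "\<forall>\<^sub>F u in nhds y. std_normal_cdf u =
        std_normal_cdf (y-1) + integral {y-1..u} std_normal_density"
      using eventually_nhds_in_open[of "{y-1<..}" y]
      by (rule eventually_mono) (auto simp: std_normal_cdf_diff[symmetric])
    ultimately show ?thesis
      using DERIV_cong_ev[OF refl _ refl, of std_normal_cdf] by simp
  qed
  then show ?thesis
    using assms by (rule DERIV_chain2)
qed

lemma std_normal_density_uminus: "std_normal_density (- x) = std_normal_density x"
  by (simp add: std_normal_density_def)

lemma std_normal_cdf_isCont: "isCont std_normal_cdf x"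
  by (rule DERIV_isCont[OF std_normal_cdf_deriv[OF DERIV_ident]])

lemma std_normal_singleton: "measure std_normal_distribution {a} = 0"
  using std_normal_cdf_isCont[of a] unfolding std_normal_cdf_def std_normal.isCont_cdf .

text \<open>The sum of the two values has derivative 0, the density being even; its limit at
  infinity identifies the constant as 1.\<close>

lemma std_normal_cdf_uminus: "std_normal_cdf (-x) = 1 - std_normal_cdf x"
proof -
  define g where "g x = std_normal_cdf x + std_normal_cdf (-x)" for x
  have "(g has_real_derivative 0) (at x)" for x
    unfolding g_def
    by (rule derivative_eq_intros refl)+ (simp add: std_normal_density_uminus)
  then have const: "g x = g 0" for x
    using DERIV_isconst_all[of g x 0] by blast
  have "(g \<longlongrightarrow> 1 + 0) at_top"
    unfolding g_def std_normal_cdf_def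
    by (intro tendsto_add std_normal.cdf_lim_at_top_prob
        filterlim_compose[OF std_normal.cdf_lim_at_bot filterlim_uminus_at_bot_at_top])
  moreover have "(g \<longlongrightarrow> g 0) at_top"
    using const by (simp add: tendsto_eventually)
  ultimately have "g 0 = 1"
    using tendsto_unique[of at_top g "g 0" 1] by simp
  then show ?thesis
    using const[of x] by (simp add: g_def)
qed

text \<open>The quantile is an \<open>inv\<close>, hence a mere choice of preimage: what has to be
  shown is that \<open>p\<close> lies in the range, by the limits at both ends and the intermediate
  value theorem.\<close>

lemma std_normal_cdf_quantile:
  assumes "0 < p" "p < 1"
  shows "std_normal_cdf (std_normal_quantile p) = p"
proof -
  have "\<forall>\<^sub>F x in at_bot. std_normal_cdf x < p"
    using order_tendstoD(2)[OF std_normal.cdf_lim_at_bot assms(1)]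
    by (simp add: std_normal_cdf_def)
  then obtain a where a: "\<And>x. x \<le> a \<Longrightarrow> std_normal_cdf x < p"
    by (auto simp: eventually_at_bot_linorder)
  have "\<forall>\<^sub>F x in at_top. p < std_normal_cdf x"
    using order_tendstoD(1)[OF std_normal.cdf_lim_at_top_prob assms(2)]
    by (simp add: std_normal_cdf_def)
  then obtain b where b: "\<And>x. x \<ge> b \<Longrightarrow> p < std_normal_cdf x"
    by (auto simp: eventually_at_top_linorder)
  have "\<exists>x\<ge>a. x \<le> max a b \<and> std_normal_cdf x = p"
    using a[of a] b[of "max a b"]
    by (intro IVT) (auto intro: std_normal_cdf_isCont less_imp_le)
  then have "p \<in> range std_normal_cdf"
    by auto
  then show ?thesis
    unfolding std_normal_quantile_def std_normal_cdf_def by (rule f_inv_into_f)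
qed

lemma std_normal_quantile_pos:
  assumes "1/2 < p" "p < 1"
  shows "0 < std_normal_quantile p"
proof (rule ccontr)
  assume "\<not> ?thesis"
  then have "std_normal_cdf (std_normal_quantile p) \<le> std_normal_cdf 0"
    unfolding std_normal_cdf_def by (intro std_normal.cdf_nondecreasing) auto
  then show False
    using assms std_normal_cdf_uminus[of 0] std_normal_cdf_quantile[of p] by auto
qed

text \<open>For \<open>u \<ge> 0\<close> this is P(|Z + \<theta>| > u) with Z standard normal,
  written in a form that can be differentiated directly.\<close>

definition gauss_power :: "real \<Rightarrow> real \<Rightarrow> real" where
  "gauss_power u \<theta> = 1 - std_normal_cdf (u - \<theta>) + std_normal_cdf (- u - \<theta>)"

lemma gauss_power_eq_measure:
  assumes "0 \<le> u"
  shows "gauss_power u \<theta> = measure std_normal_distribution {x. u < \<bar>x + \<theta>\<bar>}"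
proof -
  note z = std_normal_singleton
  \<comment> \<open>The left half line is closed to match the definition of \<open>cdf\<close>; its
    end point is removed again at no cost.\<close>
  have "{x. u < \<bar>x + \<theta>\<bar>} = {..-u-\<theta>} \<union> {u-\<theta><..} - {-u-\<theta>}"
    using assms by auto
  also have "measure std_normal_distribution \<dots> =
      measure std_normal_distribution ({..-u-\<theta>} \<union> {u-\<theta><..}) -
      measure std_normal_distribution {-u-\<theta>}"
    by (intro std_normal.finite_measure_Diff) auto
  also have "\<dots> = std_normal_cdf (-u-\<theta>) + measure std_normal_distribution {u-\<theta><..}"
    unfolding z std_normal_cdf_def cdf_def using assms by (subst std_normal.finite_measure_Union) auto
  also have "{u-\<theta><..} = space std_normal_distribution - {..u-\<theta>}"
    by auto
  also have "measure std_normal_distribution \<dots> = 1 - std_normal_cdf (u-\<theta>)"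
    unfolding std_normal_cdf_def cdf_def by (subst std_normal.prob_compl) auto
  finally show ?thesis
    by (simp add: gauss_power_def)
qed

lemma gauss_power_deriv:
  "((\<lambda>\<theta>. gauss_power u \<theta>) has_real_derivative
     (std_normal_density (u - \<theta>) - std_normal_density (u + \<theta>))) (at \<theta>)"
  unfolding gauss_power_def
  using std_normal_density_uminus[of "u + \<theta>"]
  by (auto intro!: derivative_eq_intros simp del: std_normal_density_def)

lemma gauss_power_uminus: "gauss_power u (- \<theta>) = gauss_power u \<theta>"
  unfolding gauss_power_def
  using std_normal_cdf_uminus[of "u + \<theta>"] std_normal_cdf_uminus[of "u - \<theta>"]
  by simp

text \<open>For \<open>\<theta> \<ge> 0\<close> the derivative is nonnegative, since
  \<open>u - \<theta>\<close> is closer to 0 than \<open>u + \<theta>\<close>; evenness covers the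
  rest. This is the unbiasedness of the two-sided test.\<close>

lemma gauss_power_ge:
  assumes "0 \<le> u"
  shows "gauss_power u 0 \<le> gauss_power u \<theta>"
proof -
  have *: "gauss_power u 0 \<le> gauss_power u \<theta>" if "0 \<le> \<theta>" for \<theta>
  proof (rule DERIV_nonneg_imp_nondecreasing[OF that])
    fix x assume x: "0 \<le> x" "x \<le> \<theta>"
    have "(u - x)\<^sup>2 \<le> (u + x)\<^sup>2"
      using assms x by (simp add: power2_eq_square algebra_simps)
    then have "0 \<le> std_normal_density (u - x) - std_normal_density (u + x)"
      by (simp add: std_normal_density_def divide_right_mono)
    then show "\<exists>y. ((\<lambda>\<theta>. gauss_power u \<theta>) has_real_derivative y) (at x) \<and> 0 \<le> y"
      using gauss_power_deriv by blast
  qed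
  then show ?thesis
    using *[of \<theta>] *[of "-\<theta>"] by (cases "\<theta> \<ge> 0") (auto simp: gauss_power_uminus)
qed

text \<open>The factor in front is the weight \<open>\<mu>\<close> of
  \<open>three_point_weight\<close> at \<open>d = s / Suc n\<close>, which is of order 1/d. The
  power function has derivative 0 at 0, so its increment is o(d) and the product vanishes.\<close>

lemma gauss_power_flat_at_0:
  assumes "0 < u" "s \<noteq> 0"
  shows "(\<lambda>n. exp (((s / Suc n)\<^sup>2 - s\<^sup>2) / 2) * sinh (s * u) / sinh (s / Suc n * u) *
    (gauss_power u (- (s / Suc n)) - gauss_power u 0)) \<longlonglongrightarrow> 0"
proof -
  \<comment> \<open>These values tend to 0, have the sign of \<open>s\<close> and are never 0,
    \<open>Suc\<close> excluding a division by zero.\<close>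
  define d where "d n = s / Suc n" for n
  have d0: "d \<longlonglongrightarrow> 0"
    unfolding d_def by real_asymp
  have dne: "d n \<noteq> 0" for n
    using assms by (simp add: d_def)
  have at: "filterlim d (at 0) sequentially"
    using d0 dne by (auto simp: filterlim_at)
  have "((\<lambda>h. (gauss_power u (0 + h) - gauss_power u 0) / h) \<longlongrightarrow> 0) (at 0)"
    using gauss_power_deriv[of u 0] by (simp add: DERIV_def)
  from filterlim_compose[OF this at]
  have A: "(\<lambda>n. (gauss_power u (d n) - gauss_power u 0) / d n) \<longlonglongrightarrow> 0"
    by simp
  have "((\<lambda>h. sinh (h * u)) has_real_derivative u) (at 0)"
    by (auto intro!: derivative_eq_intros)
  then have "((\<lambda>h. sinh (h * u) / h) \<longlongrightarrow> u) (at 0)"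
    by (simp add: DERIV_def)
  from filterlim_compose[OF this at]
  have B: "(\<lambda>n. sinh (d n * u) / d n) \<longlonglongrightarrow> u" .
  have "(\<lambda>n. exp (((d n)\<^sup>2 - s\<^sup>2) / 2) * sinh (s * u) / (sinh (d n * u) / d n) *
      ((gauss_power u (d n) - gauss_power u 0) / d n)) \<longlonglongrightarrow>
      exp ((0\<^sup>2 - s\<^sup>2) / 2) * sinh (s * u) / u * 0"
    by (intro tendsto_intros d0 A B) (use assms in auto)
  moreover have "exp (((d n)\<^sup>2 - s\<^sup>2) / 2) * sinh (s * u) / (sinh (d n * u) / d n) *
      ((gauss_power u (d n) - gauss_power u 0) / d n) =
      exp (((d n)\<^sup>2 - s\<^sup>2) / 2) * sinh (s * u) / sinh (d n * u) *
      (gauss_power u (- d n) - gauss_power u 0)" for n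
    using dne[of n] by (simp add: gauss_power_uminus)
  ultimately show ?thesis
    by (simp add: d_def)
qed

text \<open>
  The constants make \<open>f\<close> vanish at \<open>\<plusminus> u\<close>; since \<open>f\<close> is convex, the two-sided test maximises the
  integral of \<open>f\<close> over all tests.
\<close>

lemma three_point_weight:
  fixes s d u :: real
  assumes "0 < u" "0 < s * d"
  defines "\<mu> \<equiv> exp ((d\<^sup>2 - s\<^sup>2) / 2) * sinh (s * u) / sinh (d * u)"
  defines "c \<equiv> exp (- s\<^sup>2 / 2) * cosh (s * u) + \<mu> * exp (- d\<^sup>2 / 2) * cosh (d * u)"
  defines "f \<equiv> \<lambda>x. exp (s * x - s\<^sup>2 / 2) - c + \<mu> * exp (- d * x - d\<^sup>2 / 2)"
  shows "0 < \<mu>" "0 < c" "\<And>x. \<bar>x\<bar> \<le> u \<Longrightarrow> f x \<le> 0" "\<And>x. u < \<bar>x\<bar> \<Longrightarrow> 0 \<le> f x"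
proof -
  have sd: "0 < s \<and> 0 < d \<or> s < 0 \<and> d < 0"
    using assms(2) by (simp add: zero_less_mult_iff)
  have ne: "sinh (d * u) \<noteq> 0"
    using sd assms(1) by auto
  have "0 < sinh (s * u) / sinh (d * u)"
    using sd assms(1) by (auto simp: zero_less_divide_iff zero_less_mult_iff mult_less_0_iff)
  then show mu: "0 < \<mu>"
    unfolding \<mu>_def by (simp add: zero_less_mult_iff zero_less_divide_iff mult_less_0_iff)
  show c: "0 < c"
    unfolding c_def using mu by (intro add_pos_pos mult_pos_pos) auto
  \<comment> \<open>The choice of \<open>\<mu>\<close> makes the sinh terms of \<open>f\<close> at
    \<open>u\<close> and at \<open>-u\<close> cancel, so \<open>f\<close> takes the same value at
    both points; \<open>c\<close> is that common value, the sum of the cosh terms.\<close>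
  have mu': "\<mu> * exp (- d\<^sup>2 / 2) * sinh (d * u) = exp (- s\<^sup>2 / 2) * sinh (s * u)"
  proof -
    have "\<mu> * exp (- d\<^sup>2 / 2) * sinh (d * u) =
        exp ((d\<^sup>2 - s\<^sup>2) / 2) * exp (- d\<^sup>2 / 2) * sinh (s * u)"
      using ne unfolding \<mu>_def by simp
    also have "exp ((d\<^sup>2 - s\<^sup>2) / 2) * exp (- d\<^sup>2 / 2) = exp (- s\<^sup>2 / 2)"
      unfolding exp_add[symmetric] by (simp add: field_simps)
    finally show ?thesis .
  qed
  have e1: "exp (s * x - s\<^sup>2 / 2) = exp (- s\<^sup>2 / 2) * (cosh (s * x) + sinh (s * x))"
    and e2: "exp (- d * x - d\<^sup>2 / 2) = exp (- d\<^sup>2 / 2) * (cosh (d * x) - sinh (d * x))" for x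
    by (auto simp: cosh_plus_sinh cosh_minus_sinh exp_add[symmetric] algebra_simps)
  have fu: "f u = 0"
    unfolding f_def e1 e2 c_def using mu' by (simp add: algebra_simps)
  have fmu: "f (-u) = 0"
    unfolding f_def e1 e2 c_def using mu' by (simp add: algebra_simps)
  have conv: "convex_on UNIV f"
  proof (rule f''_ge0_imp_convex)
    show "(f has_real_derivative s * exp (s * x - s\<^sup>2 / 2) - \<mu> * d * exp (- d * x - d\<^sup>2 / 2))
        (at x)" for x
      unfolding f_def by (auto intro!: derivative_eq_intros)
    show "((\<lambda>x. s * exp (s * x - s\<^sup>2 / 2) - \<mu> * d * exp (- d * x - d\<^sup>2 / 2)) has_real_derivative
       s\<^sup>2 * exp (s * x - s\<^sup>2 / 2) + \<mu> * d\<^sup>2 * exp (- d * x - d\<^sup>2 / 2)) (at x)" for x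
      by (auto intro!: derivative_eq_intros simp: power2_eq_square)
    show "0 \<le> s\<^sup>2 * exp (s * x - s\<^sup>2 / 2) + \<mu> * d\<^sup>2 * exp (- d * x - d\<^sup>2 / 2)" for x
      using mu by simp
  qed auto
  have ineq: "f ((1 - t) * x + t * y) \<le> (1 - t) * f x + t * f y" if "0 \<le> t" "t \<le> 1" for t x y
    using convex_onD[OF conv that] by auto
  \<comment> \<open>Here \<open>x\<close> is a convex combination of the two zeros \<open>-u\<close>
    and \<open>u\<close> of \<open>f\<close>.\<close>
  show "f x \<le> 0" if "\<bar>x\<bar> \<le> u" for x
    using ineq[of "(x + u) / (2 * u)" "-u" u] that assms(1) fu fmu
    by (auto simp: field_simps)
  \<comment> \<open>Strict negativity in the middle is what forces \<open>f\<close> to be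
    nonnegative outside the two zeros.\<close>
  have f0: "f 0 < 0"
  proof -
    have "1 < cosh (s * u)" "1 < cosh (d * u)"
      using sd assms(1) cosh_real_ge_1 by (auto simp: less_le eq_commute[of 1])
    then have "exp (- s\<^sup>2 / 2) * 1 < exp (- s\<^sup>2 / 2) * cosh (s * u)"
      "\<mu> * exp (- d\<^sup>2 / 2) * 1 < \<mu> * exp (- d\<^sup>2 / 2) * cosh (d * u)"
      using mu by (auto intro!: mult_strict_left_mono)
    moreover have "f 0 = exp (- s\<^sup>2 / 2) - c + \<mu> * exp (- d\<^sup>2 / 2)"
      by (simp add: f_def)
    ultimately show ?thesis
      unfolding c_def by linarith
  qed
  show "0 \<le> f x" if "u < \<bar>x\<bar>" for x
  proof (rule ccontr)
    assume neg: "\<not> ?thesis"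
    \<comment> \<open>With this weight \<open>u\<close> or \<open>-u\<close> is a convex combination
      of 0 and \<open>x\<close>; if \<open>f\<close> were negative at both, it would be negative at
      one of its zeros.\<close>
    define t where "t = u / \<bar>x\<bar>"
    have t: "0 < t" "t < 1"
      using that assms(1) by (auto simp: t_def)
    have "f (t * x) \<le> (1 - t) * f 0 + t * f x"
      using ineq[of t 0 x] t by simp
    also have "\<dots> < 0"
      using t f0 neg by (intro add_neg_neg) (auto simp: mult_less_0_iff not_le)
    finally have "f (t * x) < 0" .
    moreover have "t * x = u \<or> t * x = - u"
      using that assms(1) by (auto simp: t_def abs_if field_simps)
    ultimately show False
      using fu fmu by auto
  qed
qed

section \<open>Products of densities and limits of exponential moments\<close>

text \<open>A product measure is determined by its values on boxes, and there integrand and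
  indicator both factor. The assumption is sigma-finiteness rather than total mass 1, because the
  lemma is also applied to the restriction of a probability measure to a set.\<close>

lemma PiM_density:
  fixes f :: "'a \<Rightarrow> ennreal"
  assumes I: "finite I" and f [measurable]: "f \<in> borel_measurable N"
    and N: "sigma_finite_measure N" and D: "sigma_finite_measure (density N f)"
  shows "PiM I (\<lambda>_. density N f) = density (PiM I (\<lambda>_. N)) (\<lambda>\<omega>. \<Prod>i\<in>I. f (\<omega> i))"
proof -
  interpret N: product_sigma_finite "\<lambda>_. N"
    using N by (simp add: product_sigma_finite_def)
  interpret D: product_sigma_finite "\<lambda>_. density N f"
    using D by (simp add: product_sigma_finite_def)
  have "density (PiM I (\<lambda>_. N)) (\<lambda>\<omega>. \<Prod>i\<in>I. f (\<omega> i)) = PiM I (\<lambda>_. density N f)"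
  proof (rule D.PiM_eqI[OF I])
    show "sets (density (PiM I (\<lambda>_. N)) (\<lambda>\<omega>. \<Prod>i\<in>I. f (\<omega> i))) = sets (PiM I (\<lambda>_. density N f))"
      by (auto intro!: sets_PiM_cong)
    fix A assume "\<And>i. i \<in> I \<Longrightarrow> A i \<in> sets (density N f)"
    then have A: "\<And>i. i \<in> I \<Longrightarrow> A i \<in> sets N"
      by simp
    then have PiA: "Pi\<^sub>E I A \<in> sets (PiM I (\<lambda>_. N))"
      by (intro sets_PiM_I_finite I A)
    have "emeasure (density (PiM I (\<lambda>_. N)) (\<lambda>\<omega>. \<Prod>i\<in>I. f (\<omega> i))) (Pi\<^sub>E I A) =
        (\<integral>\<^sup>+\<omega>. (\<Prod>i\<in>I. f (\<omega> i)) * indicator (Pi\<^sub>E I A) \<omega> \<partial>PiM I (\<lambda>_. N))"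
      using PiA by (intro emeasure_density) (auto intro!: borel_measurable_prod)
    also have "\<dots> = (\<integral>\<^sup>+\<omega>. (\<Prod>i\<in>I. f (\<omega> i) * indicator (A i) (\<omega> i)) \<partial>PiM I (\<lambda>_. N))"
    proof (intro nn_integral_cong)
      fix \<omega> assume \<omega>: "\<omega> \<in> space (PiM I (\<lambda>_. N))"
      have "indicator (Pi\<^sub>E I A) \<omega> = (\<Prod>i\<in>I. indicator (A i) (\<omega> i) :: ennreal)"
      proof (cases "\<omega> \<in> Pi\<^sub>E I A")
        case False
        then obtain i where "i \<in> I" "\<omega> i \<notin> A i"
          using \<omega> by (auto simp: space_PiM PiE_def Pi_def)
        then show ?thesis
          using False I by (subst prod_zero) (auto intro!: bexI[of _ i])
      next
        case True
        then have "(\<Prod>i\<in>I. indicator (A i) (\<omega> i) :: ennreal) = 1"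
          by (intro prod.neutral) (auto simp: PiE_mem)
        then show ?thesis
          using True by simp
      qed
      then show "(\<Prod>i\<in>I. f (\<omega> i)) * indicator (Pi\<^sub>E I A) \<omega> =
          (\<Prod>i\<in>I. f (\<omega> i) * indicator (A i) (\<omega> i))"
        by (simp add: prod.distrib)
    qed
    also have "\<dots> = (\<Prod>i\<in>I. \<integral>\<^sup>+x. f x * indicator (A i) x \<partial>N)"
      using A I by (subst N.product_nn_integral_prod) auto
    also have "\<dots> = (\<Prod>i\<in>I. emeasure (density N f) (A i))"
      using A by (intro prod.cong) (auto simp: emeasure_density)
    finally show "emeasure (density (PiM I (\<lambda>_. N)) (\<lambda>\<omega>. \<Prod>i\<in>I. f (\<omega> i))) (Pi\<^sub>E I A) =
        (\<Prod>i\<in>I. emeasure (density N f) (A i))" .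
  qed
  then show ?thesis ..
qed

lemma power_tendsto_exp:
  fixes a :: "nat \<Rightarrow> complex"
  assumes "(\<lambda>n. of_nat n * (a n - 1)) \<longlonglongrightarrow> l"
  shows "(\<lambda>n. a n ^ n) \<longlonglongrightarrow> exp l"
proof -
  have "(\<lambda>n. 1 / of_nat n * (of_nat n * (a n - 1))) \<longlonglongrightarrow> 0 * l"
    by (intro tendsto_mult assms lim_1_over_n)
  moreover have "\<forall>\<^sub>F n in sequentially. 1 / of_nat n * (of_nat n * (a n - 1)) = a n - 1"
    using eventually_gt_at_top[of 0] by eventually_elim simp
  ultimately have "(\<lambda>n. a n - 1) \<longlonglongrightarrow> 0"
    by (simp add: tendsto_cong)
  from tendsto_add[OF this tendsto_const[of 1]] have a: "a \<longlonglongrightarrow> 1"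
    by simp
  have "(Ln has_field_derivative 1) (at 1)"
    using has_field_derivative_Ln[of 1] by simp
  \<comment> \<open>Caratheodory's form of the derivative avoids dividing by \<open>a n - 1\<close>,
    which may vanish.\<close>
  then obtain g where g: "\<And>z. Ln z - Ln 1 = g z * (z - 1)" "isCont g 1" "g 1 = 1"
    unfolding CARAT_DERIV by auto
  have "(\<lambda>n. g (a n) * (of_nat n * (a n - 1))) \<longlonglongrightarrow> g 1 * l"
    by (intro tendsto_mult assms isCont_tendsto_compose[OF g(2) a])
  then have "(\<lambda>n. of_nat n * Ln (a n)) \<longlonglongrightarrow> l"
    using g(1) g(3) by (simp add: mult.left_commute)
  then have "(\<lambda>n. exp (of_nat n * Ln (a n))) \<longlonglongrightarrow> exp l"
    by (rule tendsto_exp)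
  moreover have "\<forall>\<^sub>F n in sequentially. exp (of_nat n * Ln (a n)) = a n ^ n"
    using tendsto_imp_eventually_ne[OF a one_neq_zero]
    by eventually_elim (simp add: exp_of_nat_mult)
  ultimately show ?thesis
    by (simp add: tendsto_cong)
qed

text \<open>The Taylor remainder after the quadratic term is of order n^(-3/2), so n times it still
  tends to 0.\<close>

lemma exp_second_order_limit:
  fixes w :: complex
  shows "(\<lambda>n. of_nat n * (exp (w / sqrt n) - 1 - w / sqrt n)) \<longlonglongrightarrow> w\<^sup>2 / 2"
proof (rule LIM_zero_cancel, rule Lim_null_comparison)
  show "\<forall>\<^sub>F n in sequentially. norm (of_nat n * (exp (w / sqrt n) - 1 - w / sqrt n) - w\<^sup>2 / 2)
      \<le> exp \<bar>Re w\<bar> * norm w ^ 3 / sqrt n"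
    using eventually_gt_at_top[of 0]
  proof eventually_elim
    case (elim n)
    let ?z = "w / sqrt n"
    have sq: "?z\<^sup>2 * of_nat n = w\<^sup>2"
      using elim by (simp add: power_divide flip: of_real_power)
    have "of_nat n * (exp ?z - 1 - ?z) - w\<^sup>2 / 2 =
        of_nat n * (exp ?z - (\<Sum>k\<le>2. ?z ^ k / fact k))"
      unfolding sq[symmetric] by (simp add: numeral_2_eq_2 algebra_simps power2_eq_square)
    also have "norm \<dots> \<le> real n * (exp \<bar>Re ?z\<bar> * norm ?z ^ Suc 2 / fact 2)"
      unfolding norm_mult norm_of_nat by (intro mult_left_mono Taylor_exp) auto
    also have "\<dots> \<le> real n * (exp \<bar>Re w\<bar> * norm ?z ^ Suc 2 / 1)"
    proof (intro mult_left_mono frac_le mult_right_mono)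
      have "\<bar>Re ?z\<bar> = \<bar>Re w\<bar> / sqrt n"
        by simp
      also have "\<dots> \<le> \<bar>Re w\<bar> / 1"
        using elim by (intro divide_left_mono) auto
      finally show "exp \<bar>Re ?z\<bar> \<le> exp \<bar>Re w\<bar>"
        by simp
    qed auto
    also have "\<dots> = exp \<bar>Re w\<bar> * norm w ^ 3 / sqrt n"
    proof -
      have "real n = sqrt n * sqrt n" by simp
      then show ?thesis
        using elim by (simp add: norm_divide eval_nat_numeral field_simps)
    qed
    finally show ?case .
  qed
  show "(\<lambda>n. exp \<bar>Re w\<bar> * norm w ^ 3 / sqrt n) \<longlonglongrightarrow> 0"
    by real_asymp
qed

context prob_space
begin

lemma integrable_of_square_integrable:
  fixes w :: "'a \<Rightarrow> 'b::{banach, second_countable_topology}"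
  assumes "w \<in> borel_measurable M" "integrable M (\<lambda>x. (norm (w x))\<^sup>2)"
  shows "integrable M w"
proof (rule Bochner_Integration.integrable_bound)
  show "integrable M (\<lambda>x. 1 + (norm (w x))\<^sup>2)"
    using assms by simp
  have "r \<le> 1 + r\<^sup>2" for r :: real
    using zero_le_power2[of "r - 1/2"] by (simp add: power2_eq_square algebra_simps)
  then show "AE x in M. norm (w x) \<le> norm (1 + (norm (w x))\<^sup>2)"
    by (simp add: abs_of_nonneg add_nonneg_nonneg)
qed (use assms in auto)

text \<open>Dominated convergence: the linear term has mean zero, and the remainder is at most
  \<open>exp B * (norm (w x))\<^sup>2\<close>. Only the real part enters the size of the
  exponential, which leaves room for an unbounded, square-integrable imaginary part: it will be a
  multiple of \<kappa>, while the real part is the bounded score of a tilt.\<close>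

lemma expectation_exp_limit:
  fixes w :: "'a \<Rightarrow> complex"
  assumes w [measurable]: "w \<in> borel_measurable M" and sq: "integrable M (\<lambda>x. (norm (w x))\<^sup>2)"
    and B: "\<And>x. x \<in> space M \<Longrightarrow> \<bar>Re (w x)\<bar> \<le> B" and zero: "expectation w = 0"
  shows "(\<lambda>n. of_nat n * (expectation (\<lambda>x. exp (w x / sqrt n)) - 1)) \<longlonglongrightarrow>
    expectation (\<lambda>x. (w x)\<^sup>2) / 2"
proof -
  let ?f = "\<lambda>n x. of_nat n * (exp (w x / sqrt n) - 1 - w x / sqrt n)"
  have int_w: "integrable M w"
    by (rule integrable_of_square_integrable[OF w sq])
  have Re: "\<bar>Re (w x / sqrt n)\<bar> \<le> B" if "x \<in> space M" for x and n :: nat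
  \<comment> \<open>At \<open>n = 0\<close> the quotient is 0 by the convention for division, so the
    bound holds for every index.\<close>
  proof (cases "n = 0")
    case True
    then show ?thesis
      using B[OF that] by simp
  next
    case False
    have "\<bar>Re (w x / sqrt n)\<bar> = \<bar>Re (w x)\<bar> / sqrt n"
      by simp
    also have "\<dots> \<le> \<bar>Re (w x)\<bar> / 1"
      using False by (intro divide_left_mono) auto
    finally show ?thesis
      using B[OF that] by simp
  qed
  have int_exp: "integrable M (\<lambda>x. exp (w x / sqrt n))" for n :: nat
    using Re by (intro integrable_const_bound[where B = "exp B"] AE_I2) (auto intro: abs_le_D1)
  have "(\<lambda>n. expectation (?f n)) \<longlonglongrightarrow> expectation (\<lambda>x. (w x)\<^sup>2 / 2)"
  proof (rule integral_dominated_convergence)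
    show "integrable M (\<lambda>x. exp B * (norm (w x))\<^sup>2)"
      using sq by simp
    show "AE x in M. (\<lambda>n. ?f n x) \<longlonglongrightarrow> (w x)\<^sup>2 / 2"
      using exp_second_order_limit by simp
    show "AE x in M. norm (?f n x) \<le> exp B * (norm (w x))\<^sup>2" for n
    proof (rule AE_I2)
      fix x assume x: "x \<in> space M"
      let ?z = "w x / sqrt n"
      have "norm (?f n x) = real n * norm (exp ?z - (\<Sum>k\<le>1. ?z ^ k / fact k))"
        by (simp add: norm_mult diff_diff_eq)
      also have "\<dots> \<le> real n * (exp \<bar>Re ?z\<bar> * norm ?z ^ Suc 1 / fact 1)"
        by (intro mult_left_mono Taylor_exp) auto
      also have "\<dots> \<le> real n * (exp B * norm ?z ^ Suc 1 / fact 1)"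
        using Re[OF x, of n] by (intro mult_left_mono divide_right_mono mult_right_mono) auto
      also have "\<dots> \<le> exp B * (norm (w x))\<^sup>2"
        by (cases "n = 0") (auto simp: norm_divide power_divide power2_eq_square[symmetric])
      finally show "norm (?f n x) \<le> exp B * (norm (w x))\<^sup>2" .
    qed
  qed measurable
  moreover have "expectation (?f n) = of_nat n * (expectation (\<lambda>x. exp (w x / sqrt n)) - 1)" for n
    using int_exp[of n] int_w zero by (simp add: Bochner_Integration.integral_diff prob_space)
  ultimately show ?thesis
    by (simp only: integral_divide_zero)
qed

end

section \<open>Square-integrable functions\<close>

lemma L2_measurable [measurable_dest]: "f \<in> L2 P \<Longrightarrow> f \<in> borel_measurable P"
  by (simp add: L2_def)

lemma L2_integrable_sq: "f \<in> L2 P \<Longrightarrow> integrable P (\<lambda>x. (f x)\<^sup>2)"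
  by (simp add: L2_def)

lemma L2_norm_nonneg [simp]: "0 \<le> L2_norm P f"
  by (simp add: L2_norm_def)

lemma L2_norm_sq: "(L2_norm P f)\<^sup>2 = (\<integral>x. (f x)\<^sup>2 \<partial>P)"
  by (simp add: L2_norm_def)

lemma L2_integrable_mult:
  assumes "f \<in> L2 P" "g \<in> L2 P"
  shows "integrable P (\<lambda>x. f x * g x)"
proof (rule Bochner_Integration.integrable_bound)
  show "integrable P (\<lambda>x. (f x)\<^sup>2 + (g x)\<^sup>2)"
    using assms by (simp add: L2_def)
  have "\<bar>a * b\<bar> \<le> a\<^sup>2 + b\<^sup>2" for a b :: real
    using zero_le_power2[of "\<bar>a\<bar> - \<bar>b\<bar>"] zero_le_power2[of a] zero_le_power2[of b]
    unfolding power2_diff abs_mult power2_abs by linarith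
  then show "AE x in P. norm (f x * g x) \<le> norm ((f x)\<^sup>2 + (g x)\<^sup>2)"
    by (auto intro: order_trans[OF _ abs_ge_self])
qed (use assms in measurable)

lemma L2_scale [intro]: "f \<in> L2 P \<Longrightarrow> (\<lambda>x. c * f x) \<in> L2 P"
  by (auto simp: L2_def power_mult_distrib)

lemma L2_add [intro]:
  assumes "f \<in> L2 P" "g \<in> L2 P"
  shows "(\<lambda>x. f x + g x) \<in> L2 P"
  using assms L2_integrable_mult[OF assms] unfolding L2_def
  by (auto simp: power2_sum mult.assoc)

lemma L2_diff [intro]:
  assumes "f \<in> L2 P" "g \<in> L2 P"
  shows "(\<lambda>x. f x - g x) \<in> L2 P"
  using L2_add[OF assms(1) L2_scale[OF assms(2), of "-1"]] by simp

lemma L2_norm_scale: "L2_norm P (\<lambda>x. c * f x) = \<bar>c\<bar> * L2_norm P f"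
  by (simp add: L2_norm_def power_mult_distrib real_sqrt_mult)

text \<open>The integral of \<open>(g - t f)\<^sup>2\<close> is a nonnegative polynomial in
  \<open>t\<close>. If its leading coefficient is 0, the linear coefficient must be 0 too; otherwise
  its value at the minimiser gives the inequality.\<close>

lemma L2_Cauchy_Schwarz:
  assumes f: "f \<in> L2 P" and g: "g \<in> L2 P"
  shows "\<bar>\<integral>x. f x * g x \<partial>P\<bar> \<le> L2_norm P f * L2_norm P g"
proof -
  let ?A = "\<integral>x. (f x)\<^sup>2 \<partial>P" and ?B = "\<integral>x. f x * g x \<partial>P" and ?C = "\<integral>x. (g x)\<^sup>2 \<partial>P"
  have "0 \<le> ?C - 2 * t * ?B + t\<^sup>2 * ?A" for t
  proof -
    have "0 \<le> (\<integral>x. (g x - t * f x)\<^sup>2 \<partial>P)"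
      by simp
    also have "\<dots> = (\<integral>x. (g x)\<^sup>2 - 2 * t * (f x * g x) + t\<^sup>2 * (f x)\<^sup>2 \<partial>P)"
      by (intro Bochner_Integration.integral_cong) (auto simp: power2_eq_square algebra_simps)
    also have "\<dots> = ?C - 2 * t * ?B + t\<^sup>2 * ?A"
      using L2_integrable_sq[OF f] L2_integrable_sq[OF g] L2_integrable_mult[OF f g] by simp
    finally show ?thesis .
  qed
  note quad = this
  have "?B\<^sup>2 \<le> ?A * ?C"
  proof (cases "?A = 0")
    case True
    have "?B = 0"
    proof (rule ccontr)
      assume "?B \<noteq> 0"
      then show False
        using quad[of "(?C + 1) / (2 * ?B)"] True by (simp add: field_simps)
    qed
    then show ?thesis
      by simp
  next
    case False
    then have "0 < ?A"
      by (simp add: less_le)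
    then show ?thesis
      using quad[of "?B / ?A"] by (simp add: field_simps power2_eq_square)
  qed
  then have "sqrt (?B\<^sup>2) \<le> sqrt (?A * ?C)"
    by (rule real_sqrt_le_mono)
  then show ?thesis
    by (simp add: L2_norm_def real_sqrt_mult)
qed

lemma L2_norm_triangle:
  assumes f: "f \<in> L2 P" and g: "g \<in> L2 P"
  shows "L2_norm P (\<lambda>x. f x + g x) \<le> L2_norm P f + L2_norm P g"
proof (rule power2_le_imp_le)
  have "(L2_norm P (\<lambda>x. f x + g x))\<^sup>2 = (\<integral>x. (f x)\<^sup>2 + (g x)\<^sup>2 + 2 * (f x * g x) \<partial>P)"
    unfolding L2_norm_sq by (simp add: power2_sum mult.assoc)
  also have "\<dots> = (L2_norm P f)\<^sup>2 + (L2_norm P g)\<^sup>2 + 2 * (\<integral>x. f x * g x \<partial>P)"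
    unfolding L2_norm_sq
    using L2_integrable_sq[OF f] L2_integrable_sq[OF g] L2_integrable_mult[OF f g] by simp
  also have "\<dots> \<le> (L2_norm P f + L2_norm P g)\<^sup>2"
    using L2_Cauchy_Schwarz[OF f g] by (simp add: power2_sum)
  finally show "(L2_norm P (\<lambda>x. f x + g x))\<^sup>2 \<le> (L2_norm P f + L2_norm P g)\<^sup>2" .
qed simp

lemma L2_norm_minus_commute: "L2_norm P (\<lambda>x. f x - g x) = L2_norm P (\<lambda>x. g x - f x)"
  by (simp add: L2_norm_def power2_commute)

lemma L2_norm_triangle_diff:
  assumes "f \<in> L2 P" "g \<in> L2 P"
  shows "\<bar>L2_norm P f - L2_norm P g\<bar> \<le> L2_norm P (\<lambda>x. f x - g x)"
  using L2_norm_triangle[OF L2_diff[OF assms] assms(2)]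
    L2_norm_triangle[OF L2_diff[OF assms(2,1)] assms(1)] L2_norm_minus_commute[of P f g]
  by simp

lemma L2_norm_triangle3:
  assumes "f \<in> L2 P" "g \<in> L2 P" "h \<in> L2 P"
  shows "L2_norm P (\<lambda>x. f x - h x) \<le> L2_norm P (\<lambda>x. f x - g x) + L2_norm P (\<lambda>x. g x - h x)"
  using L2_norm_triangle[OF L2_diff[OF assms(1,2)] L2_diff[OF assms(2,3)]] by simp

text \<open>Membership is asked only eventually, because the roots of densities to which this is
  applied are controlled from \<open>n = 1\<close> on.\<close>

lemma L2_norm_tendsto:
  assumes "\<forall>\<^sub>F n in F. f n \<in> L2 P" "g \<in> L2 P"
    and "((\<lambda>n. L2_norm P (\<lambda>x. f n x - g x)) \<longlongrightarrow> 0) F"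
  shows "((\<lambda>n. L2_norm P (f n)) \<longlongrightarrow> L2_norm P g) F"
proof (rule LIM_zero_cancel, rule Lim_null_comparison[OF _ assms(3)])
  show "\<forall>\<^sub>F n in F. norm (L2_norm P (f n) - L2_norm P g) \<le> L2_norm P (\<lambda>x. f n x - g x)"
    using assms(1) by eventually_elim (use L2_norm_triangle_diff assms(2) in auto)
qed

lemma L2_inner_tendsto:
  assumes "\<And>n. f n \<in> L2 P" "f' \<in> L2 P" "\<And>n. g n \<in> L2 P" "g' \<in> L2 P"
    and f: "((\<lambda>n. L2_norm P (\<lambda>x. f n x - f' x)) \<longlongrightarrow> 0) F"
    and g: "((\<lambda>n. L2_norm P (\<lambda>x. g n x - g' x)) \<longlongrightarrow> 0) F"
  shows "((\<lambda>n. \<integral>x. f n x * g n x \<partial>P) \<longlongrightarrow> (\<integral>x. f' x * g' x \<partial>P)) F"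
proof (rule LIM_zero_cancel, rule Lim_null_comparison)
  have "((\<lambda>n. L2_norm P (\<lambda>x. f n x - f' x) * L2_norm P (g n) +
      L2_norm P f' * L2_norm P (\<lambda>x. g n x - g' x)) \<longlongrightarrow>
      0 * L2_norm P g' + L2_norm P f' * 0) F"
    by (intro tendsto_intros f g L2_norm_tendsto always_eventually allI assms)
  then show "((\<lambda>n. L2_norm P (\<lambda>x. f n x - f' x) * L2_norm P (g n) +
      L2_norm P f' * L2_norm P (\<lambda>x. g n x - g' x)) \<longlongrightarrow> 0) F"
    by simp
  show "\<forall>\<^sub>F n in F. norm ((\<integral>x. f n x * g n x \<partial>P) - (\<integral>x. f' x * g' x \<partial>P)) \<le>
      L2_norm P (\<lambda>x. f n x - f' x) * L2_norm P (g n) +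
      L2_norm P f' * L2_norm P (\<lambda>x. g n x - g' x)"
  proof (intro always_eventually allI)
    fix n
    have "(\<integral>x. f n x * g n x \<partial>P) - (\<integral>x. f' x * g' x \<partial>P) =
        (\<integral>x. f n x * g n x - f' x * g' x \<partial>P)"
      by (intro Bochner_Integration.integral_diff[symmetric] L2_integrable_mult assms)
    also have "\<dots> = (\<integral>x. (f n x - f' x) * g n x + f' x * (g n x - g' x) \<partial>P)"
      by (simp add: algebra_simps)
    also have "\<dots> = (\<integral>x. (f n x - f' x) * g n x \<partial>P) + (\<integral>x. f' x * (g n x - g' x) \<partial>P)"
      by (intro Bochner_Integration.integral_add L2_integrable_mult assms L2_diff)
    finally show "norm ((\<integral>x. f n x * g n x \<partial>P) - (\<integral>x. f' x * g' x \<partial>P)) \<le>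
      L2_norm P (\<lambda>x. f n x - f' x) * L2_norm P (g n) +
      L2_norm P f' * L2_norm P (\<lambda>x. g n x - g' x)"
      using L2_Cauchy_Schwarz[OF L2_diff[OF assms(1)[of n] assms(2)] assms(3)[of n]]
        L2_Cauchy_Schwarz[OF assms(2) L2_diff[OF assms(3)[of n] assms(4)]]
      by (simp add: abs_le_iff)
  qed
qed

context prob_space
begin

lemma L2_bounded:
  fixes f :: "'a \<Rightarrow> real"
  assumes "f \<in> borel_measurable M" "\<And>x. x \<in> space M \<Longrightarrow> \<bar>f x\<bar> \<le> B"
  shows "f \<in> L2 M"
proof -
  have "integrable M (\<lambda>x. (f x)\<^sup>2)"
  proof (rule integrable_const_bound[where B = "B\<^sup>2"])
    show "AE x in M. norm ((f x)\<^sup>2) \<le> B\<^sup>2"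
      using power_mono[OF assms(2) abs_ge_zero, of _ 2] by (intro AE_I2) simp
  qed (use assms in auto)
  then show ?thesis
    using assms(1) by (simp add: L2_def)
qed

lemma L2_const: "(\<lambda>x. c) \<in> L2 M"
  by (rule L2_bounded[where B = "\<bar>c\<bar>"]) auto

lemma L2_integrable: "f \<in> L2 M \<Longrightarrow> integrable M f"
  using L2_integrable_mult[OF _ L2_const[of 1]] by simp

lemma L2_norm_const: "L2_norm M (\<lambda>x. c) = \<bar>c\<bar>"
  by (simp add: L2_norm_def prob_space)

lemma L2_expectation_le: "f \<in> L2 M \<Longrightarrow> \<bar>expectation f\<bar> \<le> L2_norm M f"
  using L2_Cauchy_Schwarz[OF _ L2_const[of 1]] by (simp add: L2_norm_const)

end

section \<open>Exponential tilts\<close>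

definition normalized_sum :: "nat \<Rightarrow> ('a \<Rightarrow> real) \<Rightarrow> (nat \<Rightarrow> 'a) \<Rightarrow> real" where
  "normalized_sum n h \<omega> = (\<Sum>i<n. h (\<omega> i)) / sqrt n"

definition tilt_mass :: "'a measure \<Rightarrow> ('a \<Rightarrow> real) \<Rightarrow> nat \<Rightarrow> real" where
  "tilt_mass P h n = (\<integral>x. exp (h x / sqrt n) \<partial>P)"

text \<open>With the sample size as last argument, \<open>exp_tilt P h\<close> is itself a sequence
  of marginals and can take the place of \<open>Q\<close> in \<open>test_power\<close>.\<close>

definition exp_tilt :: "'a measure \<Rightarrow> ('a \<Rightarrow> real) \<Rightarrow> nat \<Rightarrow> 'a measure" where
  "exp_tilt P h n = density P (\<lambda>x. ennreal (exp (h x / sqrt n) / tilt_mass P h n))"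

text \<open>Boundedness makes all exponential moments finite; mean zero makes
  \<open>tilt_mass\<close> equal to 1 + O(1/n), so that its n-th power has a finite limit.\<close>

definition bounded_score :: "'a measure \<Rightarrow> ('a \<Rightarrow> real) \<Rightarrow> bool" where
  "bounded_score P h \<longleftrightarrow> h \<in> borel_measurable P \<and> (\<exists>B. \<forall>x\<in>space P. \<bar>h x\<bar> \<le> B) \<and>
     (\<integral>x. h x \<partial>P) = 0"

lemma normalized_sum_measurable [measurable]:
  assumes [measurable]: "h \<in> borel_measurable P"
  shows "normalized_sum n h \<in> borel_measurable (prod_power n P)"
  unfolding normalized_sum_def by measurable

lemma normalized_sum_add:
  "normalized_sum n (\<lambda>x. f x + g x) \<omega> = normalized_sum n f \<omega> + normalized_sum n g \<omega>"
  by (simp add: normalized_sum_def sum.distrib add_divide_distrib)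

lemma normalized_sum_scale:
  "normalized_sum n (\<lambda>x. c * f x) \<omega> = c * normalized_sum n f \<omega>"
  by (simp add: normalized_sum_def sum_distrib_left)

lemma bounded_score_measurable [measurable_dest]:
  "bounded_score P h \<Longrightarrow> h \<in> borel_measurable P"
  by (simp add: bounded_score_def)

lemma abs_divide_sqrt_le:
  fixes a B :: real
  assumes "\<bar>a\<bar> \<le> B"
  shows "\<bar>a / sqrt (real n)\<bar> \<le> B"
proof (cases "n = 0")
  case False
  have "\<bar>a / sqrt n\<bar> = \<bar>a\<bar> / sqrt n"
    by (simp add: abs_divide)
  also have "\<dots> \<le> \<bar>a\<bar> / 1"
    using False by (intro divide_left_mono) auto
  finally show ?thesis
    using assms by simp
qed (use assms in auto)

context prob_space
begin

lemma prod_power_integral_prod: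
  fixes f :: "'a \<Rightarrow> 'b::{real_normed_field, banach, second_countable_topology}"
  assumes "integrable M f"
  shows "integrable (prod_power n M) (\<lambda>\<omega>. \<Prod>i<n. f (\<omega> i))"
    and "(\<integral>\<omega>. (\<Prod>i<n. f (\<omega> i)) \<partial>prod_power n M) = (expectation f) ^ n"
proof -
  interpret product_sigma_finite "\<lambda>_. M"
    by standard
  show "integrable (prod_power n M) (\<lambda>\<omega>. \<Prod>i<n. f (\<omega> i))"
    using assms by (intro product_integrable_prod) auto
  show "(\<integral>\<omega>. (\<Prod>i<n. f (\<omega> i)) \<partial>prod_power n M) = (expectation f) ^ n"
    using assms by (subst product_integral_prod) auto
qed

lemma prob_space_prod_power: "prob_space (prod_power n M)"
  by (intro prob_space_PiM) (rule prob_space_axioms)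

lemma bounded_score_L2: "bounded_score M h \<Longrightarrow> h \<in> L2 M"
  unfolding bounded_score_def by (auto intro: L2_bounded)

lemma bounded_score_add:
  assumes "bounded_score M f" "bounded_score M g"
  shows "bounded_score M (\<lambda>x. f x + g x)"
proof -
  obtain B C where "\<And>x. x \<in> space M \<Longrightarrow> \<bar>f x\<bar> \<le> B" "\<And>x. x \<in> space M \<Longrightarrow> \<bar>g x\<bar> \<le> C"
    using assms by (auto simp: bounded_score_def)
  then have "\<forall>x\<in>space M. \<bar>f x + g x\<bar> \<le> B + C"
    by (auto intro: order_trans[OF abs_triangle_ineq] add_mono)
  moreover have "expectation (\<lambda>x. f x + g x) = 0"
    using assms L2_integrable[OF bounded_score_L2[OF assms(1)]]
      L2_integrable[OF bounded_score_L2[OF assms(2)]] by (simp add: bounded_score_def)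
  ultimately show ?thesis
    using assms unfolding bounded_score_def by auto
qed

lemma bounded_score_scale:
  assumes "bounded_score M f"
  shows "bounded_score M (\<lambda>x. c * f x)"
proof -
  obtain B where "\<And>x. x \<in> space M \<Longrightarrow> \<bar>f x\<bar> \<le> B"
    using assms by (auto simp: bounded_score_def)
  then have "\<forall>x\<in>space M. \<bar>c * f x\<bar> \<le> \<bar>c\<bar> * B"
    by (auto simp: abs_mult intro: mult_left_mono)
  then show ?thesis
    using assms unfolding bounded_score_def by auto
qed

lemma integrable_exp_score:
  assumes h: "bounded_score M h"
  shows "integrable M (\<lambda>x. exp (h x / sqrt (real n)))"
proof -
  note [measurable] = bounded_score_measurable[OF h]
  obtain B where B: "\<And>x. x \<in> space M \<Longrightarrow> \<bar>h x\<bar> \<le> B"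
    using h by (auto simp: bounded_score_def)
  have "h x / sqrt n \<le> B" if "x \<in> space M" for x
    by (rule abs_le_D1[OF abs_divide_sqrt_le[OF B[OF that]]])
  then show ?thesis
    by (intro integrable_const_bound[where B = "exp B"] AE_I2) auto
qed

text \<open>From \<open>1 + z \<le> exp z\<close> and the zero mean. Besides positivity, the bound
  by 1 makes the normalisation error in \<open>exp_score_root_limit\<close> easy to
  estimate.\<close>

lemma tilt_mass_ge_1:
  assumes h: "bounded_score M h"
  shows "1 \<le> tilt_mass M h n"
proof -
  have int: "integrable M h"
    by (intro L2_integrable bounded_score_L2 h)
  have "1 = expectation (\<lambda>x. 1 + h x / sqrt n)"
    using h int by (simp add: bounded_score_def prob_space)
  also have "\<dots> \<le> tilt_mass M h n"
    unfolding tilt_mass_def using int integrable_exp_score[OF h, of n]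
    by (intro integral_mono) auto
  finally show ?thesis .
qed

text \<open>The case of a vanishing imaginary part in \<open>expectation_exp_limit\<close>,
  transported back to the reals.\<close>

lemma tilt_mass_limit:
  assumes h: "bounded_score M h"
  shows "(\<lambda>n. real n * (tilt_mass M h n - 1)) \<longlonglongrightarrow> (L2_norm M h)\<^sup>2 / 2"
    and "(\<lambda>n. tilt_mass M h n ^ n) \<longlonglongrightarrow> exp ((L2_norm M h)\<^sup>2 / 2)"
proof -
  note [measurable] = bounded_score_measurable[OF h]
  obtain B where B: "\<And>x. x \<in> space M \<Longrightarrow> \<bar>h x\<bar> \<le> B"
    using h by (auto simp: bounded_score_def)
  have mass: "expectation (\<lambda>x. exp (complex_of_real (h x) / complex_of_real (sqrt n))) =
      complex_of_real (tilt_mass M h n)" for n :: nat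
    unfolding tilt_mass_def by (simp flip: integral_complex_of_real exp_of_real)
  have "(\<lambda>n. of_nat n * (expectation (\<lambda>x. exp (complex_of_real (h x) / sqrt n)) - 1)) \<longlonglongrightarrow>
      expectation (\<lambda>x. (complex_of_real (h x))\<^sup>2) / 2"
    using L2_integrable_sq[OF bounded_score_L2[OF h]] B h
    by (intro expectation_exp_limit[where B = B]) (auto simp: bounded_score_def)
  also have "expectation (\<lambda>x. (complex_of_real (h x))\<^sup>2) / 2 =
      complex_of_real ((L2_norm M h)\<^sup>2 / 2)"
    unfolding L2_norm_sq by (simp flip: integral_complex_of_real of_real_power)
  finally have lim: "(\<lambda>n. of_nat n * (complex_of_real (tilt_mass M h n) - 1)) \<longlonglongrightarrow>
      complex_of_real ((L2_norm M h)\<^sup>2 / 2)"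
    unfolding mass .
  have "(\<lambda>n. complex_of_real (real n * (tilt_mass M h n - 1))) \<longlonglongrightarrow>
      complex_of_real ((L2_norm M h)\<^sup>2 / 2)"
    using lim by simp
  then show "(\<lambda>n. real n * (tilt_mass M h n - 1)) \<longlonglongrightarrow> (L2_norm M h)\<^sup>2 / 2"
    unfolding tendsto_of_real_iff .
  have "(\<lambda>n. complex_of_real (tilt_mass M h n ^ n)) \<longlonglongrightarrow>
      complex_of_real (exp ((L2_norm M h)\<^sup>2 / 2))"
    using power_tendsto_exp[OF lim] unfolding exp_of_real of_real_power .
  then show "(\<lambda>n. tilt_mass M h n ^ n) \<longlonglongrightarrow> exp ((L2_norm M h)\<^sup>2 / 2)"
    unfolding tendsto_of_real_iff .
qed

lemma prob_space_exp_tilt: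
  assumes h: "bounded_score M h"
  shows "prob_space (exp_tilt M h n)"
proof
  note [measurable] = bounded_score_measurable[OF h]
  have m: "0 < tilt_mass M h n"
    using tilt_mass_ge_1[OF h, of n] by simp
  have "emeasure (exp_tilt M h n) (space (exp_tilt M h n)) =
      (\<integral>\<^sup>+x. ennreal (exp (h x / sqrt n) / tilt_mass M h n) \<partial>M)"
    unfolding exp_tilt_def by (simp add: emeasure_density cong: nn_integral_cong)
  also have "\<dots> = ennreal (expectation (\<lambda>x. exp (h x / sqrt n) / tilt_mass M h n))"
    using m integrable_exp_score[OF h, of n] by (intro nn_integral_eq_integral) auto
  also have "\<dots> = 1"
    using m by (simp add: tilt_mass_def)
  finally show "emeasure (exp_tilt M h n) (space (exp_tilt M h n)) = 1" .
qed

lemma prod_power_exp_tilt: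
  assumes h: "bounded_score M h"
  shows "prod_power n (exp_tilt M h n) =
    density (prod_power n M) (\<lambda>\<omega>. ennreal (exp (normalized_sum n h \<omega>) / tilt_mass M h n ^ n))"
proof -
  note [measurable] = bounded_score_measurable[OF h]
  have m: "0 < tilt_mass M h n"
    using tilt_mass_ge_1[OF h, of n] by simp
  interpret T: prob_space "density M (\<lambda>x. ennreal (exp (h x / sqrt n) / tilt_mass M h n))"
    using prob_space_exp_tilt[OF h] by (simp add: exp_tilt_def)
  have "prod_power n (exp_tilt M h n) =
      density (prod_power n M) (\<lambda>\<omega>. \<Prod>i<n. ennreal (exp (h (\<omega> i) / sqrt n) / tilt_mass M h n))"
    unfolding exp_tilt_def by (rule PiM_density) (auto intro: sigma_finite_measure_axioms T.sigma_finite_measure_axioms)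
  also have "(\<lambda>\<omega>. \<Prod>i<n. ennreal (exp (h (\<omega> i) / sqrt n) / tilt_mass M h n)) =
      (\<lambda>\<omega>. ennreal (exp (normalized_sum n h \<omega>) / tilt_mass M h n ^ n))"
    using m by (simp add: prod_ennreal prod_dividef exp_sum normalized_sum_def sum_divide_distrib)
  finally show ?thesis .
qed

lemma integral_prod_power_exp_tilt:
  fixes f :: "(nat \<Rightarrow> 'a) \<Rightarrow> 'b::{banach, second_countable_topology}"
  assumes h: "bounded_score M h" and f [measurable]: "f \<in> borel_measurable (prod_power n M)"
  shows "(\<integral>\<omega>. f \<omega> \<partial>prod_power n (exp_tilt M h n)) =
    (\<integral>\<omega>. (exp (normalized_sum n h \<omega>) / tilt_mass M h n ^ n) *\<^sub>R f \<omega> \<partial>prod_power n M)"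
proof -
  note [measurable] = bounded_score_measurable[OF h]
  have m: "0 < tilt_mass M h n"
    using tilt_mass_ge_1[OF h, of n] by simp
  show ?thesis
    unfolding prod_power_exp_tilt[OF h]
    using m by (intro integral_density) auto
qed

lemma integrable_exp_normalized_sum:
  assumes h: "bounded_score M h"
  shows "integrable (prod_power n M) (\<lambda>\<omega>. exp (normalized_sum n h \<omega>))"
  using prod_power_integral_prod(1)[OF integrable_exp_score[OF h, of n], of n]
  by (simp add: exp_sum normalized_sum_def sum_divide_distrib)

text \<open>Tilt and character merge into one exponential moment with exponent
  \<open>w = h + \<i> s \<kappa>\<close>: the characteristic function is E[exp(w / sqrt n)]^n
  divided by the n-th power of the tilt mass. In the limit the real square of \<open>h\<close>
  cancels, and the cross term of w^2 turns into a shift of the mean by the inner product of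
  \<open>h\<close> and \<open>\<kappa>\<close>, as in Le Cam's third lemma.\<close>

lemma exp_tilt_char_limit:
  assumes h: "bounded_score M h" and \<kappa>: "\<kappa> \<in> L2_zero M"
  shows "(\<lambda>n. \<integral>\<omega>. iexp (s * normalized_sum n \<kappa> \<omega>) \<partial>prod_power n (exp_tilt M h n)) \<longlonglongrightarrow>
    exp (\<i> * s * expectation (\<lambda>x. h x * \<kappa> x) - s\<^sup>2 * (L2_norm M \<kappa>)\<^sup>2 / 2)"
proof -
  note [measurable] = bounded_score_measurable[OF h]
  have \<kappa>L2: "\<kappa> \<in> L2 M" and \<kappa>0: "expectation \<kappa> = 0"
    using \<kappa> by (auto simp: L2_zero_def)
  note [measurable] = L2_measurable[OF \<kappa>L2]
  note hL2 = bounded_score_L2[OF h]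
  obtain B where B: "\<And>x. x \<in> space M \<Longrightarrow> \<bar>h x\<bar> \<le> B"
    using h by (auto simp: bounded_score_def)
  define w where "w x = complex_of_real (h x) + \<i> * complex_of_real (s * \<kappa> x)" for x
  have w [measurable]: "w \<in> borel_measurable M"
    unfolding w_def by measurable
  have wsq: "(w x)\<^sup>2 = complex_of_real ((h x)\<^sup>2 - s\<^sup>2 * (\<kappa> x)\<^sup>2) + \<i> * complex_of_real (2 * s * (h x * \<kappa> x))" for x
    by (simp add: w_def power2_eq_square algebra_simps complex_eq_iff)
  have Ew: "expectation w = 0"
    unfolding w_def using h \<kappa>0 L2_integrable[OF hL2] L2_integrable[OF \<kappa>L2]
    by (simp add: bounded_score_def flip: integral_complex_of_real)
  have Ewsq: "expectation (\<lambda>x. (w x)\<^sup>2) =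
      complex_of_real ((L2_norm M h)\<^sup>2 - s\<^sup>2 * (L2_norm M \<kappa>)\<^sup>2) +
      \<i> * complex_of_real (2 * s * expectation (\<lambda>x. h x * \<kappa> x))"
    unfolding wsq L2_norm_sq
    using L2_integrable_sq[OF hL2] L2_integrable_sq[OF \<kappa>L2] L2_integrable_mult[OF hL2 \<kappa>L2]
    by (subst Bochner_Integration.integral_add) (auto simp flip: of_real_mult of_real_diff)
  have "(\<lambda>n. of_nat n * (expectation (\<lambda>x. exp (w x / sqrt n)) - 1)) \<longlonglongrightarrow>
      expectation (\<lambda>x. (w x)\<^sup>2) / 2"
  proof (rule expectation_exp_limit[where B = B])
    show "integrable M (\<lambda>x. (norm (w x))\<^sup>2)"
      using L2_integrable_sq[OF hL2] L2_integrable_sq[OF \<kappa>L2]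
      by (simp add: w_def cmod_power2 power_mult_distrib)
    show "\<bar>Re (w x)\<bar> \<le> B" if "x \<in> space M" for x
      using B[OF that] by (simp add: w_def)
  qed (use Ew in auto)
  from power_tendsto_exp[OF this]
  have "(\<lambda>n. expectation (\<lambda>x. exp (w x / sqrt n)) ^ n / complex_of_real (tilt_mass M h n ^ n)) \<longlonglongrightarrow>
      exp (expectation (\<lambda>x. (w x)\<^sup>2) / 2) / complex_of_real (exp ((L2_norm M h)\<^sup>2 / 2))"
    by (intro tendsto_divide tendsto_of_real tilt_mass_limit h) auto
  also have "exp (expectation (\<lambda>x. (w x)\<^sup>2) / 2) / complex_of_real (exp ((L2_norm M h)\<^sup>2 / 2)) =
      exp (\<i> * s * expectation (\<lambda>x. h x * \<kappa> x) - s\<^sup>2 * (L2_norm M \<kappa>)\<^sup>2 / 2)"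
    unfolding Ewsq exp_of_real[symmetric] exp_diff[symmetric]
    by (rule arg_cong[of _ _ exp]) (simp add: complex_eq_iff diff_divide_distrib)
  also have "(\<lambda>n. expectation (\<lambda>x. exp (w x / sqrt n)) ^ n / complex_of_real (tilt_mass M h n ^ n)) =
      (\<lambda>n. \<integral>\<omega>. iexp (s * normalized_sum n \<kappa> \<omega>) \<partial>prod_power n (exp_tilt M h n))"
  proof
    fix n :: nat
    have "h x / sqrt n \<le> B" if "x \<in> space M" for x
      by (rule abs_le_D1[OF abs_divide_sqrt_le[OF B[OF that]]])
    then have "integrable M (\<lambda>x. exp (w x / sqrt n))"
      by (intro integrable_const_bound[where B = "exp B"] AE_I2) (auto simp: w_def)
    from prod_power_integral_prod(2)[OF this, of n]
    have "expectation (\<lambda>x. exp (w x / sqrt n)) ^ n =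
        (\<integral>\<omega>. (\<Prod>i<n. exp (w (\<omega> i) / sqrt n)) \<partial>prod_power n M)" ..
    also have "\<dots> = (\<integral>\<omega>. exp (normalized_sum n h \<omega>) *\<^sub>R iexp (s * normalized_sum n \<kappa> \<omega>)
        \<partial>prod_power n M)"
    proof (intro Bochner_Integration.integral_cong refl)
      fix \<omega>
      have "(\<Sum>i<n. w (\<omega> i) / complex_of_real (sqrt n)) =
          complex_of_real (normalized_sum n h \<omega>) + \<i> * complex_of_real (s * normalized_sum n \<kappa> \<omega>)"
        by (simp add: w_def normalized_sum_def sum.distrib sum_distrib_left add_divide_distrib
            sum_divide_distrib)
      then show "(\<Prod>i<n. exp (w (\<omega> i) / sqrt n)) =
          exp (normalized_sum n h \<omega>) *\<^sub>R iexp (s * normalized_sum n \<kappa> \<omega>)"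
        by (simp add: exp_sum[symmetric] exp_add exp_of_real scaleR_conv_of_real)
    qed
    finally show "expectation (\<lambda>x. exp (w x / sqrt n)) ^ n / complex_of_real (tilt_mass M h n ^ n) =
        (\<integral>\<omega>. iexp (s * normalized_sum n \<kappa> \<omega>) \<partial>prod_power n (exp_tilt M h n))"
      by (subst integral_prod_power_exp_tilt[OF h])
        (auto simp: scaleR_conv_of_real simp flip: Bochner_Integration.integral_divide_zero)
  qed
  finally show ?thesis .
qed

end

text \<open>Levy's continuity theorem, followed by the portmanteau theorem: the rejection region is
  a continuity set, its boundary having at most two points.\<close>

lemma prob_gaussian_limit:
  fixes X :: "nat \<Rightarrow> 'b \<Rightarrow> real"
  assumes N: "\<And>n. prob_space (N n)" and X: "\<And>n. X n \<in> borel_measurable (N n)"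
    and char: "\<And>s. (\<lambda>n. \<integral>\<omega>. iexp (s * X n \<omega>) \<partial>N n) \<longlonglongrightarrow> exp (\<i> * s * \<theta> - complex_of_real (s\<^sup>2 / 2))"
    and u: "0 \<le> u"
  shows "(\<lambda>n. measure (N n) {\<omega> \<in> space (N n). u < \<bar>X n \<omega>\<bar>}) \<longlonglongrightarrow> gauss_power u \<theta>"
proof -
  note [measurable] = X
  \<comment> \<open>Centring by \<open>\<theta>\<close> makes the limit the standard normal law
    itself; the shift moves into the rejection region.\<close>
  let ?D = "\<lambda>n. distr (N n) borel (\<lambda>\<omega>. X n \<omega> - \<theta>)"
  have D: "real_distribution (?D n)" for n
    using N by (intro prob_space.real_distribution_distr) auto
  have "weak_conv_m ?D std_normal_distribution"
  proof (rule levy_continuity[OF D real_dist_normal_dist])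
    fix s
    have "char (?D n) s = iexp (- s * \<theta>) * (\<integral>\<omega>. iexp (s * X n \<omega>) \<partial>N n)" for n
    proof -
      have "char (?D n) s = (\<integral>\<omega>. iexp (s * (X n \<omega> - \<theta>)) \<partial>N n)"
        unfolding char_def by (subst integral_distr) auto
      also have "\<dots> = (\<integral>\<omega>. iexp (- s * \<theta>) * iexp (s * X n \<omega>) \<partial>N n)"
        by (intro Bochner_Integration.integral_cong refl)
          (simp add: exp_add[symmetric] algebra_simps)
      finally show ?thesis
        by simp
    qed
    moreover have "(\<lambda>n. iexp (- s * \<theta>) * (\<integral>\<omega>. iexp (s * X n \<omega>) \<partial>N n)) \<longlonglongrightarrow>
        iexp (- s * \<theta>) * exp (\<i> * s * \<theta> - complex_of_real (s\<^sup>2 / 2))"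
      by (intro tendsto_mult tendsto_const char)
    moreover have "iexp (- s * \<theta>) * exp (\<i> * s * \<theta> - complex_of_real (s\<^sup>2 / 2)) = char std_normal_distribution s"
      unfolding char_std_normal_distribution exp_of_real[symmetric] exp_add[symmetric]
      by (rule arg_cong[of _ _ exp]) (simp add: complex_eq_iff)
    ultimately show "(\<lambda>n. char (?D n) s) \<longlonglongrightarrow> char std_normal_distribution s"
      by (simp only:)
  qed
  moreover have "emeasure std_normal_distribution (frontier {x. u < \<bar>x + \<theta>\<bar>}) = 0"
  proof -
    have "open {x. u < \<bar>x + \<theta>\<bar>}"
      by (intro open_Collect_less continuous_intros)
    moreover have "closed {x. u \<le> \<bar>x + \<theta>\<bar>}"
      by (intro closed_Collect_le continuous_intros)
    then have "closure {x. u < \<bar>x + \<theta>\<bar>} \<subseteq> {x. u \<le> \<bar>x + \<theta>\<bar>}"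
      by (intro closure_minimal) auto
    ultimately have "frontier {x. u < \<bar>x + \<theta>\<bar>} \<subseteq> {u - \<theta>, - u - \<theta>}"
      by (auto simp: frontier_def interior_open)
    moreover have "{a} \<in> null_sets std_normal_distribution" for a
      using std_normal_singleton[of a] by (auto simp: null_sets_def std_normal.emeasure_eq_measure)
    then have "{u - \<theta>} \<union> {- u - \<theta>} \<in> null_sets std_normal_distribution"
      by (rule null_sets.Un) fact
    moreover have "frontier {x. u < \<bar>x + \<theta>\<bar>} \<in> sets std_normal_distribution"
      unfolding sets_density sets_lborel by (intro borel_closed frontier_closed)
    ultimately have "frontier {x. u < \<bar>x + \<theta>\<bar>} \<in> null_sets std_normal_distribution"
      by (metis null_sets_subset insert_is_Un)
    then show ?thesis
      by (rule null_setsD1)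
  qed
  ultimately have "(\<lambda>n. measure (?D n) {x. u < \<bar>x + \<theta>\<bar>}) \<longlonglongrightarrow>
      measure std_normal_distribution {x. u < \<bar>x + \<theta>\<bar>}"
    by (intro weak_conv_imp_continuity_set_conv D real_dist_normal_dist) auto
  moreover have "measure (?D n) {x. u < \<bar>x + \<theta>\<bar>} =
      measure (N n) {\<omega> \<in> space (N n). u < \<bar>X n \<omega>\<bar>}" for n
    by (subst measure_distr) (auto intro!: arg_cong[where f = "measure (N n)"])
  ultimately show ?thesis
    using gauss_power_eq_measure[OF u] by simp
qed

context prob_space
begin

lemma exp_tilt_two_sided_limit:
  assumes h: "bounded_score M h" and \<kappa>: "\<kappa> \<in> L2_zero M" "L2_norm M \<kappa> = 1" and u: "0 \<le> u"
  shows "(\<lambda>n. \<integral>\<omega>. (if u < \<bar>normalized_sum n \<kappa> \<omega>\<bar> then 1 else 0) \<partial>prod_power n (exp_tilt M h n))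
    \<longlonglongrightarrow> gauss_power u (expectation (\<lambda>x. h x * \<kappa> x))"
proof -
  have [measurable]: "\<kappa> \<in> borel_measurable M"
    using \<kappa> by (auto simp: L2_zero_def intro: L2_measurable)
  have sets: "sets (prod_power n (exp_tilt M h n)) = sets (prod_power n M)" for n
    by (intro sets_PiM_cong) (auto simp: exp_tilt_def)
  have meas: "normalized_sum n \<kappa> \<in> borel_measurable (prod_power n (exp_tilt M h n))" for n
    unfolding measurable_cong_sets[OF sets refl] by measurable
  note [measurable] = meas
  have "(\<lambda>n. measure (prod_power n (exp_tilt M h n))
      {\<omega> \<in> space (prod_power n (exp_tilt M h n)). u < \<bar>normalized_sum n \<kappa> \<omega>\<bar>}) \<longlonglongrightarrow>
      gauss_power u (expectation (\<lambda>x. h x * \<kappa> x))"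
  proof (rule prob_gaussian_limit[OF _ meas _ u])
    show "prob_space (prod_power n (exp_tilt M h n))" for n
      by (intro prob_space_PiM prob_space_exp_tilt h)
    show "(\<lambda>n. \<integral>\<omega>. iexp (s * normalized_sum n \<kappa> \<omega>) \<partial>prod_power n (exp_tilt M h n)) \<longlonglongrightarrow>
        exp (\<i> * s * expectation (\<lambda>x. h x * \<kappa> x) - complex_of_real (s\<^sup>2 / 2))" for s
      using exp_tilt_char_limit[OF h \<kappa>(1), of s] \<kappa>(2) by simp
  qed
  moreover have "(\<integral>\<omega>. (if u < \<bar>normalized_sum n \<kappa> \<omega>\<bar> then 1 else 0) \<partial>prod_power n (exp_tilt M h n)) =
      measure (prod_power n (exp_tilt M h n))
      {\<omega> \<in> space (prod_power n (exp_tilt M h n)). u < \<bar>normalized_sum n \<kappa> \<omega>\<bar>}" (is "?l = ?r") for n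
  proof -
    have "?l = (\<integral>\<omega>. indicator {\<omega> \<in> space (prod_power n (exp_tilt M h n)). u < \<bar>normalized_sum n \<kappa> \<omega>\<bar>} \<omega>
        \<partial>prod_power n (exp_tilt M h n))"
      by (intro Bochner_Integration.integral_cong refl) (auto simp: indicator_def)
    then show ?thesis
      by simp
  qed
  ultimately show ?thesis
    by simp
qed

text \<open>The root of the tilted density is differentiable in quadratic mean with derivative
  \<open>h / 2\<close>. Boundedness of \<open>h\<close> even gives a uniform error of order 1 / sqrt
  n, made of the Taylor remainder of the exponential and of the normalisation.\<close>

lemma exp_score_root_limit:
  assumes h: "bounded_score M h"
  shows "(\<lambda>n. L2_norm M (\<lambda>x. sqrt n * (sqrt (exp (h x / sqrt n) / tilt_mass M h n) - 1) - h x / 2))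
    \<longlonglongrightarrow> 0"
proof -
  note [measurable] = bounded_score_measurable[OF h]
  obtain B where B: "\<And>x. x \<in> space M \<Longrightarrow> \<bar>h x\<bar> \<le> B"
    using h by (auto simp: bounded_score_def)
  let ?m = "\<lambda>n. tilt_mass M h n"
  let ?f = "\<lambda>n x. sqrt n * (sqrt (exp (h x / sqrt n) / ?m n) - 1) - h x / 2"
  let ?b = "\<lambda>n. exp B * (B\<^sup>2 + real n * (?m n - 1)) / sqrt n"
  have bound: "\<bar>?f n x\<bar> \<le> ?b n" if n: "0 < n" and x: "x \<in> space M" for n x
  proof -
    \<comment> \<open>The root halves the exponent of the density.\<close>
    define z where "z = h x / (2 * sqrt n)"
    have m: "1 \<le> ?m n"
      by (rule tilt_mass_ge_1[OF h])
    have r: "sqrt (exp (h x / sqrt n)) = exp z"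
    proof -
      have "exp (h x / sqrt n) = exp z * exp z"
        unfolding exp_add[symmetric] z_def by (simp add: field_simps)
      then show ?thesis
        by simp
    qed
    have hz: "h x / 2 = sqrt n * z"
      using n by (simp add: z_def)
    have z: "\<bar>z\<bar> \<le> B" "z\<^sup>2 * n \<le> B\<^sup>2"
    proof -
      have "\<bar>h x / sqrt n\<bar> \<le> B"
        by (rule abs_divide_sqrt_le[OF B[OF x]])
      moreover have "\<bar>z\<bar> = \<bar>h x / sqrt n\<bar> / 2"
        by (simp add: z_def abs_divide)
      moreover have "a / 2 \<le> B" if "0 \<le> a" "a \<le> B" for a
        using that by simp
      ultimately show "\<bar>z\<bar> \<le> B"
        by simp
      have "(h x)\<^sup>2 \<le> B\<^sup>2"
        using power_mono[OF B[OF x] abs_ge_zero, of 2] by simp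
      moreover have "z\<^sup>2 * n = (h x)\<^sup>2 / 4"
        using n by (simp add: z_def power_divide power_mult_distrib)
      ultimately show "z\<^sup>2 * n \<le> B\<^sup>2"
        using zero_le_power2[of "h x"] by linarith
    qed
    have "\<bar>exp z - 1 - z\<bar> \<le> exp B * z\<^sup>2"
    proof -
      have "norm (complex_of_real (exp z - 1 - z)) \<le> exp \<bar>z\<bar> * \<bar>z\<bar>\<^sup>2"
        using Taylor_exp[of "complex_of_real z" 1]
        by (simp add: exp_of_real diff_diff_eq numeral_2_eq_2)
      also have "\<dots> \<le> exp B * \<bar>z\<bar>\<^sup>2"
        using z(1) by (intro mult_right_mono) auto
      finally show ?thesis
        unfolding norm_of_real by simp
    qed
    then have 1: "\<bar>sqrt n * (exp z - 1 - z)\<bar> \<le> sqrt n * (exp B * z\<^sup>2)"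
      unfolding abs_mult by (intro mult_mono) auto
    have "\<bar>1 / sqrt (?m n) - 1\<bar> = (sqrt (?m n) - 1) / sqrt (?m n)"
      using m by (simp add: abs_if field_simps)
    also have "\<dots> \<le> (sqrt (?m n) - 1) / 1"
      using m by (intro divide_left_mono) auto
    also have "\<dots> \<le> ?m n - 1"
      using m by (simp add: real_le_lsqrt power2_eq_square real_sqrt_le_iff' sqrt_le_D real_le_rsqrt)
    finally have 2: "\<bar>sqrt n * (exp z * (1 / sqrt (?m n) - 1))\<bar> \<le> sqrt n * (exp B * (?m n - 1))"
      unfolding abs_mult using z(1) by (intro mult_mono) auto
    \<comment> \<open>First the Taylor error of the unnormalised root, then the effect of dividing
      by the root of the tilt mass.\<close>
    have "?f n x = sqrt n * (exp z - 1 - z) + sqrt n * (exp z * (1 / sqrt (?m n) - 1))"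
      unfolding real_sqrt_divide r hz by (simp add: algebra_simps)
    then have "\<bar>?f n x\<bar> \<le> sqrt n * (exp B * z\<^sup>2) + sqrt n * (exp B * (?m n - 1))"
      using 1 2 by linarith
    also have "\<dots> = exp B * (z\<^sup>2 * n + real n * (?m n - 1)) / sqrt n"
    proof -
      define q where "q = sqrt n"
      have "real n = q * q" "q \<noteq> 0"
        using n by (simp_all add: q_def)
      then show ?thesis
        unfolding q_def[symmetric] by (simp add: field_simps)
    qed
    also have "\<dots> \<le> ?b n"
      using z(2) by (intro divide_right_mono mult_left_mono add_right_mono) auto
    finally show ?thesis .
  qed
  have norm_bound: "L2_norm M (?f n) \<le> ?b n" if n: "0 < n" for n
  proof -
    obtain b where b: "b = ?b n"
      by simp
    have b0: "0 \<le> b"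
      using tilt_mass_ge_1[OF h, of n] by (simp add: b)
    have fb: "\<bar>?f n x\<bar> \<le> b" if "x \<in> space M" for x
      unfolding b by (rule bound[OF n that])
    have f: "?f n \<in> L2 M"
      by (rule L2_bounded[OF _ fb]) measurable
    have "(L2_norm M (?f n))\<^sup>2 \<le> expectation (\<lambda>x. b\<^sup>2)"
      unfolding L2_norm_sq
      by (intro integral_mono_AE L2_integrable_sq[OF f] integrable_const AE_I2)
        (simp only: abs_le_square_iff[symmetric] abs_of_nonneg[OF b0] fb)
    then have "L2_norm M (?f n) \<le> b"
      by (intro power2_le_imp_le[OF _ b0]) (simp add: prob_space)
    then show ?thesis
      unfolding b .
  qed
  have "(\<lambda>n. exp B * (B\<^sup>2 + real n * (?m n - 1)) * (1 / sqrt n)) \<longlonglongrightarrow>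
      exp B * (B\<^sup>2 + (L2_norm M h)\<^sup>2 / 2) * 0"
    by (intro tendsto_intros tilt_mass_limit h) real_asymp
  then have "?b \<longlonglongrightarrow> 0"
    by simp
  moreover have "\<forall>\<^sub>F n in sequentially. norm (L2_norm M (?f n)) \<le> ?b n"
    using eventually_gt_at_top[of 0]
    by eventually_elim (simp only: real_norm_def abs_of_nonneg[OF L2_norm_nonneg] norm_bound)
  ultimately show ?thesis
    by (rule Lim_null_comparison[rotated])
qed

end

section \<open>Comparison of product experiments\<close>

text \<open>
  The part of \<open>Q\<close> on \<open>S\<close> has density \<open>r\<^sup>2\<close>; its complement carries the mass singular to \<open>M\<close>.
  Hellinger affinities \<open>\<integral>r s\<close> are multiplicative under products, total variation distances are not.
\<close>

lemma (in prob_space) prod_power_total_variation: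
  fixes r s :: "'a \<Rightarrow> real"
  assumes Q: "prob_space Q" "sets Q = sets M" and S: "S \<in> sets M"
    and r [measurable]: "r \<in> borel_measurable M" and s: "s \<in> L2 M" "L2_norm M s = 1"
    and dQ: "density Q (indicator S) = density M (\<lambda>x. ennreal ((r x)\<^sup>2))"
    and \<psi>: "is_test (prod_power n M) \<psi>"
  shows "r \<in> L2 M" "(L2_norm M r)\<^sup>2 = measure Q S"
    and "\<bar>(\<integral>\<omega>. \<psi> \<omega> \<partial>prod_power n Q) -
          (\<integral>\<omega>. \<psi> \<omega> \<partial>prod_power n (density M (\<lambda>x. ennreal ((s x)\<^sup>2))))\<bar>
        \<le> 1 - measure Q S ^ n +
          2 * sqrt (measure Q S ^ n + 1 - 2 * (expectation (\<lambda>x. r x * s x)) ^ n)"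
proof -
  interpret Q: prob_space Q by fact
  interpret Mn: prob_space "prod_power n M" by (rule prob_space_prod_power)
  interpret Qn: prob_space "prod_power n Q" by (rule Q.prob_space_prod_power)
  note sL2 = s(1)
  note [measurable] = L2_measurable[OF s(1)]
  let ?p = "measure Q S"
  have SQ [measurable]: "S \<in> sets Q"
    using S Q by simp
  have nn: "(\<integral>\<^sup>+x. ennreal ((r x)\<^sup>2) \<partial>M) = ennreal ?p"
  proof -
    have "(\<integral>\<^sup>+x. ennreal ((r x)\<^sup>2) \<partial>M) = emeasure (density M (\<lambda>x. ennreal ((r x)\<^sup>2))) (space M)"
      by (subst emeasure_density) (auto cong: nn_integral_cong)
    also have "\<dots> = emeasure (density Q (indicator S)) (space Q)"
      unfolding dQ by (simp add: sets_eq_imp_space_eq[OF Q(2)])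
    also have "\<dots> = (\<integral>\<^sup>+x. indicator S x * indicator (space Q) x \<partial>Q)"
      by (intro emeasure_density) auto
    also have "\<dots> = (\<integral>\<^sup>+x. indicator S x \<partial>Q)"
      by (intro nn_integral_cong) auto
    also have "\<dots> = ennreal ?p"
      by (simp add: Q.emeasure_eq_measure)
    finally show ?thesis .
  qed
  show rL2: "r \<in> L2 M"
    unfolding L2_def using nn by (auto intro!: integrableI_nonneg)
  show rnorm: "(L2_norm M r)\<^sup>2 = ?p"
  proof -
    have "ennreal (expectation (\<lambda>x. (r x)\<^sup>2)) = ennreal ?p"
      using nn L2_integrable_sq[OF rL2] by (subst nn_integral_eq_integral[symmetric]) auto
    then show ?thesis
      unfolding L2_norm_sq by (subst (asm) ennreal_inj) auto
  qed
  \<comment> \<open>\<open>R\<close> and \<open>T\<close> are the root densities of the two products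
    with respect to the product of \<open>M\<close>; \<open>I\<close> indicates that no observation
    falls into the singular part of \<open>Q\<close>.\<close>
  define R where "R = (\<lambda>\<omega>::nat \<Rightarrow> 'a. \<Prod>i<n. r (\<omega> i))"
  define T where "T = (\<lambda>\<omega>::nat \<Rightarrow> 'a. \<Prod>i<n. s (\<omega> i))"
  define I where "I = (\<lambda>\<omega>::nat \<Rightarrow> 'a. \<Prod>i<n. indicator S (\<omega> i) :: real)"
  have setsQn: "sets (prod_power n Q) = sets (prod_power n M)"
    using Q by (intro sets_PiM_cong) auto
  have meas [measurable]: "R \<in> borel_measurable (prod_power n M)"
      "T \<in> borel_measurable (prod_power n M)" "I \<in> borel_measurable (prod_power n Q)"
    unfolding R_def T_def I_def by measurable
  have \<psi>m [measurable]: "\<psi> \<in> borel_measurable (prod_power n M)"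
    and \<psi>01: "\<And>\<omega>. \<omega> \<in> space (prod_power n M) \<Longrightarrow> 0 \<le> \<psi> \<omega> \<and> \<psi> \<omega> \<le> 1"
    using \<psi> by (auto simp: is_test_def)
  have \<psi>mQ [measurable]: "\<psi> \<in> borel_measurable (prod_power n Q)"
    unfolding measurable_cong_sets[OF setsQn refl] by fact
  have \<psi>01Q: "\<omega> \<in> space (prod_power n Q) \<Longrightarrow> 0 \<le> \<psi> \<omega> \<and> \<psi> \<omega> \<le> 1" for \<omega>
    using \<psi>01 sets_eq_imp_space_eq[OF setsQn] by simp
  have I01: "0 \<le> I \<omega>" "I \<omega> \<le> 1" for \<omega>
    unfolding I_def by (auto intro: prod_nonneg prod_le_1)
  have RL2: "R \<in> L2 (prod_power n M)" and TL2: "T \<in> L2 (prod_power n M)"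
    and Rn: "(L2_norm (prod_power n M) R)\<^sup>2 = ?p ^ n"
    and Tn: "(L2_norm (prod_power n M) T)\<^sup>2 = 1"
    and RT: "(\<integral>\<omega>. R \<omega> * T \<omega> \<partial>prod_power n M) = (expectation (\<lambda>x. r x * s x)) ^ n"
    using prod_power_integral_prod[OF L2_integrable_sq[OF rL2], of n]
      prod_power_integral_prod[OF L2_integrable_sq[OF sL2], of n]
      prod_power_integral_prod[OF L2_integrable_mult[OF rL2 sL2], of n] meas
      rnorm s(2) L2_norm_sq[of M s]
    by (auto simp: L2_def L2_norm_sq R_def T_def prod_power_distrib prod.distrib)
  have dens: "density (prod_power n Q) (\<lambda>\<omega>. ennreal (I \<omega>)) =
      density (prod_power n M) (\<lambda>\<omega>. ennreal ((R \<omega>)\<^sup>2))"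
  proof -
    \<comment> \<open>The restriction of \<open>Q\<close> to \<open>S\<close> may have total mass
      below 1.\<close>
    have fin: "sigma_finite_measure (density Q (indicator S))"
      by (intro finite_measure.axioms(1) finite_measure_restricted)
        (auto intro: Q.finite_measure_restricted finite_measure.axioms(1))
    have "density (prod_power n Q) (\<lambda>\<omega>. \<Prod>i<n. indicator S (\<omega> i)) = prod_power n (density Q (indicator S))"
      by (intro PiM_density[symmetric] fin Q.sigma_finite_measure_axioms) auto
    also have "\<dots> = density (prod_power n M) (\<lambda>\<omega>. \<Prod>i<n. ennreal ((r (\<omega> i))\<^sup>2))"
      unfolding dQ using fin
      by (intro PiM_density sigma_finite_measure_axioms) (auto simp: dQ)
    also have "(\<lambda>\<omega>. \<Prod>i<n. ennreal ((r (\<omega> i))\<^sup>2)) = (\<lambda>\<omega>. ennreal ((R \<omega>)\<^sup>2))"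
      by (simp add: R_def prod_ennreal prod_power_distrib)
    also have "(\<lambda>\<omega>. \<Prod>i<n. indicator S (\<omega> i)) = (\<lambda>\<omega>. ennreal (I \<omega>))"
      unfolding I_def by (subst prod_ennreal[symmetric]) (auto simp: ennreal_indicator)
    finally show ?thesis .
  qed
  have "(\<integral>\<omega>. I \<omega> *\<^sub>R \<psi> \<omega> \<partial>prod_power n Q) = (\<integral>\<omega>. \<psi> \<omega> \<partial>density (prod_power n Q) (\<lambda>\<omega>. ennreal (I \<omega>)))"
    by (intro integral_density[symmetric]) (auto simp: I01)
  also have "\<dots> = (\<integral>\<omega>. (R \<omega>)\<^sup>2 *\<^sub>R \<psi> \<omega> \<partial>prod_power n M)"
    unfolding dens by (intro integral_density) auto
  finally have QI: "(\<integral>\<omega>. I \<omega> * \<psi> \<omega> \<partial>prod_power n Q) = (\<integral>\<omega>. (R \<omega>)\<^sup>2 * \<psi> \<omega> \<partial>prod_power n M)"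
    by simp
  have intQ: "integrable (prod_power n Q) \<psi>" "integrable (prod_power n Q) I"
    "integrable (prod_power n Q) (\<lambda>\<omega>. I \<omega> * \<psi> \<omega>)"
    using \<psi>01Q I01
    by (auto intro!: Qn.integrable_const_bound[where B = 1] AE_I2 mult_le_one simp: abs_mult)
  have EI: "(\<integral>\<omega>. I \<omega> \<partial>prod_power n Q) = ?p ^ n"
  proof -
    have "integrable Q (indicator S :: _ \<Rightarrow> real)"
      by (intro integrable_real_indicator) (auto simp: Q.emeasure_eq_measure)
    from Q.prod_power_integral_prod(2)[OF this, of n] show ?thesis
      by (simp add: I_def)
  qed
  \<comment> \<open>Discarding the samples with at least one singular observation costs at most
    their probability, \<open>1 - ?p ^ n\<close>.\<close>
  have 1: "\<bar>(\<integral>\<omega>. \<psi> \<omega> \<partial>prod_power n Q) - (\<integral>\<omega>. I \<omega> * \<psi> \<omega> \<partial>prod_power n Q)\<bar> \<le> 1 - ?p ^ n"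
  proof -
    have "(\<integral>\<omega>. \<psi> \<omega> - I \<omega> * \<psi> \<omega> \<partial>prod_power n Q) \<le> (\<integral>\<omega>. 1 - I \<omega> \<partial>prod_power n Q)"
    proof (intro integral_mono Bochner_Integration.integrable_diff intQ)
      fix \<omega> assume "\<omega> \<in> space (prod_power n Q)"
      then have "(1 - I \<omega>) * \<psi> \<omega> \<le> (1 - I \<omega>) * 1"
        using \<psi>01Q I01[of \<omega>] by (intro mult_left_mono) auto
      then show "\<psi> \<omega> - I \<omega> * \<psi> \<omega> \<le> 1 - I \<omega>"
        by (simp add: algebra_simps)
    qed auto
    moreover have "0 \<le> (\<integral>\<omega>. \<psi> \<omega> - I \<omega> * \<psi> \<omega> \<partial>prod_power n Q)"
      using \<psi>01Q I01 by (intro integral_nonneg_AE AE_I2) (simp add: mult_left_le_one_le)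
    ultimately show ?thesis
      using intQ EI by (simp add: Qn.prob_space)
  qed
  have sdens: "(\<integral>\<omega>. \<psi> \<omega> \<partial>prod_power n (density M (\<lambda>x. ennreal ((s x)\<^sup>2)))) =
      (\<integral>\<omega>. (T \<omega>)\<^sup>2 * \<psi> \<omega> \<partial>prod_power n M)"
  proof -
    have "prob_space (density M (\<lambda>x. ennreal ((s x)\<^sup>2)))"
    proof (rule prob_spaceI)
      have "emeasure (density M (\<lambda>x. ennreal ((s x)\<^sup>2))) (space M) = (\<integral>\<^sup>+x. ennreal ((s x)\<^sup>2) \<partial>M)"
        by (subst emeasure_density) (auto cong: nn_integral_cong)
      also have "\<dots> = ennreal (expectation (\<lambda>x. (s x)\<^sup>2))"
        by (intro nn_integral_eq_integral L2_integrable_sq sL2) auto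
      also have "expectation (\<lambda>x. (s x)\<^sup>2) = 1"
        using s(2) L2_norm_sq[of M s] by simp
      finally show "emeasure (density M (\<lambda>x. ennreal ((s x)\<^sup>2)))
          (space (density M (\<lambda>x. ennreal ((s x)\<^sup>2)))) = 1"
        by simp
    qed
    then have "prod_power n (density M (\<lambda>x. ennreal ((s x)\<^sup>2))) =
        density (prod_power n M) (\<lambda>\<omega>. \<Prod>i<n. ennreal ((s (\<omega> i))\<^sup>2))"
      by (intro PiM_density sigma_finite_measure_axioms)
        (auto intro: finite_measure.axioms(1) prob_space.axioms(1))
    also have "(\<lambda>\<omega>. \<Prod>i<n. ennreal ((s (\<omega> i))\<^sup>2)) = (\<lambda>\<omega>. ennreal ((T \<omega>)\<^sup>2))"
      by (simp add: T_def prod_ennreal prod_power_distrib)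
    finally show ?thesis
      by (simp add: integral_density)
  qed
  have intM: "integrable (prod_power n M) (\<lambda>\<omega>. (f \<omega>)\<^sup>2 * \<psi> \<omega>)"
    if f: "f \<in> L2 (prod_power n M)" for f
    using \<psi>01 L2_measurable[OF f]
    by (intro Bochner_Integration.integrable_bound[OF L2_integrable_sq[OF f]] AE_I2)
      (auto simp: abs_mult mult_left_le)
  note intM = intM[OF RL2] intM[OF TL2]
  \<comment> \<open>Factor R^2 - T^2 = (R - T)(R + T) and apply Cauchy-Schwarz: the norm of the
    second factor is at most 2, and the square of the norm of the first is computed from the
    affinity, which is an n-th power.\<close>
  let ?D = "\<lambda>\<omega>. \<bar>R \<omega> - T \<omega>\<bar>" and ?A = "\<lambda>\<omega>. \<bar>R \<omega> + T \<omega>\<bar>"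
  have abs_L2: "(\<lambda>\<omega>. \<bar>f \<omega>\<bar>) \<in> L2 N" if "f \<in> L2 N" for f :: "'b \<Rightarrow> real" and N
    using that by (auto simp: L2_def)
  have D: "?D \<in> L2 (prod_power n M)" and A: "?A \<in> L2 (prod_power n M)"
    using RL2 TL2 by (auto intro!: abs_L2)
  have "\<bar>(\<integral>\<omega>. (R \<omega>)\<^sup>2 * \<psi> \<omega> \<partial>prod_power n M) - (\<integral>\<omega>. (T \<omega>)\<^sup>2 * \<psi> \<omega> \<partial>prod_power n M)\<bar> =
      \<bar>\<integral>\<omega>. (R \<omega>)\<^sup>2 * \<psi> \<omega> - (T \<omega>)\<^sup>2 * \<psi> \<omega> \<partial>prod_power n M\<bar>"
    using intM by simp
  also have "\<dots> \<le> (\<integral>\<omega>. \<bar>(R \<omega>)\<^sup>2 * \<psi> \<omega> - (T \<omega>)\<^sup>2 * \<psi> \<omega>\<bar> \<partial>prod_power n M)"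
    by (rule integral_abs_bound)
  also have "\<dots> \<le> (\<integral>\<omega>. ?D \<omega> * ?A \<omega> \<partial>prod_power n M)"
  proof (intro integral_mono L2_integrable_mult D A)
    fix \<omega> assume "\<omega> \<in> space (prod_power n M)"
    then have "?D \<omega> * ?A \<omega> * \<bar>\<psi> \<omega>\<bar> \<le> ?D \<omega> * ?A \<omega>"
      using \<psi>01 by (intro mult_left_le) auto
    moreover have "(R \<omega>)\<^sup>2 * \<psi> \<omega> - (T \<omega>)\<^sup>2 * \<psi> \<omega> = (R \<omega> - T \<omega>) * (R \<omega> + T \<omega>) * \<psi> \<omega>"
      by (simp add: power2_eq_square algebra_simps)
    ultimately show "\<bar>(R \<omega>)\<^sup>2 * \<psi> \<omega> - (T \<omega>)\<^sup>2 * \<psi> \<omega>\<bar> \<le> ?D \<omega> * ?A \<omega>"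
      by (simp add: abs_mult)
  qed (use intM in auto)
  also have "\<dots> \<le> L2_norm (prod_power n M) ?D * L2_norm (prod_power n M) ?A"
    using L2_Cauchy_Schwarz[OF D A] by linarith
  also have "\<dots> \<le> sqrt (?p ^ n + 1 - 2 * (expectation (\<lambda>x. r x * s x)) ^ n) * 2"
  proof -
    have "(L2_norm (prod_power n M) ?D)\<^sup>2 = (\<integral>\<omega>. (R \<omega>)\<^sup>2 + (T \<omega>)\<^sup>2 - 2 * (R \<omega> * T \<omega>) \<partial>prod_power n M)"
      unfolding L2_norm_sq by (simp add: power2_diff mult.assoc)
    also have "\<dots> = (L2_norm (prod_power n M) R)\<^sup>2 + (L2_norm (prod_power n M) T)\<^sup>2 -
        2 * (\<integral>\<omega>. R \<omega> * T \<omega> \<partial>prod_power n M)"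
      unfolding L2_norm_sq
      using L2_integrable_sq[OF RL2] L2_integrable_sq[OF TL2] L2_integrable_mult[OF RL2 TL2]
      by simp
    finally have DD: "L2_norm (prod_power n M) ?D \<le>
        sqrt (?p ^ n + 1 - 2 * (expectation (\<lambda>x. r x * s x)) ^ n)"
      unfolding Rn Tn RT by (intro real_le_rsqrt) simp
    have "L2_norm (prod_power n M) ?A = L2_norm (prod_power n M) (\<lambda>\<omega>. R \<omega> + T \<omega>)"
      by (simp add: L2_norm_def)
    also have "\<dots> \<le> L2_norm (prod_power n M) R + L2_norm (prod_power n M) T"
      by (rule L2_norm_triangle[OF RL2 TL2])
    also have "L2_norm (prod_power n M) R \<le> 1"
      by (rule power2_le_imp_le) (simp_all add: Rn power_le_one)
    also have "L2_norm (prod_power n M) T \<le> 1"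
      by (rule power2_le_imp_le) (simp_all add: Tn)
    finally have AA: "L2_norm (prod_power n M) ?A \<le> 2"
      by simp
    show ?thesis
      by (rule mult_mono[OF DD AA order_trans[OF L2_norm_nonneg DD] L2_norm_nonneg])
  qed
  finally have 2: "\<bar>(\<integral>\<omega>. (R \<omega>)\<^sup>2 * \<psi> \<omega> \<partial>prod_power n M) - (\<integral>\<omega>. (T \<omega>)\<^sup>2 * \<psi> \<omega> \<partial>prod_power n M)\<bar> \<le>
      2 * sqrt (?p ^ n + 1 - 2 * (expectation (\<lambda>x. r x * s x)) ^ n)"
    by simp
  show "\<bar>(\<integral>\<omega>. \<psi> \<omega> \<partial>prod_power n Q) -
          (\<integral>\<omega>. \<psi> \<omega> \<partial>prod_power n (density M (\<lambda>x. ennreal ((s x)\<^sup>2))))\<bar>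
        \<le> 1 - ?p ^ n + 2 * sqrt (?p ^ n + 1 - 2 * (expectation (\<lambda>x. r x * s x)) ^ n)"
    using 1 2 unfolding sdens QI by linarith
qed

text \<open>
  \<open>h\<close> is the local parameter \<open>c \<cdot> g\<close> of the sequence \<open>Q n\<close>, where \<open>g\<close> is the tangent of the curve and
  \<open>c\<close> the limit of \<open>t n * sqrt n\<close>; \<open>r n\<close> is the root of the density of the absolutely continuous part.
\<close>

definition score_sequence :: "'a measure \<Rightarrow> (nat \<Rightarrow> 'a measure) \<Rightarrow> ('a \<Rightarrow> real) \<Rightarrow> bool" where
  "score_sequence P Q h \<longleftrightarrow> h \<in> L2 P \<and>
     (\<exists>r S. (\<forall>n\<ge>1. prob_space (Q n) \<and> sets (Q n) = sets P \<and> r n \<in> borel_measurable P \<and>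
          S n \<in> sets P \<and>
          density (Q n) (indicator (S n)) = density P (\<lambda>x. ennreal ((r n x)\<^sup>2))) \<and>
        (\<lambda>n. real n * (1 - measure (Q n) (S n))) \<longlonglongrightarrow> 0 \<and>
        (\<lambda>n. L2_norm P (\<lambda>x. sqrt n * (r n x - 1) - h x / 2)) \<longlonglongrightarrow> 0)"

text \<open>The limit of the bound in \<open>prod_power_total_variation\<close> when the two scores
  have L2 distance \<open>d\<close>: the singular part disappears, and the n-th power of the
  affinity tends to exp(-d^2/8).\<close>

definition variation_bound :: "real \<Rightarrow> real" where
  "variation_bound d = 2 * sqrt (2 - 2 * exp (- d\<^sup>2 / 8))"

lemma variation_bound_tendsto:
  "(f \<longlongrightarrow> 0) F \<Longrightarrow> ((\<lambda>x. variation_bound (f x)) \<longlongrightarrow> 0) F"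
  unfolding variation_bound_def by (auto intro!: tendsto_eq_intros)

lemma real_power_tendsto_exp:
  fixes a :: "nat \<Rightarrow> real"
  assumes "(\<lambda>n. real n * (a n - 1)) \<longlonglongrightarrow> l"
  shows "(\<lambda>n. a n ^ n) \<longlonglongrightarrow> exp l"
proof -
  have "(\<lambda>n. complex_of_real (real n * (a n - 1))) \<longlonglongrightarrow> complex_of_real l"
    using assms unfolding tendsto_of_real_iff .
  then have "(\<lambda>n. of_nat n * (complex_of_real (a n) - 1)) \<longlonglongrightarrow> complex_of_real l"
    by simp
  then have "(\<lambda>n. complex_of_real (a n ^ n)) \<longlonglongrightarrow> complex_of_real (exp l)"
    unfolding of_real_power exp_of_real[symmetric] by (rule power_tendsto_exp)
  then show ?thesis
    unfolding tendsto_of_real_iff .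
qed

text \<open>The order of the quantifiers matters: one error sequence \<open>e\<close> serves all
  tests at once. Both root densities have expansions in quadratic mean, so their distance is
  asymptotically \<open>1 / (2 sqrt n)\<close> times that of the scores, and this determines the
  affinity up to o(1/n).\<close>

lemma (in prob_space) score_sequence_exp_tilt:
  assumes Q: "score_sequence M Q h" and h': "bounded_score M h'"
  shows "\<exists>e. e \<longlonglongrightarrow> variation_bound (L2_norm M (\<lambda>x. h x - h' x)) \<and>
    (\<forall>\<psi> n. 1 \<le> n \<longrightarrow> is_test (prod_power n M) (\<psi> n) \<longrightarrow>
      \<bar>test_power \<psi> Q n - test_power \<psi> (exp_tilt M h') n\<bar> \<le> e n)"
proof -
  obtain r S where hL2: "h \<in> L2 M"
    and QS: "\<And>n. 1 \<le> n \<Longrightarrow> prob_space (Q n)" "\<And>n. 1 \<le> n \<Longrightarrow> sets (Q n) = sets M"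
      "\<And>n. 1 \<le> n \<Longrightarrow> r n \<in> borel_measurable M" "\<And>n. 1 \<le> n \<Longrightarrow> S n \<in> sets M"
      "\<And>n. 1 \<le> n \<Longrightarrow> density (Q n) (indicator (S n)) = density M (\<lambda>x. ennreal ((r n x)\<^sup>2))"
    and p: "(\<lambda>n. real n * (1 - measure (Q n) (S n))) \<longlonglongrightarrow> 0"
    and r: "(\<lambda>n. L2_norm M (\<lambda>x. sqrt n * (r n x - 1) - h x / 2)) \<longlonglongrightarrow> 0"
    using Q unfolding score_sequence_def by blast
  note [measurable] = bounded_score_measurable[OF h']
  note h'L2 = bounded_score_L2[OF h']
  define s where "s n x = sqrt (exp (h' x / sqrt n) / tilt_mass M h' n)" for n :: nat and x
  let ?p = "\<lambda>n. measure (Q n) (S n)"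
  let ?rs = "\<lambda>n. expectation (\<lambda>x. r n x * s n x)"
  let ?e = "\<lambda>n. 1 - ?p n ^ n + 2 * sqrt (?p n ^ n + 1 - 2 * ?rs n ^ n)"
  have m: "0 < tilt_mass M h' n" for n
    using tilt_mass_ge_1[OF h', of n] by simp
  have s2: "(s n x)\<^sup>2 = exp (h' x / sqrt n) / tilt_mass M h' n" for n x
    using m[of n] by (simp add: s_def)
  have sL2: "s n \<in> L2 M" for n
  proof -
    have "s n \<in> borel_measurable M"
      unfolding s_def by measurable
    then show ?thesis
      unfolding L2_def using integrable_exp_score[OF h', of n] by (simp add: s2)
  qed
  have s1: "L2_norm M (s n) = 1" for n
    unfolding L2_norm_def s2 using m[of n] by (simp add: tilt_mass_def)
  have tilt: "exp_tilt M h' n = density M (\<lambda>x. ennreal ((s n x)\<^sup>2))" for n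
    by (simp add: exp_tilt_def s2)
  \<comment> \<open>The facts on \<open>r\<close> come from a lemma about a test, which the zero
    test instantiates.\<close>
  have test0: "is_test (prod_power n M) (\<lambda>_. 0)" for n
    by (simp add: is_test_def)
  have rL2: "r n \<in> L2 M" and rp: "(L2_norm M (r n))\<^sup>2 = ?p n" if "1 \<le> n" for n
    using prod_power_total_variation(1,2)[of "Q n" "S n" "r n" "s n" n "\<lambda>_. 0"]
      QS[OF that] sL2[of n] s1[of n] test0[of n] by blast+
  have bound: "\<bar>test_power \<psi> Q n - test_power \<psi> (exp_tilt M h') n\<bar> \<le> ?e n"
    if n: "1 \<le> n" and "is_test (prod_power n M) (\<psi> n)" for \<psi> n
    unfolding test_power_def tilt
    using prod_power_total_variation(3)[of "Q n" "S n" "r n" "s n" n "\<psi> n"]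
      QS[OF n] sL2[of n] s1[of n] that(2) by blast
  have diff: "(\<lambda>n. L2_norm M (\<lambda>x. sqrt n * (r n x - s n x))) \<longlonglongrightarrow>
      L2_norm M (\<lambda>x. 1 / 2 * (h x - h' x))"
  proof (rule L2_norm_tendsto)
    show "\<forall>\<^sub>F n in sequentially. (\<lambda>x. sqrt n * (r n x - s n x)) \<in> L2 M"
      using eventually_ge_at_top[of 1] by eventually_elim (intro L2_scale L2_diff rL2 sL2)
    show "(\<lambda>x. 1 / 2 * (h x - h' x)) \<in> L2 M"
      by (intro L2_scale L2_diff hL2 h'L2)
    have "(\<lambda>n. L2_norm M (\<lambda>x. sqrt n * (r n x - 1) - h x / 2) +
        L2_norm M (\<lambda>x. sqrt n * (s n x - 1) - h' x / 2)) \<longlonglongrightarrow> 0 + 0"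
      unfolding s_def by (intro tendsto_add r exp_score_root_limit h')
    then have lim: "(\<lambda>n. L2_norm M (\<lambda>x. sqrt n * (r n x - 1) - h x / 2) +
        L2_norm M (\<lambda>x. sqrt n * (s n x - 1) - h' x / 2)) \<longlonglongrightarrow> 0"
      by simp
    show "(\<lambda>n. L2_norm M (\<lambda>x. sqrt n * (r n x - s n x) - 1 / 2 * (h x - h' x))) \<longlonglongrightarrow> 0"
    proof (rule Lim_null_comparison[OF _ lim])
      show "\<forall>\<^sub>F n in sequentially.
          norm (L2_norm M (\<lambda>x. sqrt n * (r n x - s n x) - 1 / 2 * (h x - h' x))) \<le>
          L2_norm M (\<lambda>x. sqrt n * (r n x - 1) - h x / 2) +
          L2_norm M (\<lambda>x. sqrt n * (s n x - 1) - h' x / 2)"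
        using eventually_ge_at_top[of 1]
      proof eventually_elim
        case (elim n)
        have 1: "(\<lambda>x. sqrt n * (r n x - 1) - 1 / 2 * h x) \<in> L2 M"
          "(\<lambda>x. sqrt n * (s n x - 1) - 1 / 2 * h' x) \<in> L2 M"
          using elim by (intro L2_scale L2_diff rL2 sL2 hL2 h'L2 L2_const; simp)+
        have "L2_norm M (\<lambda>x. sqrt n * (r n x - s n x) - 1 / 2 * (h x - h' x)) =
          L2_norm M (\<lambda>x. (sqrt n * (r n x - 1) - 1 / 2 * h x) +
            (- 1) * (sqrt n * (s n x - 1) - 1 / 2 * h' x))"
          by (intro arg_cong[where f = "L2_norm M"] ext) (simp add: field_simps)
        also have "\<dots> \<le> L2_norm M (\<lambda>x. sqrt n * (r n x - 1) - 1 / 2 * h x) +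
            L2_norm M (\<lambda>x. (- 1) * (sqrt n * (s n x - 1) - 1 / 2 * h' x))"
          using 1 by (intro L2_norm_triangle L2_scale)
        finally show ?case
          unfolding L2_norm_scale by simp
      qed
    qed
  qed
  \<comment> \<open>By the identity |r - s|^2 = p + 1 - 2 <r, s> this expression is n(<r, s> - 1).
    The constant 8 arises as 2 from that identity times the square of the 2 in
    \<open>h / 2\<close>.\<close>
  have "(\<lambda>n. - (real n * (1 - ?p n) + (L2_norm M (\<lambda>x. sqrt n * (r n x - s n x)))\<^sup>2) / 2) \<longlonglongrightarrow>
      - (0 + (L2_norm M (\<lambda>x. 1 / 2 * (h x - h' x)))\<^sup>2) / 2"
    by (intro tendsto_intros p diff) simp
  also have "- (0 + (L2_norm M (\<lambda>x. 1 / 2 * (h x - h' x)))\<^sup>2) / 2 =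
      - (L2_norm M (\<lambda>x. h x - h' x))\<^sup>2 / 8"
    unfolding L2_norm_scale by (simp add: power_mult_distrib power_divide)
  finally have "(\<lambda>n. real n * (?rs n - 1)) \<longlonglongrightarrow> - (L2_norm M (\<lambda>x. h x - h' x))\<^sup>2 / 8"
  proof (rule Lim_transform_eventually)
    show "\<forall>\<^sub>F n in sequentially.
        - (real n * (1 - ?p n) + (L2_norm M (\<lambda>x. sqrt n * (r n x - s n x)))\<^sup>2) / 2 =
        real n * (?rs n - 1)"
      using eventually_ge_at_top[of 1]
    proof eventually_elim
      case (elim n)
      note rn = rL2[OF elim]
      have "(L2_norm M (\<lambda>x. r n x - s n x))\<^sup>2 =
          expectation (\<lambda>x. (r n x)\<^sup>2 + (s n x)\<^sup>2 - 2 * (r n x * s n x))"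
        unfolding L2_norm_sq by (simp add: power2_diff mult.assoc)
      also have "\<dots> = (L2_norm M (r n))\<^sup>2 + (L2_norm M (s n))\<^sup>2 - 2 * ?rs n"
        unfolding L2_norm_sq
        using L2_integrable_sq[OF rn] L2_integrable_sq[OF sL2[of n]] L2_integrable_mult[OF rn sL2[of n]]
        by simp
      finally have "(L2_norm M (\<lambda>x. r n x - s n x))\<^sup>2 = ?p n + 1 - 2 * ?rs n"
        unfolding rp[OF elim] s1 by simp
      then have rs: "?rs n = (?p n + 1 - (L2_norm M (\<lambda>x. r n x - s n x))\<^sup>2) / 2"
        by simp
      show ?case
        unfolding L2_norm_scale rs by (simp add: power_mult_distrib field_simps)
    qed
  qed
  from real_power_tendsto_exp[OF this]
  have rs: "(\<lambda>n. ?rs n ^ n) \<longlonglongrightarrow> exp (- (L2_norm M (\<lambda>x. h x - h' x))\<^sup>2 / 8)" .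
  have "(\<lambda>n. real n * (?p n - 1)) \<longlonglongrightarrow> 0"
    using tendsto_minus[OF p] by (simp add: algebra_simps)
  from real_power_tendsto_exp[OF this] have pn: "(\<lambda>n. ?p n ^ n) \<longlonglongrightarrow> 1"
    by simp
  have "?e \<longlonglongrightarrow> 1 - 1 + 2 * sqrt (1 + 1 - 2 * exp (- (L2_norm M (\<lambda>x. h x - h' x))\<^sup>2 / 8))"
    by (intro tendsto_intros pn rs)
  then have "?e \<longlonglongrightarrow> variation_bound (L2_norm M (\<lambda>x. h x - h' x))"
    by (simp add: variation_bound_def)
  then show ?thesis
    using bound by blast
qed

section \<open>Optimality of the two-sided test\<close>

context prob_space
begin

text \<open>Truncate and recentre. As \<open>h\<close> has mean zero, the recentring constant is
  itself at most the truncation error, whence the factor 2 in the estimate.\<close>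

lemma bounded_score_approx:
  assumes h: "h \<in> L2_zero M"
  obtains f where "\<And>m::nat. bounded_score M (f m)"
    and "(\<lambda>m. L2_norm M (\<lambda>x. f m x - h x)) \<longlonglongrightarrow> 0"
proof -
  have hL2: "h \<in> L2 M" and h0: "expectation h = 0"
    using h by (auto simp: L2_zero_def)
  note [measurable] = L2_measurable[OF hL2]
  define g where "g m x = (if \<bar>h x\<bar> \<le> real m then h x else 0)" for m :: nat and x
  have gm [measurable]: "g m \<in> borel_measurable M" for m
    unfolding g_def by measurable
  have gb: "\<bar>g m x\<bar> \<le> real m" for m x
    by (simp add: g_def)
  have gL2: "g m \<in> L2 M" for m
    by (rule L2_bounded[OF gm gb])
  have "(\<lambda>m. expectation (\<lambda>x. (g m x - h x)\<^sup>2)) \<longlonglongrightarrow> expectation (\<lambda>x. 0)"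
  proof (rule integral_dominated_convergence)
    show "integrable M (\<lambda>x. (h x)\<^sup>2)"
      by (rule L2_integrable_sq[OF hL2])
    show "AE x in M. (\<lambda>m. (g m x - h x)\<^sup>2) \<longlonglongrightarrow> 0"
    proof (rule AE_I2)
      fix x
      obtain m0 :: nat where "\<bar>h x\<bar> \<le> real m0"
        using real_arch_simple by blast
      then have "\<forall>\<^sub>F m in sequentially. (g m x - h x)\<^sup>2 = 0"
        unfolding eventually_sequentially by (intro exI[of _ m0]) (auto simp: g_def)
      then show "(\<lambda>m. (g m x - h x)\<^sup>2) \<longlonglongrightarrow> 0"
        by (rule tendsto_eventually)
    qed
    show "AE x in M. norm ((g m x - h x)\<^sup>2) \<le> (h x)\<^sup>2" for m
      by (simp add: g_def)
  qed measurable
  then have "(\<lambda>m. sqrt (expectation (\<lambda>x. (g m x - h x)\<^sup>2))) \<longlonglongrightarrow> sqrt 0"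
    by (intro tendsto_real_sqrt) simp
  then have glim: "(\<lambda>m. 2 * L2_norm M (\<lambda>x. g m x - h x)) \<longlonglongrightarrow> 0"
    unfolding L2_norm_def by (auto intro: tendsto_mult_right_zero)
  define f where "f m x = g m x - expectation (g m)" for m x
  have "bounded_score M (f m)" for m
  proof -
    have "\<forall>x\<in>space M. \<bar>f m x\<bar> \<le> real m + \<bar>expectation (g m)\<bar>"
      unfolding f_def using gb[of m] by (auto intro: order_trans[OF abs_triangle_ineq4] add_right_mono)
    moreover have "expectation (f m) = 0"
      unfolding f_def using L2_integrable[OF gL2[of m]] by (simp add: prob_space)
    moreover have "f m \<in> borel_measurable M"
      unfolding f_def by measurable
    ultimately show ?thesis
      unfolding bounded_score_def by blast
  qed
  moreover have "(\<lambda>m. L2_norm M (\<lambda>x. f m x - h x)) \<longlonglongrightarrow> 0"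
  proof (rule Lim_null_comparison[OF _ glim], intro always_eventually allI)
    fix m
    have "L2_norm M (\<lambda>x. f m x - h x) = L2_norm M (\<lambda>x. (g m x - h x) + (- expectation (g m)))"
      by (simp add: f_def algebra_simps)
    also have "\<dots> \<le> L2_norm M (\<lambda>x. g m x - h x) + L2_norm M (\<lambda>x. - expectation (g m))"
      by (intro L2_norm_triangle L2_diff gL2 hL2 L2_const)
    also have "L2_norm M (\<lambda>x. - expectation (g m)) = \<bar>expectation (\<lambda>x. g m x - h x)\<bar>"
      using L2_integrable[OF gL2[of m]] L2_integrable[OF hL2] h0 by (simp add: L2_norm_const)
    also have "\<dots> \<le> L2_norm M (\<lambda>x. g m x - h x)"
      by (intro L2_expectation_le L2_diff gL2 hL2)
    finally show "norm (L2_norm M (\<lambda>x. f m x - h x)) \<le> 2 * L2_norm M (\<lambda>x. g m x - h x)"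
      by simp
  qed
  ultimately show thesis
    by (rule that)
qed

text \<open>Truncation destroys norm and orthogonality, so a Gram-Schmidt step follows it. Both
  relations are restored exactly for each \<open>m\<close>, because the three-point comparison works
  with one fixed \<open>m\<close> and needs the squared norm of \<open>E + \<sigma> K\<close> to
  split.\<close>

lemma orthonormal_bounded_score_approx:
  assumes \<kappa>: "\<kappa> \<in> L2_zero M" "L2_norm M \<kappa> = 1"
    and \<eta>: "\<eta> \<in> L2_zero M" "expectation (\<lambda>x. \<eta> x * \<kappa> x) = 0"
  obtains K E where "\<And>m::nat. bounded_score M (K m)" "\<And>m::nat. bounded_score M (E m)"
    and "\<And>m. L2_norm M (K m) = 1" "\<And>m. expectation (\<lambda>x. E m x * K m x) = 0"
    and "(\<lambda>m. L2_norm M (\<lambda>x. K m x - \<kappa> x)) \<longlonglongrightarrow> 0"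
    and "(\<lambda>m. L2_norm M (\<lambda>x. E m x - \<eta> x)) \<longlonglongrightarrow> 0"
proof -
  have L2: "\<kappa> \<in> L2 M" "\<eta> \<in> L2 M"
    using \<kappa> \<eta> by (auto simp: L2_zero_def)
  obtain K1 where K1: "\<And>m::nat. bounded_score M (K1 m)"
    and K1lim: "(\<lambda>m. L2_norm M (\<lambda>x. K1 m x - \<kappa> x)) \<longlonglongrightarrow> 0"
    using bounded_score_approx[OF \<kappa>(1)] by blast
  obtain E1 where E1: "\<And>m::nat. bounded_score M (E1 m)"
    and E1lim: "(\<lambda>m. L2_norm M (\<lambda>x. E1 m x - \<eta> x)) \<longlonglongrightarrow> 0"
    using bounded_score_approx[OF \<eta>(1)] by blast
  note bL2 = bounded_score_L2[OF K1] bounded_score_L2[OF E1]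
  have norm1: "(\<lambda>m. L2_norm M (K1 m)) \<longlonglongrightarrow> 1"
    using L2_norm_tendsto[OF _ L2(1) K1lim] bL2 \<kappa>(2) by simp
  then have "\<forall>\<^sub>F m in sequentially. 0 < L2_norm M (K1 m)"
    by (rule order_tendstoD) simp
  \<comment> \<open>Early truncations may vanish; the index is shifted past them before dividing by
    the norm.\<close>
  then obtain m0 where m0: "\<And>m. m0 \<le> m \<Longrightarrow> 0 < L2_norm M (K1 m)"
    by (auto simp: eventually_sequentially)
  define nu where "nu m = L2_norm M (K1 (m + m0))" for m
  have nu0: "0 < nu m" for m
    by (simp add: nu_def m0)
  have nu1: "nu \<longlonglongrightarrow> 1"
    unfolding nu_def by (rule LIMSEQ_ignore_initial_segment[OF norm1])
  define K where "K m x = (1 / nu m) * K1 (m + m0) x" for m x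
  have K: "bounded_score M (K m)" for m
    unfolding K_def by (intro bounded_score_scale K1)
  note KL2 = bounded_score_L2[OF K]
  have Kn: "L2_norm M (K m) = 1" for m
    unfolding K_def L2_norm_scale using nu0[of m] by (simp add: nu_def)
  have Klim: "(\<lambda>m. L2_norm M (\<lambda>x. K m x - \<kappa> x)) \<longlonglongrightarrow> 0"
  proof (rule Lim_null_comparison)
    have "(\<lambda>m. \<bar>1 - nu m\<bar> + L2_norm M (\<lambda>x. K1 (m + m0) x - \<kappa> x)) \<longlonglongrightarrow> \<bar>1 - 1\<bar> + 0"
      by (intro tendsto_intros nu1 LIMSEQ_ignore_initial_segment[OF K1lim])
    then show "(\<lambda>m. \<bar>1 - nu m\<bar> + L2_norm M (\<lambda>x. K1 (m + m0) x - \<kappa> x)) \<longlonglongrightarrow> 0"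
      by simp
    show "\<forall>\<^sub>F m in sequentially. norm (L2_norm M (\<lambda>x. K m x - \<kappa> x)) \<le>
        \<bar>1 - nu m\<bar> + L2_norm M (\<lambda>x. K1 (m + m0) x - \<kappa> x)"
    proof (intro always_eventually allI)
      fix m
      have "L2_norm M (\<lambda>x. K m x - K1 (m + m0) x) = L2_norm M (\<lambda>x. (1 - nu m) * K m x)"
        using nu0[of m] by (intro arg_cong[where f = "L2_norm M"] ext) (simp add: K_def field_simps)
      also have "\<dots> = \<bar>1 - nu m\<bar>"
        unfolding L2_norm_scale Kn by simp
      finally show "norm (L2_norm M (\<lambda>x. K m x - \<kappa> x)) \<le>
          \<bar>1 - nu m\<bar> + L2_norm M (\<lambda>x. K1 (m + m0) x - \<kappa> x)"
        using L2_norm_triangle3[OF KL2[of m] bL2(1)[of "m + m0"] L2(1)] by simp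
    qed
  qed
  define a where "a m = expectation (\<lambda>x. E1 m x * K m x)" for m
  have a0: "a \<longlonglongrightarrow> 0"
    unfolding a_def using L2_inner_tendsto[OF bL2(2) L2(2) KL2 L2(1) E1lim Klim] \<eta>(2) by simp
  \<comment> \<open>Subtracting the component along the unit vector \<open>K m\<close> changes
    \<open>E1 m\<close> by \<open>\<bar>a m\<bar>\<close> in norm, which tends to 0 because the
    limits \<open>\<eta>\<close> and \<open>\<kappa>\<close> are orthogonal.\<close>
  define E where "E m x = E1 m x + (- a m) * K m x" for m x
  have E: "bounded_score M (E m)" for m
    unfolding E_def by (intro bounded_score_add bounded_score_scale K E1)
  have EK: "expectation (\<lambda>x. E m x * K m x) = 0" for m
  proof -
    have "expectation (\<lambda>x. E m x * K m x) = expectation (\<lambda>x. E1 m x * K m x - a m * (K m x)\<^sup>2)"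
      by (intro Bochner_Integration.integral_cong refl)
        (simp add: E_def power2_eq_square algebra_simps)
    also have "\<dots> = a m - a m * (L2_norm M (K m))\<^sup>2"
      unfolding L2_norm_sq a_def
      using L2_integrable_mult[OF bL2(2) KL2, of m m] L2_integrable_sq[OF KL2, of m] by simp
    finally show ?thesis
      by (simp add: Kn)
  qed
  have Elim: "(\<lambda>m. L2_norm M (\<lambda>x. E m x - \<eta> x)) \<longlonglongrightarrow> 0"
  proof (rule Lim_null_comparison)
    have "(\<lambda>m. \<bar>a m\<bar> + L2_norm M (\<lambda>x. E1 m x - \<eta> x)) \<longlonglongrightarrow> \<bar>0\<bar> + 0"
      by (intro tendsto_intros a0 E1lim)
    then show "(\<lambda>m. \<bar>a m\<bar> + L2_norm M (\<lambda>x. E1 m x - \<eta> x)) \<longlonglongrightarrow> 0"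
      by simp
    show "\<forall>\<^sub>F m in sequentially. norm (L2_norm M (\<lambda>x. E m x - \<eta> x)) \<le>
        \<bar>a m\<bar> + L2_norm M (\<lambda>x. E1 m x - \<eta> x)"
    proof (intro always_eventually allI)
      fix m
      have "L2_norm M (\<lambda>x. E m x - E1 m x) = L2_norm M (\<lambda>x. (- a m) * K m x)"
        by (simp add: E_def)
      also have "\<dots> = \<bar>a m\<bar>"
        unfolding L2_norm_scale Kn by simp
      finally show "norm (L2_norm M (\<lambda>x. E m x - \<eta> x)) \<le>
          \<bar>a m\<bar> + L2_norm M (\<lambda>x. E1 m x - \<eta> x)"
        using L2_norm_triangle3[OF bounded_score_L2[OF E, of m] bL2(2)[of m] L2(2)] by simp
    qed
  qed
  show thesis
    by (rule that[OF K E Kn EK Klim Elim])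
qed

lemma test_power_bounds:
  assumes h: "bounded_score M h" and \<psi>: "is_test (prod_power n M) (\<psi> n)"
  shows "0 \<le> test_power \<psi> (exp_tilt M h) n" "test_power \<psi> (exp_tilt M h) n \<le> 1"
proof -
  interpret T: prob_space "prod_power n (exp_tilt M h n)"
    by (intro prob_space_PiM prob_space_exp_tilt h)
  have sets: "sets (prod_power n (exp_tilt M h n)) = sets (prod_power n M)"
    by (intro sets_PiM_cong) (auto simp: exp_tilt_def)
  have m: "\<psi> n \<in> borel_measurable (prod_power n (exp_tilt M h n))"
    using \<psi> unfolding measurable_cong_sets[OF sets refl] by (simp add: is_test_def)
  have b: "0 \<le> \<psi> n \<omega> \<and> \<psi> n \<omega> \<le> 1" if "\<omega> \<in> space (prod_power n (exp_tilt M h n))" for \<omega>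
    using \<psi> that sets_eq_imp_space_eq[OF sets] by (simp add: is_test_def)
  show "0 \<le> test_power \<psi> (exp_tilt M h) n"
    unfolding test_power_def using b by (intro integral_nonneg_AE AE_I2) auto
  have "integrable (prod_power n (exp_tilt M h n)) (\<psi> n)"
    using b by (intro T.integrable_const_bound[where B = 1] AE_I2 m) auto
  then have "test_power \<psi> (exp_tilt M h) n \<le> (\<integral>\<omega>. 1 \<partial>prod_power n (exp_tilt M h n))"
    unfolding test_power_def using b by (intro integral_mono) auto
  then show "test_power \<psi> (exp_tilt M h) n \<le> 1"
    by (simp add: T.prob_space)
qed

text \<open>After replacement of the normalising constants by their limits, the three likelihood
  ratios share the positive factor coming from \<open>\<eta>\<close>, and their combination is that
  factor times \<open>f\<close> of the normalised sum of \<open>\<kappa>\<close>. The two-sided test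
  is 1 only where \<open>f\<close> is nonnegative and 0 only where it is nonpositive, so it wins
  pointwise for every \<open>n\<close>.\<close>

lemma exp_tilt_three_point_bound:
  fixes s d u :: real and \<psi> :: "nat \<Rightarrow> (nat \<Rightarrow> 'a) \<Rightarrow> real"
  assumes \<kappa>: "bounded_score M \<kappa>" "L2_norm M \<kappa> = 1"
    and \<eta>: "bounded_score M \<eta>" "expectation (\<lambda>x. \<eta> x * \<kappa> x) = 0"
    and u: "0 < u" and sd: "0 < s * d"
    and \<psi>: "\<And>n. 1 \<le> n \<Longrightarrow> is_test (prod_power n M) (\<psi> n)"
  defines "\<mu> \<equiv> exp ((d\<^sup>2 - s\<^sup>2) / 2) * sinh (s * u) / sinh (d * u)"
  defines "c \<equiv> exp (- s\<^sup>2 / 2) * cosh (s * u) + \<mu> * exp (- d\<^sup>2 / 2) * cosh (d * u)"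
  defines "T \<equiv> \<lambda>\<psi> \<sigma> n. test_power \<psi> (exp_tilt M (\<lambda>x. \<eta> x + \<sigma> * \<kappa> x)) n"
  shows "\<exists>e. e \<longlonglongrightarrow> 0 \<and> (\<forall>n\<ge>1. T \<psi> s n - c * T \<psi> 0 n + \<mu> * T \<psi> (- d) n \<le>
      gauss_power u s - c * gauss_power u 0 + \<mu> * gauss_power u (- d) + e n)"
proof -
  note [measurable] = bounded_score_measurable[OF \<kappa>(1)] bounded_score_measurable[OF \<eta>(1)]
  note \<kappa>L2 = bounded_score_L2[OF \<kappa>(1)] and \<eta>L2 = bounded_score_L2[OF \<eta>(1)]
  have mu: "0 < \<mu>" and c: "0 < c"
    unfolding \<mu>_def c_def using three_point_weight(1,2)[OF u sd] by simp_all
  define f where "f x = exp (s * x - s\<^sup>2 / 2) - c + \<mu> * exp (- d * x - d\<^sup>2 / 2)" for x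
  have f: "\<bar>x\<bar> \<le> u \<Longrightarrow> f x \<le> 0" "u < \<bar>x\<bar> \<Longrightarrow> 0 \<le> f x" for x
    unfolding f_def \<mu>_def c_def using three_point_weight(3,4)[OF u sd] by simp_all
  define \<phi> :: "nat \<Rightarrow> (nat \<Rightarrow> 'a) \<Rightarrow> real"
    where "\<phi> n \<omega> = (if u < \<bar>normalized_sum n \<kappa> \<omega>\<bar> then 1 else 0)" for n \<omega>
  have \<phi>: "is_test (prod_power n M) (\<phi> n)" for n
    unfolding is_test_def \<phi>_def by auto
  define h where "h \<sigma> x = \<eta> x + \<sigma> * \<kappa> x" for \<sigma> x
  have h: "bounded_score M (h \<sigma>)" for \<sigma>
    unfolding h_def by (intro bounded_score_add bounded_score_scale \<eta> \<kappa>)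
  have h\<kappa>: "expectation (\<lambda>x. h \<sigma> x * \<kappa> x) = \<sigma>" for \<sigma>
  proof -
    have "expectation (\<lambda>x. h \<sigma> x * \<kappa> x) = expectation (\<lambda>x. \<eta> x * \<kappa> x + \<sigma> * (\<kappa> x)\<^sup>2)"
      by (simp add: h_def power2_eq_square algebra_simps)
    also have "\<dots> = 0 + \<sigma> * (L2_norm M \<kappa>)\<^sup>2"
      unfolding L2_norm_sq \<eta>(2)[symmetric]
      using L2_integrable_mult[OF \<eta>L2 \<kappa>L2] L2_integrable_sq[OF \<kappa>L2] by simp
    finally show ?thesis
      using \<kappa>(2) by simp
  qed
  have hn: "(L2_norm M (h \<sigma>))\<^sup>2 = (L2_norm M \<eta>)\<^sup>2 + \<sigma>\<^sup>2" for \<sigma>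
  proof -
    have "(L2_norm M (h \<sigma>))\<^sup>2 =
        expectation (\<lambda>x. (\<eta> x)\<^sup>2 + 2 * \<sigma> * (\<eta> x * \<kappa> x) + \<sigma>\<^sup>2 * (\<kappa> x)\<^sup>2)"
      unfolding L2_norm_sq h_def
      by (intro Bochner_Integration.integral_cong refl) (simp add: power2_eq_square algebra_simps)
    also have "\<dots> = (L2_norm M \<eta>)\<^sup>2 + 2 * \<sigma> * expectation (\<lambda>x. \<eta> x * \<kappa> x) + \<sigma>\<^sup>2 * (L2_norm M \<kappa>)\<^sup>2"
      unfolding L2_norm_sq
      using L2_integrable_mult[OF \<eta>L2 \<kappa>L2] L2_integrable_sq[OF \<kappa>L2] L2_integrable_sq[OF \<eta>L2]
      by simp
    finally show ?thesis
      using \<kappa>(2) \<eta>(2) by simp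
  qed
  \<comment> \<open>By orthogonality the n-th power of the tilt mass tends to
    \<open>a * exp (\<sigma>\<^sup>2 / 2)\<close>, with \<open>a\<close> common to the three points.
    The factor \<open>\<rho> \<sigma> n\<close> exchanges the exact constant for this limit and
    tends to 1.\<close>
  define a where "a = exp ((L2_norm M \<eta>)\<^sup>2 / 2)"
  define \<rho> where "\<rho> \<sigma> n = tilt_mass M (h \<sigma>) n ^ n / (a * exp (\<sigma>\<^sup>2 / 2))" for \<sigma> n
  have T: "T \<tau> \<sigma> n = test_power \<tau> (exp_tilt M (h \<sigma>)) n" for \<tau> \<sigma> n
    by (simp add: T_def h_def[abs_def])
  have \<rho>1: "(\<lambda>n. \<rho> \<sigma> n) \<longlonglongrightarrow> 1" for \<sigma>
  proof -
    have "(\<lambda>n. tilt_mass M (h \<sigma>) n ^ n / (a * exp (\<sigma>\<^sup>2 / 2))) \<longlonglongrightarrow>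
        exp ((L2_norm M (h \<sigma>))\<^sup>2 / 2) / (a * exp (\<sigma>\<^sup>2 / 2))"
      by (intro tendsto_divide tendsto_const tilt_mass_limit h) (simp add: a_def)
    also have "exp ((L2_norm M (h \<sigma>))\<^sup>2 / 2) = a * exp (\<sigma>\<^sup>2 / 2)"
      by (simp add: hn a_def exp_add add_divide_distrib)
    finally show ?thesis
      by (simp add: \<rho>_def a_def)
  qed
  have \<phi>lim: "(\<lambda>n. T \<phi> \<sigma> n) \<longlonglongrightarrow> gauss_power u \<sigma>" for \<sigma>
    using exp_tilt_two_sided_limit[OF h[of \<sigma>] _ \<kappa>(2), of u] u \<kappa>(1) \<kappa>L2
    unfolding T test_power_def \<phi>_def h\<kappa> by (simp add: L2_zero_def bounded_score_def)
  \<comment> \<open>The combination of powers with the limiting constants; in contrast to the true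
    powers it is exactly the integral of one weight against the test.\<close>
  define W where "W \<tau> n = \<rho> s n * T \<tau> s n - c * (\<rho> 0 n * T \<tau> 0 n) + \<mu> * (\<rho> (- d) n * T \<tau> (- d) n)"
    for \<tau> n
  let ?w = "\<lambda>n \<omega>. exp (normalized_sum n \<eta> \<omega>) / a"
  have term_int: "\<rho> \<sigma> n * T \<tau> \<sigma> n =
      (\<integral>\<omega>. ?w n \<omega> * exp (\<sigma> * normalized_sum n \<kappa> \<omega> - \<sigma>\<^sup>2 / 2) * \<tau> n \<omega> \<partial>prod_power n M)" (is ?eq)
    and term_integrable: "integrable (prod_power n M)
      (\<lambda>\<omega>. ?w n \<omega> * exp (\<sigma> * normalized_sum n \<kappa> \<omega> - \<sigma>\<^sup>2 / 2) * \<tau> n \<omega>)" (is ?int)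
    if \<tau>: "is_test (prod_power n M) (\<tau> n)" for \<tau> n \<sigma>
  proof -
    have [measurable]: "\<tau> n \<in> borel_measurable (prod_power n M)"
      using \<tau> by (simp add: is_test_def)
    have m: "0 < tilt_mass M (h \<sigma>) n"
      using tilt_mass_ge_1[OF h[of \<sigma>], of n] by simp
    have exp_eq: "exp (normalized_sum n (h \<sigma>) \<omega>) / (a * exp (\<sigma>\<^sup>2 / 2)) =
        ?w n \<omega> * exp (\<sigma> * normalized_sum n \<kappa> \<omega> - \<sigma>\<^sup>2 / 2)" for \<omega>
      unfolding h_def normalized_sum_add normalized_sum_scale by (simp add: exp_add exp_diff)
    have "\<rho> \<sigma> n * T \<tau> \<sigma> n = \<rho> \<sigma> n *
        (\<integral>\<omega>. exp (normalized_sum n (h \<sigma>) \<omega>) / tilt_mass M (h \<sigma>) n ^ n * \<tau> n \<omega> \<partial>prod_power n M)"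
      unfolding T test_power_def by (subst integral_prod_power_exp_tilt[OF h]) auto
    also have "\<dots> = (\<integral>\<omega>. \<rho> \<sigma> n *
        (exp (normalized_sum n (h \<sigma>) \<omega>) / tilt_mass M (h \<sigma>) n ^ n * \<tau> n \<omega>) \<partial>prod_power n M)"
      by simp
    also have "\<dots> = (\<integral>\<omega>. exp (normalized_sum n (h \<sigma>) \<omega>) / (a * exp (\<sigma>\<^sup>2 / 2)) * \<tau> n \<omega>
        \<partial>prod_power n M)"
      using m by (intro Bochner_Integration.integral_cong refl) (simp add: \<rho>_def)
    finally show ?eq
      unfolding exp_eq .
    have "integrable (prod_power n M)
        (\<lambda>\<omega>. exp (normalized_sum n (h \<sigma>) \<omega>) / (a * exp (\<sigma>\<^sup>2 / 2)) * \<tau> n \<omega>)"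
    proof (rule Bochner_Integration.integrable_bound)
      show "integrable (prod_power n M) (\<lambda>\<omega>. exp (normalized_sum n (h \<sigma>) \<omega>) / (a * exp (\<sigma>\<^sup>2 / 2)))"
        by (intro Bochner_Integration.integrable_divide integrable_exp_normalized_sum h)
      show "AE \<omega> in prod_power n M. norm (exp (normalized_sum n (h \<sigma>) \<omega>) / (a * exp (\<sigma>\<^sup>2 / 2)) * \<tau> n \<omega>)
          \<le> norm (exp (normalized_sum n (h \<sigma>) \<omega>) / (a * exp (\<sigma>\<^sup>2 / 2)))"
        using \<tau> unfolding norm_mult
        by (intro AE_I2 mult_left_le) (auto simp: is_test_def)
      have [measurable]: "h \<sigma> \<in> borel_measurable M"
        by (rule bounded_score_measurable[OF h])
      show "(\<lambda>\<omega>. exp (normalized_sum n (h \<sigma>) \<omega>) / (a * exp (\<sigma>\<^sup>2 / 2)) * \<tau> n \<omega>)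
          \<in> borel_measurable (prod_power n M)"
        by measurable
    qed
    then show ?int
      unfolding exp_eq .
  qed
  have W_int: "W \<tau> n = (\<integral>\<omega>. f (normalized_sum n \<kappa> \<omega>) * (?w n \<omega> * \<tau> n \<omega>) \<partial>prod_power n M)"
    and W_integrable: "integrable (prod_power n M) (\<lambda>\<omega>. f (normalized_sum n \<kappa> \<omega>) * (?w n \<omega> * \<tau> n \<omega>))"
    if \<tau>: "is_test (prod_power n M) (\<tau> n)" for \<tau> n
  proof -
    let ?t = "\<lambda>\<sigma> \<omega>. ?w n \<omega> * exp (\<sigma> * normalized_sum n \<kappa> \<omega> - \<sigma>\<^sup>2 / 2) * \<tau> n \<omega>"
    have eq: "?t s \<omega> - c * ?t 0 \<omega> + \<mu> * ?t (- d) \<omega> = f (normalized_sum n \<kappa> \<omega>) * (?w n \<omega> * \<tau> n \<omega>)" for \<omega>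
      by (simp add: f_def algebra_simps)
    have int: "integrable (prod_power n M) (?t \<sigma>)" for \<sigma>
      by (rule term_integrable[of n \<tau> \<sigma>, OF \<tau>])
    show "W \<tau> n = (\<integral>\<omega>. f (normalized_sum n \<kappa> \<omega>) * (?w n \<omega> * \<tau> n \<omega>) \<partial>prod_power n M)"
      unfolding W_def term_int[of n \<tau>, OF \<tau>] eq[symmetric]
      by (subst Bochner_Integration.integral_add Bochner_Integration.integral_diff integral_mult_right_zero;
          (intro Bochner_Integration.integrable_diff integrable_mult_right int)?)+ (rule refl)
    show "integrable (prod_power n M) (\<lambda>\<omega>. f (normalized_sum n \<kappa> \<omega>) * (?w n \<omega> * \<tau> n \<omega>))"
      unfolding eq[symmetric]
      by (intro Bochner_Integration.integrable_add Bochner_Integration.integrable_diff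
          integrable_mult_right int)
  qed
  have W_le: "W \<psi> n \<le> W \<phi> n" if n: "1 \<le> n" for n
    unfolding W_int[of n \<psi>, OF \<psi>[OF n]] W_int[of n \<phi>, OF \<phi>]
  proof (intro integral_mono W_integrable[of n \<psi>, OF \<psi>[OF n]] W_integrable[of n \<phi>, OF \<phi>])
    fix \<omega> assume \<omega>: "\<omega> \<in> space (prod_power n M)"
    have \<psi>01: "0 \<le> \<psi> n \<omega>" "\<psi> n \<omega> \<le> 1"
      using \<psi>[OF n] \<omega> by (auto simp: is_test_def)
    have w: "0 \<le> ?w n \<omega>"
      by (simp add: a_def)
    show "f (normalized_sum n \<kappa> \<omega>) * (?w n \<omega> * \<psi> n \<omega>) \<le> f (normalized_sum n \<kappa> \<omega>) * (?w n \<omega> * \<phi> n \<omega>)"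
    proof (cases "u < \<bar>normalized_sum n \<kappa> \<omega>\<bar>")
      case True
      then have "0 \<le> f (normalized_sum n \<kappa> \<omega>)"
        by (rule f(2))
      then show ?thesis
        using True w \<psi>01 by (intro mult_left_mono) (auto simp: \<phi>_def)
    next
      case False
      then have "f (normalized_sum n \<kappa> \<omega>) \<le> 0"
        by (intro f(1)) simp
      then show ?thesis
        using False mult_nonpos_nonneg[OF _ mult_nonneg_nonneg[OF w \<psi>01(1)]] by (simp add: \<phi>_def)
    qed
  qed
  \<comment> \<open>Powers lie between 0 and 1, so inserting the factors \<open>\<rho>\<close> costs
    at most the first three terms; the last one is the distance of the two-sided test from its
    Gaussian limit.\<close>
  define e where "e n = \<bar>1 - \<rho> s n\<bar> + c * \<bar>1 - \<rho> 0 n\<bar> + \<mu> * \<bar>1 - \<rho> (- d) n\<bar> +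
    (W \<phi> n - (gauss_power u s - c * gauss_power u 0 + \<mu> * gauss_power u (- d)))" for n
  show ?thesis
  proof (intro exI[of _ e] conjI allI impI)
    have "e \<longlonglongrightarrow> \<bar>1 - 1\<bar> + c * \<bar>1 - 1\<bar> + \<mu> * \<bar>1 - 1\<bar> +
      ((1 * gauss_power u s - c * (1 * gauss_power u 0) + \<mu> * (1 * gauss_power u (- d))) -
       (gauss_power u s - c * gauss_power u 0 + \<mu> * gauss_power u (- d)))"
      unfolding e_def W_def by (intro tendsto_intros \<rho>1 \<phi>lim)
    then show "e \<longlonglongrightarrow> 0"
      by simp
    fix n :: nat assume n: "1 \<le> n"
    have near: "\<bar>T \<psi> \<sigma> n - \<rho> \<sigma> n * T \<psi> \<sigma> n\<bar> \<le> \<bar>1 - \<rho> \<sigma> n\<bar>" for \<sigma>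
    proof -
      have "\<bar>T \<psi> \<sigma> n - \<rho> \<sigma> n * T \<psi> \<sigma> n\<bar> = \<bar>1 - \<rho> \<sigma> n\<bar> * \<bar>T \<psi> \<sigma> n\<bar>"
        unfolding abs_mult[symmetric] by (simp add: algebra_simps)
      also have "\<dots> \<le> \<bar>1 - \<rho> \<sigma> n\<bar>"
        using test_power_bounds[of "h \<sigma>" n \<psi>, OF h \<psi>[OF n]] unfolding T
        by (intro mult_left_le) auto
      finally show ?thesis .
    qed
    have "T \<psi> s n - \<rho> s n * T \<psi> s n \<le> \<bar>1 - \<rho> s n\<bar>"
      using near[of s] by linarith
    moreover have "c * (\<rho> 0 n * T \<psi> 0 n - T \<psi> 0 n) \<le> c * \<bar>1 - \<rho> 0 n\<bar>"
      using near[of 0] c by (intro mult_left_mono) linarith+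
    moreover have "\<mu> * (T \<psi> (- d) n - \<rho> (- d) n * T \<psi> (- d) n) \<le> \<mu> * \<bar>1 - \<rho> (- d) n\<bar>"
      using near[of "- d"] mu by (intro mult_left_mono) linarith+
    ultimately show "T \<psi> s n - c * T \<psi> 0 n + \<mu> * T \<psi> (- d) n \<le>
        gauss_power u s - c * gauss_power u 0 + \<mu> * gauss_power u (- d) + e n"
      using W_le[OF n] unfolding e_def W_def[of \<psi>] right_diff_distrib by linarith
  qed
qed

end

section \<open>Asymptotic power along score sequences\<close>

lemma limsup_le_ereal_iff:
  fixes X :: "nat \<Rightarrow> real"
  shows "limsup (\<lambda>n. ereal (X n)) \<le> ereal a \<longleftrightarrow> (\<forall>\<epsilon>>0. \<forall>\<^sub>F n in sequentially. X n < a + \<epsilon>)"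
proof
  assume *: "limsup (\<lambda>n. ereal (X n)) \<le> ereal a"
  show "\<forall>\<epsilon>>0. \<forall>\<^sub>F n in sequentially. X n < a + \<epsilon>"
  proof (intro allI impI)
    fix \<epsilon> :: real assume "0 < \<epsilon>"
    then have "ereal a < ereal (a + \<epsilon>)"
      by simp
    then have "\<forall>\<^sub>F n in sequentially. ereal (X n) < ereal (a + \<epsilon>)"
      using * unfolding Limsup_le_iff by blast
    then show "\<forall>\<^sub>F n in sequentially. X n < a + \<epsilon>"
      by simp
  qed
next
  assume *: "\<forall>\<epsilon>>0. \<forall>\<^sub>F n in sequentially. X n < a + \<epsilon>"
  show "limsup (\<lambda>n. ereal (X n)) \<le> ereal a"
  proof (rule ereal_le_epsilon2)
    fix \<epsilon> :: real assume "0 < \<epsilon>"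
    then have "\<forall>\<^sub>F n in sequentially. ereal (X n) \<le> ereal a + ereal \<epsilon>"
      using * by (auto elim!: eventually_mono)
    then show "limsup (\<lambda>n. ereal (X n)) \<le> ereal a + ereal \<epsilon>"
      by (rule Limsup_bounded)
  qed
qed

lemma le_liminf_ereal_iff:
  fixes X :: "nat \<Rightarrow> real"
  shows "ereal a \<le> liminf (\<lambda>n. ereal (X n)) \<longleftrightarrow> (\<forall>\<epsilon>>0. \<forall>\<^sub>F n in sequentially. a - \<epsilon> < X n)"
proof -
  have "limsup (\<lambda>n. ereal (- X n)) = - liminf (\<lambda>n. ereal (X n))"
    using ereal_Limsup_uminus[of sequentially "\<lambda>n. ereal (X n)"] by simp
  then have "ereal a \<le> liminf (\<lambda>n. ereal (X n)) \<longleftrightarrow> limsup (\<lambda>n. ereal (- X n)) \<le> ereal (- a)"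
    using ereal_minus_le_minus[of "liminf (\<lambda>n. ereal (X n))" "ereal a"] by simp
  then show ?thesis
    unfolding limsup_le_ereal_iff by (simp add: algebra_simps)
qed

context prob_space
begin

text \<open>Three errors of size \<open>\<epsilon> / 3\<close>: replacing \<open>Q\<close> by a
  tilt, convergence under that tilt, and continuity of \<open>gauss_power\<close> in the inner
  product. The approximating score is fixed before \<open>n\<close> grows.\<close>

lemma score_sequence_two_sided_limit:
  assumes Q: "score_sequence M Q h" and h: "h \<in> L2_zero M"
    and \<kappa>: "\<kappa> \<in> L2_zero M" "L2_norm M \<kappa> = 1" and u: "0 \<le> u"
  shows "(\<lambda>n. test_power (\<lambda>n \<omega>. if u < \<bar>normalized_sum n \<kappa> \<omega>\<bar> then 1 else 0) Q n) \<longlonglongrightarrow>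
    gauss_power u (expectation (\<lambda>x. h x * \<kappa> x))"
proof -
  let ?\<phi> = "\<lambda>n \<omega>. if u < \<bar>normalized_sum n \<kappa> \<omega>\<bar> then 1 else 0 :: real"
  let ?\<theta> = "\<lambda>h. expectation (\<lambda>x. h x * \<kappa> x)"
  have hL2: "h \<in> L2 M" and \<kappa>L2: "\<kappa> \<in> L2 M"
    using h \<kappa> by (auto simp: L2_zero_def)
  note [measurable] = L2_measurable[OF \<kappa>L2]
  have \<phi>: "is_test (prod_power n M) (?\<phi> n)" for n
    unfolding is_test_def by auto
  obtain H where H: "\<And>m::nat. bounded_score M (H m)"
    and Hlim: "(\<lambda>m. L2_norm M (\<lambda>x. H m x - h x)) \<longlonglongrightarrow> 0"
    using bounded_score_approx[OF h] by blast
  have v: "(\<lambda>m. variation_bound (L2_norm M (\<lambda>x. h x - H m x))) \<longlonglongrightarrow> 0"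
    using variation_bound_tendsto[OF Hlim] by (simp add: L2_norm_minus_commute)
  have "(\<lambda>m. ?\<theta> (H m)) \<longlonglongrightarrow> ?\<theta> h"
    using L2_inner_tendsto[OF bounded_score_L2[OF H] hL2 \<kappa>L2 \<kappa>L2 Hlim]
    by (simp add: L2_norm_def)
  then have g: "(\<lambda>m. gauss_power u (?\<theta> (H m))) \<longlonglongrightarrow> gauss_power u (?\<theta> h)"
    by (rule isCont_tendsto_compose[OF DERIV_isCont[OF gauss_power_deriv]])
  show ?thesis
    unfolding LIMSEQ_iff
  proof (intro allI impI)
    fix \<epsilon> :: real assume \<epsilon>: "0 < \<epsilon>"
    have "\<forall>\<^sub>F m in sequentially. variation_bound (L2_norm M (\<lambda>x. h x - H m x)) < \<epsilon> / 3 \<and>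
        \<bar>gauss_power u (?\<theta> (H m)) - gauss_power u (?\<theta> h)\<bar> < \<epsilon> / 3"
      using \<epsilon> order_tendstoD(2)[OF v, of "\<epsilon> / 3"] tendstoD[OF g, of "\<epsilon> / 3"]
      by (auto simp: dist_real_def eventually_conj_iff)
    then obtain m where m: "variation_bound (L2_norm M (\<lambda>x. h x - H m x)) < \<epsilon> / 3"
      "\<bar>gauss_power u (?\<theta> (H m)) - gauss_power u (?\<theta> h)\<bar> < \<epsilon> / 3"
      unfolding eventually_sequentially by blast
    obtain e where e: "e \<longlonglongrightarrow> variation_bound (L2_norm M (\<lambda>x. h x - H m x))"
      and eb': "\<forall>\<psi> n. 1 \<le> n \<longrightarrow> is_test (prod_power n M) (\<psi> n) \<longrightarrow>
        \<bar>test_power \<psi> Q n - test_power \<psi> (exp_tilt M (H m)) n\<bar> \<le> e n"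
      using score_sequence_exp_tilt[OF Q H[of m]] by blast
    have eb: "\<bar>test_power ?\<phi> Q n - test_power ?\<phi> (exp_tilt M (H m)) n\<bar> \<le> e n" if "1 \<le> n" for n
      using eb'[rule_format, of n ?\<phi>, OF that \<phi>] .
    have "(\<lambda>n. test_power ?\<phi> (exp_tilt M (H m)) n) \<longlonglongrightarrow> gauss_power u (?\<theta> (H m))"
      unfolding test_power_def by (rule exp_tilt_two_sided_limit[OF H \<kappa> u])
    then have "\<forall>\<^sub>F n in sequentially.
        \<bar>test_power ?\<phi> (exp_tilt M (H m)) n - gauss_power u (?\<theta> (H m))\<bar> < \<epsilon> / 3"
      using \<epsilon> by (auto dest!: tendstoD[where e = "\<epsilon> / 3"] simp: dist_real_def)
    with order_tendstoD(2)[OF e m(1)] eventually_ge_at_top[of "1::nat"]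
    have "\<forall>\<^sub>F n in sequentially. \<bar>test_power ?\<phi> Q n - gauss_power u (?\<theta> h)\<bar> < \<epsilon>"
    proof eventually_elim
      case (elim n)
      then show ?case
        using eb[OF elim(2)] m(2) unfolding abs_less_iff abs_le_iff by linarith
    qed
    then show "\<exists>no. \<forall>n\<ge>no. norm (test_power ?\<phi> Q n - gauss_power u (?\<theta> h)) < \<epsilon>"
      by (simp add: eventually_sequentially)
  qed
qed

text \<open>Unbiasedness enters only through \<open>null\<close> and \<open>alt\<close>, at points
  of one line in the direction of \<open>\<kappa>\<close>; the level is written
  \<open>gauss_power u 0\<close>. Tests under score sequences are compared with tests under tilts at
  the three points \<open>s\<close>, \<open>0\<close> and \<open>- d\<close>.\<close>

lemma unbiased_power_bound:
  assumes \<kappa>: "\<kappa> \<in> L2_zero M" "L2_norm M \<kappa> = 1"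
    and \<eta>: "\<eta> \<in> L2_zero M" "expectation (\<lambda>x. \<eta> x * \<kappa> x) = 0"
    and u: "0 < u" and s: "s \<noteq> 0"
    and \<psi>: "\<And>n. 1 \<le> n \<Longrightarrow> is_test (prod_power n M) (\<psi> n)"
    and Q: "score_sequence M Q (\<lambda>x. \<eta> x + s * \<kappa> x)"
    and null: "score_sequence M R0 (\<lambda>x. \<eta> x + 0 * \<kappa> x)"
      "limsup (\<lambda>n. ereal (test_power \<psi> R0 n)) \<le> ereal (gauss_power u 0)"
    and alt: "\<And>\<sigma>. \<sigma> \<noteq> 0 \<Longrightarrow> \<exists>R. score_sequence M R (\<lambda>x. \<eta> x + \<sigma> * \<kappa> x) \<and>
      ereal (gauss_power u 0) \<le> liminf (\<lambda>n. ereal (test_power \<psi> R n))"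
  shows "limsup (\<lambda>n. ereal (test_power \<psi> Q n)) \<le> ereal (gauss_power u s)"
proof -
  have L2: "\<kappa> \<in> L2 M" "\<eta> \<in> L2 M"
    using \<kappa> \<eta> by (auto simp: L2_zero_def)
  obtain K E where K: "\<And>m::nat. bounded_score M (K m)" and E: "\<And>m::nat. bounded_score M (E m)"
    and Kn: "\<And>m. L2_norm M (K m) = 1" and EK: "\<And>m. expectation (\<lambda>x. E m x * K m x) = 0"
    and Klim: "(\<lambda>m. L2_norm M (\<lambda>x. K m x - \<kappa> x)) \<longlonglongrightarrow> 0"
    and Elim: "(\<lambda>m. L2_norm M (\<lambda>x. E m x - \<eta> x)) \<longlonglongrightarrow> 0"
    using orthonormal_bounded_score_approx[OF \<kappa> \<eta>] by blast
  define V where "V \<sigma> m = variation_bound (L2_norm M (\<lambda>x. (\<eta> x + \<sigma> * \<kappa> x) - (E m x + \<sigma> * K m x)))"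
    for \<sigma> m
  have V: "(\<lambda>m. V \<sigma> m) \<longlonglongrightarrow> 0" for \<sigma>
    unfolding V_def
  proof (rule variation_bound_tendsto, rule Lim_null_comparison)
    have "(\<lambda>m. L2_norm M (\<lambda>x. E m x - \<eta> x) + \<bar>\<sigma>\<bar> * L2_norm M (\<lambda>x. K m x - \<kappa> x)) \<longlonglongrightarrow> 0 + \<bar>\<sigma>\<bar> * 0"
      by (intro tendsto_intros Elim Klim)
    then show "(\<lambda>m. L2_norm M (\<lambda>x. E m x - \<eta> x) + \<bar>\<sigma>\<bar> * L2_norm M (\<lambda>x. K m x - \<kappa> x)) \<longlonglongrightarrow> 0"
      by simp
    show "\<forall>\<^sub>F m in sequentially.
        norm (L2_norm M (\<lambda>x. (\<eta> x + \<sigma> * \<kappa> x) - (E m x + \<sigma> * K m x))) \<le>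
        L2_norm M (\<lambda>x. E m x - \<eta> x) + \<bar>\<sigma>\<bar> * L2_norm M (\<lambda>x. K m x - \<kappa> x)"
    proof (intro always_eventually allI)
      fix m
      have "L2_norm M (\<lambda>x. (\<eta> x + \<sigma> * \<kappa> x) - (E m x + \<sigma> * K m x)) =
          L2_norm M (\<lambda>x. (E m x + \<sigma> * K m x) - (\<eta> x + \<sigma> * \<kappa> x))"
        by (rule L2_norm_minus_commute)
      also have "\<dots> = L2_norm M (\<lambda>x. (E m x - \<eta> x) + \<sigma> * (K m x - \<kappa> x))"
        by (simp add: algebra_simps)
      also have "\<dots> \<le> L2_norm M (\<lambda>x. E m x - \<eta> x) + L2_norm M (\<lambda>x. \<sigma> * (K m x - \<kappa> x))"
        by (intro L2_norm_triangle L2_scale L2_diff L2 bounded_score_L2 K E)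
      finally show "norm (L2_norm M (\<lambda>x. (\<eta> x + \<sigma> * \<kappa> x) - (E m x + \<sigma> * K m x))) \<le>
          L2_norm M (\<lambda>x. E m x - \<eta> x) + \<bar>\<sigma>\<bar> * L2_norm M (\<lambda>x. K m x - \<kappa> x)"
        unfolding L2_norm_scale by simp
    qed
  qed
  have score: "bounded_score M (\<lambda>x. E m x + \<sigma> * K m x)" for m \<sigma>
    by (intro bounded_score_add bounded_score_scale K E)
  define \<mu> where "\<mu> d = exp ((d\<^sup>2 - s\<^sup>2) / 2) * sinh (s * u) / sinh (d * u)" for d
  \<comment> \<open>What the three-point bound leaves once the level has been inserted at
    \<open>0\<close> and at \<open>- d\<close>; the terms with \<open>c\<close> cancel.\<close>
  define G where "G d = gauss_power u s + \<mu> d * (gauss_power u (- d) - gauss_power u 0)" for d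
  have three: "\<forall>\<^sub>F n in sequentially. test_power \<psi> Q n < G d + \<epsilon>"
    if sd: "0 < s * d" and \<epsilon>: "0 < \<epsilon>" for d \<epsilon>
  proof -
    have d: "- d \<noteq> 0"
      using sd by auto
    define c where "c = exp (- s\<^sup>2 / 2) * cosh (s * u) + \<mu> d * exp (- d\<^sup>2 / 2) * cosh (d * u)"
    have mu: "0 < \<mu> d" and c: "0 < c"
      unfolding \<mu>_def c_def using three_point_weight(1,2)[OF u sd] by simp_all
    obtain R where R: "score_sequence M R (\<lambda>x. \<eta> x + (- d) * \<kappa> x)"
      "ereal (gauss_power u 0) \<le> liminf (\<lambda>n. ereal (test_power \<psi> R n))"
      using alt[OF d] by blast
    \<comment> \<open>The index \<open>m\<close> is chosen after \<open>d\<close>: the weights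
      \<open>c\<close> and \<open>\<mu> d\<close> are unbounded as \<open>d\<close> tends to 0, so
      the approximation has to be finer for smaller \<open>d\<close>.\<close>
    have "(\<lambda>m. V s m + c * V 0 m + \<mu> d * V (- d) m) \<longlonglongrightarrow> 0 + c * 0 + \<mu> d * 0"
      by (intro tendsto_intros V)
    then have "\<forall>\<^sub>F m in sequentially. V s m + c * V 0 m + \<mu> d * V (- d) m < \<epsilon> / 2"
      using \<epsilon> by (intro order_tendstoD(2)[where a = "\<epsilon> / 2"]) auto
    then obtain m where m: "V s m + c * V 0 m + \<mu> d * V (- d) m < \<epsilon> / 2"
      unfolding eventually_sequentially by blast
    let ?T = "\<lambda>\<sigma> n. test_power \<psi> (exp_tilt M (\<lambda>x. E m x + \<sigma> * K m x)) n"
    obtain e1 where e1: "e1 \<longlonglongrightarrow> V s m"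
      and b1': "\<forall>\<psi> n. 1 \<le> n \<longrightarrow> is_test (prod_power n M) (\<psi> n) \<longrightarrow>
        \<bar>test_power \<psi> Q n - test_power \<psi> (exp_tilt M (\<lambda>x. E m x + s * K m x)) n\<bar> \<le> e1 n"
      using score_sequence_exp_tilt[OF Q score[of m s]] unfolding V_def by blast
    have b1: "\<bar>test_power \<psi> Q n - ?T s n\<bar> \<le> e1 n" if "1 \<le> n" for n
      using b1'[rule_format, of n \<psi>, OF that \<psi>[OF that]] .
    obtain e2 where e2: "e2 \<longlonglongrightarrow> V 0 m"
      and b2': "\<forall>\<psi> n. 1 \<le> n \<longrightarrow> is_test (prod_power n M) (\<psi> n) \<longrightarrow>
        \<bar>test_power \<psi> R0 n - test_power \<psi> (exp_tilt M (\<lambda>x. E m x + 0 * K m x)) n\<bar> \<le> e2 n"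
      using score_sequence_exp_tilt[OF null(1) score[of m 0]] unfolding V_def by blast
    have b2: "\<bar>test_power \<psi> R0 n - ?T 0 n\<bar> \<le> e2 n" if "1 \<le> n" for n
      using b2'[rule_format, of n \<psi>, OF that \<psi>[OF that]] .
    obtain e3 where e3: "e3 \<longlonglongrightarrow> V (- d) m"
      and b3': "\<forall>\<psi> n. 1 \<le> n \<longrightarrow> is_test (prod_power n M) (\<psi> n) \<longrightarrow>
        \<bar>test_power \<psi> R n - test_power \<psi> (exp_tilt M (\<lambda>x. E m x + (- d) * K m x)) n\<bar> \<le> e3 n"
      using score_sequence_exp_tilt[OF R(1) score[of m "- d"]] unfolding V_def by blast
    have b3: "\<bar>test_power \<psi> R n - ?T (- d) n\<bar> \<le> e3 n" if "1 \<le> n" for n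
      using b3'[rule_format, of n \<psi>, OF that \<psi>[OF that]] .
    obtain e where e: "e \<longlonglongrightarrow> 0"
      and b': "\<forall>n\<ge>1. ?T s n - c * ?T 0 n + \<mu> d * ?T (- d) n \<le>
        gauss_power u s - c * gauss_power u 0 + \<mu> d * gauss_power u (- d) + e n"
      using exp_tilt_three_point_bound[OF K[of m] Kn[of m] E[of m] EK[of m] u sd \<psi>]
      unfolding c_def \<mu>_def by blast
    note b = b'[rule_format]
    \<comment> \<open>The slack allowed at \<open>0\<close> and at \<open>- d\<close>, such that
      both together, multiplied by their weights, use up half of \<open>\<epsilon>\<close>.\<close>
    define \<delta> where "\<delta> = \<epsilon> / 2 / (c + \<mu> d)"
    have \<delta>: "0 < \<delta>" "c * \<delta> + \<mu> d * \<delta> = \<epsilon> / 2"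
    proof -
      have pos: "0 < c + \<mu> d"
        using c mu by simp
      then show "0 < \<delta>"
        using \<epsilon> by (simp add: \<delta>_def)
      show "c * \<delta> + \<mu> d * \<delta> = \<epsilon> / 2"
        using pos unfolding distrib_right[symmetric] \<delta>_def
        by (metis less_irrefl nonzero_mult_div_cancel_left times_divide_eq_right)
    qed
    have "(\<lambda>n. e1 n + c * e2 n + \<mu> d * e3 n + e n) \<longlonglongrightarrow> V s m + c * V 0 m + \<mu> d * V (- d) m + 0"
      by (intro tendsto_intros e e1 e2 e3)
    then have err: "\<forall>\<^sub>F n in sequentially. e1 n + c * e2 n + \<mu> d * e3 n + e n < \<epsilon> / 2"
      using m by (intro order_tendstoD(2)[where a = "\<epsilon> / 2"]) auto
    have "\<forall>\<^sub>F n in sequentially. test_power \<psi> R0 n < gauss_power u 0 + \<delta>"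
      using null(2) \<delta>(1) unfolding limsup_le_ereal_iff by blast
    moreover have "\<forall>\<^sub>F n in sequentially. gauss_power u 0 - \<delta> < test_power \<psi> R n"
      using R(2) \<delta>(1) unfolding le_liminf_ereal_iff by blast
    ultimately show ?thesis
      using err eventually_ge_at_top[of 1]
    proof eventually_elim
      case (elim n)
      have "c * ?T 0 n \<le> c * (gauss_power u 0 + \<delta> + e2 n)"
        using b2[OF elim(4)] elim(1) c by (intro mult_left_mono) linarith+
      moreover have "\<mu> d * (gauss_power u 0 - \<delta> - e3 n) \<le> \<mu> d * ?T (- d) n"
        using b3[OF elim(4)] elim(2) mu by (intro mult_left_mono) linarith+
      ultimately show ?case
        using b1[OF elim(4)] b[OF elim(4)] elim(3) \<delta>(2)
        unfolding G_def distrib_left right_diff_distrib by linarith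
    qed
  qed
  have G: "(\<lambda>j. G (s / Suc j)) \<longlonglongrightarrow> gauss_power u s"
    using tendsto_add[OF tendsto_const gauss_power_flat_at_0[OF u s], of "gauss_power u s"]
    by (simp add: G_def \<mu>_def)
  show ?thesis
    unfolding limsup_le_ereal_iff
  proof (intro allI impI)
    fix \<epsilon> :: real assume \<epsilon>: "0 < \<epsilon>"
    have "\<forall>\<^sub>F j in sequentially. G (s / Suc j) < gauss_power u s + \<epsilon> / 2"
      using order_tendstoD(2)[OF G, of "gauss_power u s + \<epsilon> / 2"] \<epsilon> by simp
    then obtain j where j: "G (s / Suc j) < gauss_power u s + \<epsilon> / 2"
      unfolding eventually_sequentially by blast
    have "0 < s * s"
      using s not_real_square_gt_zero by blast
    then have "0 < s * (s / Suc j)"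
      by simp
    from three[OF this, of "\<epsilon> / 2"] \<epsilon>
    have "\<forall>\<^sub>F n in sequentially. test_power \<psi> Q n < G (s / Suc j) + \<epsilon> / 2"
      by simp
    then show "\<forall>\<^sub>F n in sequentially. test_power \<psi> Q n < gauss_power u s + \<epsilon>"
      by eventually_elim (use j in linarith)
  qed
qed

text \<open>\<open>L2_diff_curve\<close> asks of a tangent only square integrability, so the zero
  mean has to be derived. With \<open>X n = sqrt n (r n - 1)\<close>, the total mass of the density
  part ties E(X n) to \<open>-(n (1 - p) + |X n|\<^sup>2) / (2 sqrt n)\<close>, which tends to 0,
  while E(X n) also tends to half the mean of \<open>h\<close>.\<close>

lemma score_sequence_mean_zero:
  assumes "score_sequence M Q h"
  shows "h \<in> L2_zero M"
proof -
  obtain r S where hL2: "h \<in> L2 M"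
    and QS: "\<And>n. 1 \<le> n \<Longrightarrow> prob_space (Q n)" "\<And>n. 1 \<le> n \<Longrightarrow> sets (Q n) = sets M"
      "\<And>n. 1 \<le> n \<Longrightarrow> r n \<in> borel_measurable M" "\<And>n. 1 \<le> n \<Longrightarrow> S n \<in> sets M"
      "\<And>n. 1 \<le> n \<Longrightarrow> density (Q n) (indicator (S n)) = density M (\<lambda>x. ennreal ((r n x)\<^sup>2))"
    and p: "(\<lambda>n. real n * (1 - measure (Q n) (S n))) \<longlonglongrightarrow> 0"
    and r: "(\<lambda>n. L2_norm M (\<lambda>x. sqrt n * (r n x - 1) - h x / 2)) \<longlonglongrightarrow> 0"
    using assms unfolding score_sequence_def by blast
  have test0: "is_test (prod_power n M) (\<lambda>_. 0)" for n
    by (simp add: is_test_def)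
  have rL2: "r n \<in> L2 M" and rp: "(L2_norm M (r n))\<^sup>2 = measure (Q n) (S n)" if "1 \<le> n" for n
    using prod_power_total_variation(1,2)[of "Q n" "S n" "r n" "\<lambda>_. 1" n "\<lambda>_. 0"]
      QS[OF that] L2_const[of 1] L2_norm_const[of 1] test0[of n] by auto
  define X where "X n x = sqrt n * (r n x - 1)" for n :: nat and x
  have XL2: "X n \<in> L2 M" if "1 \<le> n" for n
    unfolding X_def by (intro L2_scale L2_diff rL2 that L2_const)
  have hh: "(\<lambda>x. 1 / 2 * h x) \<in> L2 M"
    by (intro L2_scale hL2)
  have X: "(\<lambda>n. L2_norm M (\<lambda>x. X n x - 1 / 2 * h x)) \<longlonglongrightarrow> 0"
    using r by (simp add: X_def)
  have Xn: "(\<lambda>n. L2_norm M (X n)) \<longlonglongrightarrow> L2_norm M (\<lambda>x. 1 / 2 * h x)"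
    by (rule L2_norm_tendsto[OF _ hh X])
      (use eventually_ge_at_top[of 1] in eventually_elim, rule XL2)
  have EX: "(\<lambda>n. expectation (X n)) \<longlonglongrightarrow> expectation (\<lambda>x. 1 / 2 * h x)"
  proof (rule LIM_zero_cancel, rule Lim_null_comparison[OF _ X])
    show "\<forall>\<^sub>F n in sequentially. norm (expectation (X n) - expectation (\<lambda>x. 1 / 2 * h x)) \<le>
        L2_norm M (\<lambda>x. X n x - 1 / 2 * h x)"
      using eventually_ge_at_top[of 1]
    proof eventually_elim
      case (elim n)
      have "expectation (X n) - expectation (\<lambda>x. 1 / 2 * h x) = expectation (\<lambda>x. X n x - 1 / 2 * h x)"
        by (intro Bochner_Integration.integral_diff[symmetric] L2_integrable XL2[OF elim] hh)
      then show ?case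
        using L2_expectation_le[OF L2_diff[OF XL2[OF elim] hh]] by simp
    qed
  qed
  have lim: "(\<lambda>n. (- (real n * (1 - measure (Q n) (S n))) - (L2_norm M (X n))\<^sup>2) * (1 / sqrt n) / 2)
      \<longlonglongrightarrow> (- 0 - (L2_norm M (\<lambda>x. 1 / 2 * h x))\<^sup>2) * 0 / 2"
    by (intro tendsto_intros p Xn) (real_asymp, simp)
  have "(\<lambda>n. expectation (X n)) \<longlonglongrightarrow> 0"
  proof (rule Lim_transform_eventually[OF lim[simplified]])
    show "\<forall>\<^sub>F n in sequentially.
        (- (real n * (1 - measure (Q n) (S n))) - (L2_norm M (X n))\<^sup>2) / (sqrt n * 2) = expectation (X n)"
      using eventually_ge_at_top[of 1]
    proof eventually_elim
      case (elim n)
      define q where "q = sqrt n"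
      have q: "0 < q" "real n = q\<^sup>2"
        using elim by (simp_all add: q_def)
      note rn = rL2[OF elim]
      have EXn: "expectation (X n) = q * (expectation (r n) - 1)"
        unfolding X_def q_def using L2_integrable[OF rn] by (simp add: prob_space)
      have "L2_norm M (X n) = q * L2_norm M (\<lambda>x. r n x - 1)"
        unfolding X_def L2_norm_scale q_def by simp
      then have "(L2_norm M (X n))\<^sup>2 = q\<^sup>2 * expectation (\<lambda>x. (r n x)\<^sup>2 + 1 - 2 * r n x)"
        by (simp add: power_mult_distrib L2_norm_sq power2_diff)
      also have "expectation (\<lambda>x. (r n x)\<^sup>2 + 1 - 2 * r n x) =
          measure (Q n) (S n) - 2 * expectation (r n) + 1"
        unfolding rp[OF elim, symmetric] L2_norm_sq
        using L2_integrable[OF rn] L2_integrable_sq[OF rn] by (simp add: prob_space)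
      finally show ?case
        unfolding EXn q_def[symmetric] q(2) using q(1) by (simp add: field_simps power2_eq_square)
    qed
  qed
  from LIMSEQ_unique[OF EX this] show ?thesis
    using hL2 by (simp add: L2_zero_def)
qed

end

section \<open>From differentiable curves and tangents to score sequences\<close>

text \<open>Since \<open>t n * sqrt n\<close> tends to \<open>c\<close>, the rates o(|t|) and o(t^2)
  along the curve become o(1 / sqrt n) and o(1 / n), the rates that \<open>score_sequence\<close>
  records after scaling.\<close>

lemma L2_diff_curve_score_sequence:
  assumes P: "\<P> \<subseteq> space (prob_algebra M)" "P0 \<in> \<P>"
    and curve: "L2_diff_curve \<P> P0 \<epsilon> f g"
    and t: "t \<longlonglongrightarrow> 0" "(\<lambda>n. t n * sqrt (real n)) \<longlonglongrightarrow> c" "0 < c"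
    and Q: "\<And>n. 1 \<le> n \<Longrightarrow> \<bar>t n\<bar> < \<epsilon> \<and> Q n = f (t n)"
  shows "score_sequence P0 Q (\<lambda>x. c * g x)"
proof -
  have P0: "prob_space P0" and P0M: "sets P0 = sets M"
    using P by (auto simp: space_prob_algebra)
  interpret P0: prob_space P0 by fact
  obtain L where L: "\<And>t. \<bar>t\<bar> < \<epsilon> \<Longrightarrow> density_quotient (f t) P0 (L t)"
    and o1: "(\<lambda>t. L2_norm P0 (\<lambda>x. 2 * (sqrt (enn2real (L t x)) - 1) - t * g x)) \<in> o[at 0](\<lambda>t. \<bar>t\<bar>)"
    and o2: "(\<lambda>t. measure (f t) {x \<in> space (f t). L t x = \<infinity>}) \<in> o[at 0](\<lambda>t. t\<^sup>2)"
    and f: "\<And>t. \<bar>t\<bar> < \<epsilon> \<Longrightarrow> f t \<in> \<P>" and g: "g \<in> L2 P0"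
    using curve unfolding L2_diff_curve_def by blast
  \<comment> \<open>On \<open>S n\<close> the density quotient is finite and \<open>enn2real\<close>
    loses nothing; the mass of \<open>Q n\<close> off \<open>S n\<close> is the singular
    part.\<close>
  define r where "r n x = sqrt (enn2real (L (t n) x))" for n x
  define S where "S n = {x \<in> space P0. L (t n) x < \<infinity>}" for n
  \<comment> \<open>The positive limit \<open>c\<close> keeps \<open>t n\<close> away from 0, where
    the quotients below are undefined and the limit at 0 says nothing.\<close>
  have pos: "\<forall>\<^sub>F n in sequentially. t n \<noteq> 0"
    using order_tendstoD(1)[OF t(2) t(3)] by eventually_elim auto
  have at0: "filterlim t (at 0) sequentially"
    using t(1) pos by (simp add: filterlim_at)
  have QP: "prob_space (Q n)" and Qsets: "sets (Q n) = sets P0" if "1 \<le> n" for n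
    using Q[OF that] f P(1) P0M by (auto simp: space_prob_algebra)
  have Lm: "L (t n) \<in> borel_measurable P0"
    and Lq: "\<And>A. A \<in> sets P0 \<Longrightarrow>
      emeasure (Q n) A = (\<integral>\<^sup>+x\<in>A. L (t n) x \<partial>P0) + emeasure (Q n) (A \<inter> {x. L (t n) x = \<infinity>})"
    and L1: "measure P0 (S n) = 1" if "1 \<le> n" for n
    using L[of "t n"] Q[OF that] by (auto simp: density_quotient_def S_def)
  have rm: "r n \<in> borel_measurable P0" and Sm: "S n \<in> sets P0" if "1 \<le> n" for n
    using Lm[OF that] unfolding r_def S_def by measurable
  have dens: "density (Q n) (indicator (S n)) = density P0 (\<lambda>x. ennreal ((r n x)\<^sup>2))" if n: "1 \<le> n" for n
  proof (rule measure_eqI)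
    note [measurable] = Lm[OF n] rm[OF n] Sm[OF n]
    show "sets (density (Q n) (indicator (S n))) = sets (density P0 (\<lambda>x. ennreal ((r n x)\<^sup>2)))"
      using Qsets[OF n] by simp
    fix A assume "A \<in> sets (density (Q n) (indicator (S n)))"
    then have AQ: "A \<in> sets (Q n)" and A [measurable]: "A \<in> sets P0"
      using Qsets[OF n] by auto
    have SQ: "S n \<in> sets (Q n)"
      using Sm[OF n] Qsets[OF n] by simp
    \<comment> \<open>Where the quotient is infinite, \<open>enn2real\<close> returns 0, so the
      square of \<open>r n\<close> agrees with it only up to this null set of
      \<open>P0\<close>.\<close>
    have "AE x in P0. x \<in> S n"
      using L1[OF n] Sm[OF n] by (simp add: P0.AE_in_set_eq_1)
    then have ae: "AE x in P0. L (t n) x * indicator (S n \<inter> A) x = ennreal ((r n x)\<^sup>2) * indicator A x"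
      by eventually_elim (auto simp: S_def r_def indicator_def)
    have "emeasure (density (Q n) (indicator (S n))) A = emeasure (Q n) (S n \<inter> A)"
      by (rule emeasure_restricted[OF SQ AQ])
    also have "\<dots> = (\<integral>\<^sup>+x. L (t n) x * indicator (S n \<inter> A) x \<partial>P0) +
        emeasure (Q n) ((S n \<inter> A) \<inter> {x. L (t n) x = \<infinity>})"
      using Lq[OF n, of "S n \<inter> A"] by simp
    also have "(S n \<inter> A) \<inter> {x. L (t n) x = \<infinity>} = {}"
      by (auto simp: S_def)
    also have "(\<integral>\<^sup>+x. L (t n) x * indicator (S n \<inter> A) x \<partial>P0) =
        (\<integral>\<^sup>+x. ennreal ((r n x)\<^sup>2) * indicator A x \<partial>P0)"
      by (rule nn_integral_cong_AE[OF ae])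
    also have "\<dots> = emeasure (density P0 (\<lambda>x. ennreal ((r n x)\<^sup>2))) A"
      by (rule emeasure_density[symmetric]) measurable
    finally show "emeasure (density (Q n) (indicator (S n))) A =
        emeasure (density P0 (\<lambda>x. ennreal ((r n x)\<^sup>2))) A"
      by simp
  qed
  have sing: "(\<lambda>n. real n * (1 - measure (Q n) (S n))) \<longlonglongrightarrow> 0"
  proof -
    let ?m = "\<lambda>t. measure (f t) {x \<in> space (f t). L t x = \<infinity>} / t\<^sup>2"
    have "(?m \<longlongrightarrow> 0) (at 0)"
      by (rule smalloD_tendsto[OF o2])
    from filterlim_compose[OF this at0]
    have "(\<lambda>n. (t n * sqrt n)\<^sup>2 * ?m (t n)) \<longlonglongrightarrow> c\<^sup>2 * 0"
      by (intro tendsto_mult tendsto_power t(2))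
    then have "(\<lambda>n. (t n * sqrt n)\<^sup>2 * ?m (t n)) \<longlonglongrightarrow> 0"
      by simp
    then show ?thesis
    proof (rule Lim_transform_eventually)
      show "\<forall>\<^sub>F n in sequentially. (t n * sqrt n)\<^sup>2 * ?m (t n) = real n * (1 - measure (Q n) (S n))"
        using pos eventually_ge_at_top[of 1]
      proof eventually_elim
        case (elim n)
        interpret Qn: prob_space "Q n" by (rule QP[OF elim(2)])
        have sp: "space (Q n) = space P0"
          by (rule sets_eq_imp_space_eq[OF Qsets[OF elim(2)]])
        have "S n \<in> sets (Q n)"
          using Sm[OF elim(2)] Qsets[OF elim(2)] by simp
        then have "1 - measure (Q n) (S n) = measure (Q n) (space (Q n) - S n)"
          by (rule Qn.prob_compl[symmetric])
        also have "space (Q n) - S n = {x \<in> space (f (t n)). L (t n) x = \<infinity>}"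
          using Q[OF elim(2)] sp by (auto simp: S_def not_less top_unique)
        finally show ?case
          using elim(1) Q[OF elim(2)] by (simp add: power_mult_distrib)
      qed
    qed
  qed
  have test0: "is_test (prod_power n P0) (\<lambda>_. 0)" for n
    by (simp add: is_test_def)
  have rL2: "r n \<in> L2 P0" if "1 \<le> n" for n
    using P0.prod_power_total_variation(1)[of "Q n" "S n" "r n" "\<lambda>_. 1" n "\<lambda>_. 0"]
      QP[OF that] Qsets[OF that] Sm[OF that] rm[OF that] dens[OF that] P0.L2_const[of 1]
      P0.L2_norm_const[of 1] test0[of n] by auto
  have root: "(\<lambda>n. L2_norm P0 (\<lambda>x. sqrt n * (r n x - 1) - c * g x / 2)) \<longlonglongrightarrow> 0"
  proof -
    let ?q = "\<lambda>t. L2_norm P0 (\<lambda>x. 2 * (sqrt (enn2real (L t x)) - 1) - t * g x) / \<bar>t\<bar>"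
    have "(?q \<longlongrightarrow> 0) (at 0)"
      by (rule smalloD_tendsto[OF o1])
    from filterlim_compose[OF this at0]
    have "(\<lambda>n. \<bar>t n * sqrt n\<bar> / 2 * ?q (t n) + \<bar>t n * sqrt n - c\<bar> / 2 * L2_norm P0 g) \<longlonglongrightarrow>
        \<bar>c\<bar> / 2 * 0 + \<bar>c - c\<bar> / 2 * L2_norm P0 g"
      by (intro tendsto_intros t(2)) auto
    then have lim: "(\<lambda>n. \<bar>t n * sqrt n\<bar> / 2 * ?q (t n) + \<bar>t n * sqrt n - c\<bar> / 2 * L2_norm P0 g) \<longlonglongrightarrow> 0"
      by simp
    show ?thesis
    proof (rule Lim_null_comparison[OF _ lim])
      show "\<forall>\<^sub>F n in sequentially. norm (L2_norm P0 (\<lambda>x. sqrt n * (r n x - 1) - c * g x / 2)) \<le>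
          \<bar>t n * sqrt n\<bar> / 2 * ?q (t n) + \<bar>t n * sqrt n - c\<bar> / 2 * L2_norm P0 g"
        using pos eventually_ge_at_top[of 1]
      proof eventually_elim
        case (elim n)
        have 1: "(\<lambda>x. 2 * (r n x - 1) - t n * g x) \<in> L2 P0"
          by (intro L2_diff L2_scale rL2 g P0.L2_const elim(2))
        \<comment> \<open>Split into the differentiability error of the curve and the error of
          \<open>t n * sqrt n\<close> against its limit.\<close>
        have "L2_norm P0 (\<lambda>x. sqrt n * (r n x - 1) - c * g x / 2) =
            L2_norm P0 (\<lambda>x. sqrt n / 2 * (2 * (r n x - 1) - t n * g x) + (t n * sqrt n - c) / 2 * g x)"
          by (intro arg_cong[where f = "L2_norm P0"] ext) (simp add: field_simps)
        also have "\<dots> \<le> L2_norm P0 (\<lambda>x. sqrt n / 2 * (2 * (r n x - 1) - t n * g x)) +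
            L2_norm P0 (\<lambda>x. (t n * sqrt n - c) / 2 * g x)"
          by (intro L2_norm_triangle L2_scale 1 g)
        also have "\<dots> = \<bar>t n * sqrt n\<bar> / 2 * ?q (t n) + \<bar>t n * sqrt n - c\<bar> / 2 * L2_norm P0 g"
          unfolding L2_norm_scale using elim(1) by (simp add: r_def abs_mult)
        finally show ?case
          by simp
      qed
    qed
  qed
  show ?thesis
    unfolding score_sequence_def
    using L2_scale[OF g, of c] QP Qsets rm Sm dens sing root by blast
qed

lemma tangent_cone_L2: "g \<in> tangent_cone P0 \<P> \<Longrightarrow> g \<in> L2 P0"
  by (auto simp: tangent_cone_def L2_diff_curve_def)

lemma tangent_space_combination:
  assumes "g1 \<in> tangent_cone P0 \<P>" "g2 \<in> tangent_cone P0 \<P>"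
  shows "(\<lambda>x. a * g1 x + b * g2 x) \<in> tangent_space P0 \<P>"
proof -
  have "(\<lambda>x. a * g1 x + b * g2 x) \<in> fun_span (tangent_cone P0 \<P>)"
  \<comment> \<open>\<open>fun_span\<close> sums over a set of functions, so a repeated function
    occurs once and needs the coefficient \<open>a + b\<close>.\<close>
  proof (cases "g1 = g2")
    case True
    have "(\<lambda>x. a * g1 x + b * g2 x) = (\<lambda>x. \<Sum>g\<in>{g1}. (a + b) * g x)"
      using True by (simp add: algebra_simps)
    then show ?thesis
      using assms unfolding fun_span_def by (auto intro!: exI[of _ "{g1}"] exI[of _ "\<lambda>_. a + b"])
  next
    case False
    have "(\<lambda>x. a * g1 x + b * g2 x) = (\<lambda>x. \<Sum>g\<in>{g1, g2}. (if g = g1 then a else b) * g x)"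
      using False by auto
    then show ?thesis
      using assms unfolding fun_span_def
      by (auto intro!: exI[of _ "{g1, g2}"] exI[of _ "\<lambda>g. if g = g1 then a else b"])
  qed
  moreover have "(\<lambda>x. a * g1 x + b * g2 x) \<in> L2 P0"
    by (intro L2_add L2_scale tangent_cone_L2[OF assms(1)] tangent_cone_L2[OF assms(2)])
  ultimately show ?thesis
    unfolding tangent_space_def L2_closure_def
    by (auto intro!: bexI[of _ "\<lambda>x. a * g1 x + b * g2 x"] simp: L2_norm_def)
qed

text \<open>The gradient concerns the one-sided limit \<open>t \<down> 0\<close>; it applies because
  the positive limit of \<open>t n * sqrt n\<close> makes \<open>t n\<close> eventually
  positive.\<close>

lemma L2_diff_curve_gradient_limit:
  assumes grad: "is_gradient P0 \<P> k kd" and curve: "L2_diff_curve \<P> P0 \<epsilon> f g"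
    and t: "t \<longlonglongrightarrow> 0" "(\<lambda>n. t n * sqrt (real n)) \<longlonglongrightarrow> c" "0 < c"
    and Q: "\<And>n. 1 \<le> n \<Longrightarrow> Q n = f (t n)"
  shows "(\<lambda>n. sqrt (real n) * (k (Q n) - k P0)) \<longlonglongrightarrow> (\<integral>x. kd x * (c * g x) \<partial>P0)"
proof -
  have pos: "\<forall>\<^sub>F n in sequentially. 0 < t n"
    using order_tendstoD(1)[OF t(2) t(3)] by eventually_elim (auto simp: zero_less_mult_iff)
  have right: "filterlim t (at_right 0) sequentially"
    using t(1) pos unfolding filterlim_at by (auto elim: eventually_mono)
  have "((\<lambda>t. (k (f t) - k P0) / t) \<longlongrightarrow> (\<integral>x. kd x * g x \<partial>P0)) (at_right 0)"
    using grad curve by (auto simp: is_gradient_def)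
  from filterlim_compose[OF this right]
  have "(\<lambda>n. t n * sqrt n * ((k (f (t n)) - k P0) / t n)) \<longlonglongrightarrow> c * (\<integral>x. kd x * g x \<partial>P0)"
    by (intro tendsto_mult t(2))
  also have "c * (\<integral>x. kd x * g x \<partial>P0) = (\<integral>x. kd x * (c * g x) \<partial>P0)"
    unfolding integral_mult_right_zero[symmetric] by (simp add: ac_simps)
  finally show ?thesis
  proof (rule Lim_transform_eventually)
    show "\<forall>\<^sub>F n in sequentially. t n * sqrt n * ((k (f (t n)) - k P0) / t n) =
        sqrt (real n) * (k (Q n) - k P0)"
      using pos eventually_ge_at_top[of 1] by eventually_elim (simp add: Q)
  qed
qed

lemma F1_score_sequence:
  assumes P: "\<P> \<subseteq> space (prob_algebra M)" "P0 \<in> \<P>" and grad: "is_gradient P0 \<P> k kd"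
    and Q: "Q \<in> F1 P0 \<P>"
  obtains c g where "0 < c" "g \<in> tangent_cone P0 \<P>" "score_sequence P0 Q (\<lambda>x. c * g x)"
    "(\<lambda>n. sqrt (real n) * (k (Q n) - k P0)) \<longlonglongrightarrow> (\<integral>x. kd x * (c * g x) \<partial>P0)"
proof -
  obtain t c \<epsilon> f g where t: "t \<longlonglongrightarrow> 0" "(\<lambda>n. t n * sqrt (real n)) \<longlonglongrightarrow> c" "0 < c"
    and curve: "L2_diff_curve \<P> P0 \<epsilon> f g" and Qn: "\<And>n. 1 \<le> n \<Longrightarrow> \<bar>t n\<bar> < \<epsilon> \<and> Q n = f (t n)"
    using Q unfolding F1_def by blast
  show thesis
  proof (rule that[OF t(3)])
    show "g \<in> tangent_cone P0 \<P>"
      using curve by (auto simp: tangent_cone_def)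
    show "score_sequence P0 Q (\<lambda>x. c * g x)"
      by (rule L2_diff_curve_score_sequence[OF P curve t Qn])
    show "(\<lambda>n. sqrt (real n) * (k (Q n) - k P0)) \<longlonglongrightarrow> (\<integral>x. kd x * (c * g x) \<partial>P0)"
      by (rule L2_diff_curve_gradient_limit[OF grad curve t]) (simp add: Qn)
  qed
qed

text \<open>The converse of \<open>F1_score_sequence\<close>: sampling a curve at
  \<open>1 / sqrt n\<close> gives \<open>c = 1\<close>, so every tangent is itself a local
  parameter.\<close>

lemma tangent_cone_F1:
  assumes P: "\<P> \<subseteq> space (prob_algebra M)" "P0 \<in> \<P>" and grad: "is_gradient P0 \<P> k kd"
    and g: "g \<in> tangent_cone P0 \<P>"
  obtains Q where "Q \<in> F1 P0 \<P>" "score_sequence P0 Q g"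
    "(\<lambda>n. sqrt (real n) * (k (Q n) - k P0)) \<longlonglongrightarrow> (\<integral>x. kd x * g x \<partial>P0)"
proof -
  obtain \<epsilon> f where curve: "L2_diff_curve \<P> P0 \<epsilon> f g"
    using g by (auto simp: tangent_cone_def)
  then have \<epsilon>: "0 < \<epsilon>"
    by (simp add: L2_diff_curve_def)
  \<comment> \<open>\<open>F1\<close> demands points inside the domain of the curve for every
    \<open>n \<ge> 1\<close>, so the finitely many sample points outside it are moved to 0.\<close>
  define t where "t n = (if 1 / sqrt (real n) < \<epsilon> then 1 / sqrt (real n) else 0)" for n :: nat
  have inv: "(\<lambda>n::nat. 1 / sqrt (real n)) \<longlonglongrightarrow> 0"
    by real_asymp
  have ev: "\<forall>\<^sub>F n in sequentially. t n = 1 / sqrt (real n)"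
    using order_tendstoD(2)[OF inv \<epsilon>] by eventually_elim (simp add: t_def)
  have t1: "t \<longlonglongrightarrow> 0"
    using inv ev by (simp add: tendsto_cong)
  have "\<forall>\<^sub>F n in sequentially. t n * sqrt (real n) = 1"
    using ev eventually_gt_at_top[of 0] by eventually_elim simp
  then have t2: "(\<lambda>n. t n * sqrt (real n)) \<longlonglongrightarrow> 1"
    by (rule tendsto_eventually)
  have tn: "\<bar>t n\<bar> < \<epsilon>" for n
    using \<epsilon> by (simp add: t_def)
  show thesis
  proof (rule that)
    show "(\<lambda>n. f (t n)) \<in> F1 P0 \<P>"
      unfolding F1_def using t1 t2 curve tn zero_less_one by blast
    show "score_sequence P0 (\<lambda>n. f (t n)) g"
      using L2_diff_curve_score_sequence[OF P curve t1 t2 zero_less_one, of "\<lambda>n. f (t n)"] tn by simp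
    show "(\<lambda>n. sqrt (real n) * (k (f (t n)) - k P0)) \<longlonglongrightarrow> (\<integral>x. kd x * g x \<partial>P0)"
      using L2_diff_curve_gradient_limit[OF grad curve t1 t2 zero_less_one, of "\<lambda>n. f (t n)"] by simp
  qed
qed

theorem mainTheorem9:
  fixes M :: "'a measure"
    and \<P> :: "'a measure set"
    and P0 :: "'a measure"
    and k :: "'a measure \<Rightarrow> real"
    and kc :: "'a \<Rightarrow> real"
    and \<alpha> :: real
  assumes "\<P> \<noteq> {}"
    and "\<P> \<subseteq> space (prob_algebra M)"
    and "P0 \<in> \<P>"
    and "is_canonical_gradient P0 \<P> k kc"
    and "(\<integral>x. (kc x)\<^sup>2 \<partial>P0) \<noteq> 0"
    and "0 < \<alpha>" and "\<alpha> < 1"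
    and "tangent_cone P0 \<P> = tangent_space P0 \<P>"
  shows "asymp_optimal_in (F1 P0 \<P>)
           (asymp_unbiased M \<alpha> (H4 P0 \<P> k) (K4 P0 \<P> k))
           (two_sided_test P0 kc \<alpha>)"
proof -
  note P = assms(2,3)
  have "prob_space P0" and sets: "sets P0 = sets M"
    using P by (auto simp: space_prob_algebra)
  then interpret P0: prob_space P0 by simp
  have grad: "is_gradient P0 \<P> k kc" and kcT: "kc \<in> tangent_cone P0 \<P>"
    using assms(4,8) by (auto simp: is_canonical_gradient_def)
  have kc0: "kc \<in> L2_zero P0"
    using grad by (simp add: is_gradient_def)
  then have kcL2: "kc \<in> L2 P0"
    by (simp add: L2_zero_def)
  note [measurable] = L2_measurable[OF kcL2]
  define \<sigma> where "\<sigma> = L2_norm P0 kc"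
  have \<sigma>: "0 < \<sigma>"
  proof -
    have "0 \<le> (\<integral>x. (kc x)\<^sup>2 \<partial>P0)"
      by simp
    then show ?thesis
      using assms(5) by (simp add: \<sigma>_def L2_norm_def less_le)
  qed
  define \<kappa> where "\<kappa> x = 1 / \<sigma> * kc x" for x
  have \<kappa>L2: "\<kappa> \<in> L2 P0"
    unfolding \<kappa>_def by (rule L2_scale[OF kcL2])
  have \<kappa>1: "L2_norm P0 \<kappa> = 1"
    unfolding \<kappa>_def L2_norm_scale using \<sigma> by (simp add: \<sigma>_def)
  have \<kappa>0: "\<kappa> \<in> L2_zero P0"
    using \<kappa>L2 kc0 unfolding \<kappa>_def[abs_def] by (simp add: L2_zero_def)
  have kc\<kappa>: "kc x = \<sigma> * \<kappa> x" for x
    using \<sigma> by (simp add: \<kappa>_def)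
  define u where "u = std_normal_quantile (1 - \<alpha> / 2)"
  have u: "0 < u"
    unfolding u_def using assms(6,7) by (intro std_normal_quantile_pos) auto
  \<comment> \<open>Both tails of the two-sided test have probability
    \<open>\<alpha> / 2\<close>.\<close>
  have level: "gauss_power u 0 = \<alpha>"
    using std_normal_cdf_quantile[of "1 - \<alpha> / 2"] std_normal_cdf_uminus[of u] assms(6,7)
    by (simp add: gauss_power_def u_def)
  define \<phi> where "\<phi> = (\<lambda>n \<omega>. if u < \<bar>normalized_sum n \<kappa> \<omega>\<bar> then 1 else 0 :: real)"
  have \<phi>_eq: "two_sided_test P0 kc \<alpha> = \<phi>"
  proof (intro ext)
    fix n and \<omega> :: "nat \<Rightarrow> 'a"
    have "1 / sqrt n * (\<Sum>i<n. kc (\<omega> i)) = \<sigma> * normalized_sum n \<kappa> \<omega>"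
      unfolding normalized_sum_def kc\<kappa> sum_distrib_left[symmetric] by simp
    then have "\<bar>1 / sqrt n * (\<Sum>i<n. kc (\<omega> i))\<bar> = \<sigma> * \<bar>normalized_sum n \<kappa> \<omega>\<bar>"
      using \<sigma> by (simp add: abs_mult)
    then show "two_sided_test P0 kc \<alpha> n \<omega> = \<phi> n \<omega>"
      unfolding two_sided_test_def \<phi>_def u_def[symmetric] \<sigma>_def[symmetric]
      using \<sigma> by (simp add: mult.commute[of u])
  qed
  have prod_sets: "sets (prod_power n P0) = sets (prod_power n M)" for n
    by (intro sets_PiM_cong) (auto simp: sets)
  have test_eq: "is_test (prod_power n M) \<psi> \<longleftrightarrow> is_test (prod_power n P0) \<psi>" for n and \<psi> :: "(nat \<Rightarrow> 'a) \<Rightarrow> real"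
    unfolding is_test_def sets_eq_imp_space_eq[OF prod_sets] measurable_cong_sets[OF prod_sets refl] ..
  have \<phi>_test: "is_test (prod_power n M) (\<phi> n)" for n
  proof -
    have [measurable]: "\<kappa> \<in> borel_measurable P0"
      by (rule L2_measurable[OF \<kappa>L2])
    show ?thesis
      unfolding test_eq unfolding is_test_def \<phi>_def by auto
  qed
  let ?\<theta> = "\<lambda>h. \<integral>x. h x * \<kappa> x \<partial>P0"
  have gradient_limit: "(\<integral>x. kc x * h x \<partial>P0) = \<sigma> * ?\<theta> h" for h
    unfolding kc\<kappa> integral_mult_right_zero[symmetric] by (simp add: ac_simps)
  \<comment> \<open>The scaled increments of \<open>k\<close> tend to \<open>\<sigma>\<close> times
    the coordinate of the local parameter along \<open>\<kappa>\<close>. As \<open>\<sigma>\<close>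
    is positive, implicit hypotheses are exactly the sequences whose coordinate is 0, and that
    coordinate is also the shift in the limiting power.\<close>
  have sequences: "\<exists>c g. g \<in> tangent_cone P0 \<P> \<and> score_sequence P0 Q (\<lambda>x. c * g x) \<and>
      (\<lambda>n. test_power \<phi> Q n) \<longlonglongrightarrow> gauss_power u (?\<theta> (\<lambda>x. c * g x)) \<and>
      (Q \<in> H4 P0 \<P> k \<longleftrightarrow> ?\<theta> (\<lambda>x. c * g x) = 0)" if Q: "Q \<in> F1 P0 \<P>" for Q
  proof -
    obtain c g where cg: "0 < c" "g \<in> tangent_cone P0 \<P>" "score_sequence P0 Q (\<lambda>x. c * g x)"
      and lim: "(\<lambda>n. sqrt (real n) * (k (Q n) - k P0)) \<longlonglongrightarrow> \<sigma> * ?\<theta> (\<lambda>x. c * g x)"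
      using F1_score_sequence[OF P grad Q] unfolding gradient_limit by blast
    have "(\<lambda>n. test_power \<phi> Q n) \<longlonglongrightarrow> gauss_power u (?\<theta> (\<lambda>x. c * g x))"
      unfolding \<phi>_def using u
      by (intro P0.score_sequence_two_sided_limit cg P0.score_sequence_mean_zero[OF cg(3)] \<kappa>0 \<kappa>1) auto
    moreover have "Q \<in> H4 P0 \<P> k \<longleftrightarrow> ?\<theta> (\<lambda>x. c * g x) = 0"
    proof
      assume "Q \<in> H4 P0 \<P> k"
      then have "(\<lambda>n. sqrt (real n) * (k (Q n) - k P0)) \<longlonglongrightarrow> 0"
        by (simp add: H4_def)
      from LIMSEQ_unique[OF lim this] show "?\<theta> (\<lambda>x. c * g x) = 0"
        using \<sigma> by simp
    next
      assume "?\<theta> (\<lambda>x. c * g x) = 0"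
      then show "Q \<in> H4 P0 \<P> k"
        using lim Q by (simp add: H4_def)
    qed
    ultimately show ?thesis
      using cg by blast
  qed
  have \<phi>_in: "\<phi> \<in> asymp_unbiased M \<alpha> (H4 P0 \<P> k) (K4 P0 \<P> k)"
    unfolding asymp_unbiased_def
  proof (intro CollectI conjI ballI allI impI)
    show "is_test (prod_power n M) (\<phi> n)" for n
      by (rule \<phi>_test)
    fix Q assume Q: "Q \<in> H4 P0 \<P> k"
    then have "Q \<in> F1 P0 \<P>"
      by (simp add: H4_def)
    then have "(\<lambda>n. test_power \<phi> Q n) \<longlonglongrightarrow> \<alpha>"
      using sequences[of Q] Q level by auto
    then have "limsup (\<lambda>n. ereal (test_power \<phi> Q n)) = ereal \<alpha>"
      by (intro lim_imp_Limsup) auto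
    then show "limsup (\<lambda>n. ereal (test_power \<phi> Q n)) \<le> ereal \<alpha>"
      by simp
  next
    fix Q assume "Q \<in> K4 P0 \<P> k"
    then have "Q \<in> F1 P0 \<P>"
      by (simp add: K4_def)
    then obtain \<theta> where "(\<lambda>n. test_power \<phi> Q n) \<longlonglongrightarrow> gauss_power u \<theta>"
      using sequences[of Q] by blast
    then have "liminf (\<lambda>n. ereal (test_power \<phi> Q n)) = ereal (gauss_power u \<theta>)"
      by (intro lim_imp_Liminf) auto
    then show "ereal \<alpha> \<le> liminf (\<lambda>n. ereal (test_power \<phi> Q n))"
      using gauss_power_ge[of u \<theta>] u level by simp
  qed
  have optimal: "limsup (\<lambda>n. ereal (test_power \<psi> Q n)) \<le> ereal (lim (test_power \<phi> Q))"
    if \<psi>: "\<psi> \<in> asymp_unbiased M \<alpha> (H4 P0 \<P> k) (K4 P0 \<P> k)" and Q: "Q \<in> F1 P0 \<P>" for \<psi> Q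
  proof -
    obtain c g where g: "g \<in> tangent_cone P0 \<P>" and score: "score_sequence P0 Q (\<lambda>x. c * g x)"
      and pow: "(\<lambda>n. test_power \<phi> Q n) \<longlonglongrightarrow> gauss_power u (?\<theta> (\<lambda>x. c * g x))"
      and H4: "Q \<in> H4 P0 \<P> k \<longleftrightarrow> ?\<theta> (\<lambda>x. c * g x) = 0"
      using sequences[OF Q] by blast
    define s where "s = ?\<theta> (\<lambda>x. c * g x)"
    have lim: "lim (test_power \<phi> Q) = gauss_power u s"
      unfolding s_def using pow by (rule limI)
    have "limsup (\<lambda>n. ereal (test_power \<psi> Q n)) \<le> ereal (gauss_power u s)"
    \<comment> \<open>For \<open>s = 0\<close> the sequence is itself an implicit hypothesis, and
      the bound is the level condition on \<open>\<psi>\<close>.\<close>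
    proof (cases "s = 0")
      case True
      then show ?thesis
        using \<psi> H4 level unfolding s_def by (auto simp: asymp_unbiased_def)
    next
      case False
      have h0: "(\<lambda>x. c * g x) \<in> L2_zero P0"
        by (rule P0.score_sequence_mean_zero[OF score])
      then have hL2: "(\<lambda>x. c * g x) \<in> L2 P0"
        by (simp add: L2_zero_def)
      \<comment> \<open>The component of the local parameter orthogonal to \<open>\<kappa>\<close>;
        adding \<open>r * \<kappa>\<close> to it then yields the coordinate
        \<open>r\<close>.\<close>
      define \<eta> where "\<eta> x = c * g x - s * \<kappa> x" for x
      have \<eta>L2: "\<eta> \<in> L2 P0"
        unfolding \<eta>_def by (intro L2_diff L2_scale \<kappa>L2 hL2)
      have \<eta>0: "\<eta> \<in> L2_zero P0"
        using \<eta>L2 h0 \<kappa>0 P0.L2_integrable[OF hL2] P0.L2_integrable[OF \<kappa>L2]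
        unfolding \<eta>_def[abs_def] by (auto simp: L2_zero_def)
      have shift: "?\<theta> (\<lambda>x. \<eta> x + r * \<kappa> x) = r" for r
      proof -
        have "?\<theta> (\<lambda>x. \<eta> x + r * \<kappa> x) = (\<integral>x. c * g x * \<kappa> x + (r - s) * (\<kappa> x)\<^sup>2 \<partial>P0)"
          by (intro Bochner_Integration.integral_cong refl)
            (simp add: \<eta>_def power2_eq_square algebra_simps)
        also have "\<dots> = s + (r - s) * (L2_norm P0 \<kappa>)\<^sup>2"
          unfolding L2_norm_sq s_def
          using L2_integrable_mult[OF hL2 \<kappa>L2] L2_integrable_sq[OF \<kappa>L2] by simp
        finally show ?thesis
          by (simp add: \<kappa>1)
      qed
      \<comment> \<open>Here the equality of cone and space enters: the points of the line are
        linear combinations of two tangents, hence again tangents of curves.\<close>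
      have tangent: "(\<lambda>x. \<eta> x + r * \<kappa> x) \<in> tangent_cone P0 \<P>" for r
      proof -
        have "(\<lambda>x. \<eta> x + r * \<kappa> x) = (\<lambda>x. c * g x + ((r - s) / \<sigma>) * kc x)"
          by (simp add: \<eta>_def \<kappa>_def algebra_simps diff_divide_distrib)
        then show ?thesis
          using tangent_space_combination[OF g kcT, of c "(r - s) / \<sigma>"] assms(8) by (simp only:)
      qed
      \<comment> \<open>Each point of the line is realised by a sequence in \<open>F1\<close>, whose
        class is read off from \<open>r\<close>: an implicit hypothesis for \<open>r = 0\<close>, an
        implicit alternative otherwise.\<close>
      have local: "\<exists>R. R \<in> F1 P0 \<P> \<and> score_sequence P0 R (\<lambda>x. \<eta> x + r * \<kappa> x) \<and>
          (\<lambda>n. sqrt (real n) * (k (R n) - k P0)) \<longlonglongrightarrow> \<sigma> * r" for r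
        using tangent_cone_F1[OF P grad tangent[of r]] unfolding gradient_limit shift by blast
      obtain R0 where R0: "R0 \<in> F1 P0 \<P>" "score_sequence P0 R0 (\<lambda>x. \<eta> x + 0 * \<kappa> x)"
        "(\<lambda>n. sqrt (real n) * (k (R0 n) - k P0)) \<longlonglongrightarrow> \<sigma> * 0"
        using local[of 0] by blast
      show ?thesis
      proof (rule P0.unbiased_power_bound[OF \<kappa>0 \<kappa>1 \<eta>0 _ u False])
        show "(\<integral>x. \<eta> x * \<kappa> x \<partial>P0) = 0"
          using shift[of 0] by simp
        show "is_test (prod_power n P0) (\<psi> n)" if "1 \<le> n" for n
          using \<psi> that test_eq by (simp add: asymp_unbiased_def)
        show "score_sequence P0 Q (\<lambda>x. \<eta> x + s * \<kappa> x)"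
          using score by (simp add: \<eta>_def)
        show "score_sequence P0 R0 (\<lambda>x. \<eta> x + 0 * \<kappa> x)"
          by (rule R0(2))
        have "R0 \<in> H4 P0 \<P> k"
          using R0(1,3) by (simp add: H4_def)
        then show "limsup (\<lambda>n. ereal (test_power \<psi> R0 n)) \<le> ereal (gauss_power u 0)"
          using \<psi> unfolding level by (auto simp: asymp_unbiased_def)
        show "\<exists>R. score_sequence P0 R (\<lambda>x. \<eta> x + r * \<kappa> x) \<and>
            ereal (gauss_power u 0) \<le> liminf (\<lambda>n. ereal (test_power \<psi> R n))" if r: "r \<noteq> 0" for r
        proof -
          obtain R where R: "R \<in> F1 P0 \<P>" "score_sequence P0 R (\<lambda>x. \<eta> x + r * \<kappa> x)"
            "(\<lambda>n. sqrt (real n) * (k (R n) - k P0)) \<longlonglongrightarrow> \<sigma> * r"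
            using local[of r] by blast
          have "R \<in> K4 P0 \<P> k"
            using R(1,3) \<sigma> r by (auto simp: K4_def intro!: exI[of _ "\<sigma> * r"])
          then have "ereal \<alpha> \<le> liminf (\<lambda>n. ereal (test_power \<psi> R n))"
            using \<psi> by (auto simp: asymp_unbiased_def)
          then show ?thesis
            using R(2) unfolding level by blast
        qed
      qed
    qed
    then show ?thesis
      unfolding lim .
  qed
  show ?thesis
    unfolding asymp_optimal_in_def \<phi>_eq
  proof (intro conjI ballI \<phi>_in optimal)
    fix Q assume "Q \<in> F1 P0 \<P>"
    then show "convergent (test_power \<phi> Q)"
      using sequences[of Q] by (auto simp: convergent_def)
  qed
qed

end
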